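(* Fix $\delta\in(0,1)$, $r\in(0,1/2)$, $d\ge 4$ and $T\ge 4$. Let $P_X$ be the uniform distribution on the unit ball $\mathcal S^d$. Let $P_{Y|X}$ be any conditional label distribution whose Bayes classifier is $\mathrm{sgn}(w^*\cdot x)$ for some unit vector $w^*$ and which satisfies the Tsybakov noise condition (TNC) with parameters $\mu>0$ and $\alpha$ such that $1/(1+\log(1/r))\le\alpha<1$. Then the output $\widehat w=\widehat w_E$ of Algorithm 1 (a stream-based algorithm in $\mathcal A^{\mathrm{str}}_{d,T}$, run with inputs $d,T,\delta,r$, which uses no knowledge of $\alpha$ or $\mu$) satisfies, with probability at least $1-\delta$, $$\mathrm{err}(\widehat w)-\mathrm{err}(w^* )=\widetilde O\!\left(\left(\frac{d+\log(1/\delta)}{T}\right)^{1/(2\alpha)}\right),$$ where $\widetilde O$ hides multiplicative factors depending only on $r,\mu$ (and $\alpha$) and factors polylogarithmic in $T$ and $d$.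
   Context: $\mathcal S^d\subseteq\mathbb R^d$ is the unit ball, labels lie in $\{+1,-1\}$, $\log=\log_2$. For a unit vector $w$, $\mathrm{err}(w)=\Pr_{(x,y)\sim P_{XY}}[y\neq\mathrm{sgn}(w\cdot x)]$. $\theta(w,w')=\arccos(w\cdot w')$ is the angle between unit vectors, and $B_\theta(w,\beta)=\{w':\|w'\|_2=1,\ \theta(w',w)\le\beta\}$. Tsybakov noise condition (TNC) with parameters $\mu\in(0,\infty)$, $\alpha\in[0,1)$: for all unit vectors $w\in\mathbb R^d$, $\mu\,\theta(w,w^* )^{1/(1-\alpha)}\le \mathrm{err}(w)-\mathrm{err}(w^* )$. Algorithm 1 (inputs $d,T,\delta,r$): set $E=\tfrac12\log T$, $n=T/E$, $\beta_0=\pi$, and $\widehat w_0$ an arbitrary (random) unit vector. For $k=1,\dots,E$: set $b_{k-1}=+\infty$ if $k=1$ and $b_{k-1}=\frac{2\beta_{k-1}}{\sqrt d}\sqrt{E(1+\log(1/r))}$ if $k>1$; starting with $W=\emptyset$, repeatedly draw $x\sim P_X$, discard it if $|\widehat w_{k-1}\cdot x|>b_{k-1}$, and otherwise request its label $y$ and add $(x,y)$ to $W$, until $|W|=n$; let $\widehat w_k\in B_\theta(\widehat w_{k-1},\beta_{k-1})$ minimize the empirical error $\sum_{(x,y)\in W}I[y\,w\cdot x<0]$ over $w\in B_\theta(\widehat w_{k-1},\beta_{k-1})$; set $\beta_k=r\beta_{k-1}$. Output $\widehat w_E$. *)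

theory Defs
  imports "HOL-Probability.Probability"
begin

text \<open>Vectors of R^d are represented as functions nat => real, extensional on {..<d},
  so that the dimension d can be quantified inside the statement.\<close>

definition dotp :: "nat \<Rightarrow> (nat \<Rightarrow> real) \<Rightarrow> (nat \<Rightarrow> real) \<Rightarrow> real" where
  "dotp d w x = (\<Sum>i<d. w i * x i)"

definition unit_vecs :: "nat \<Rightarrow> (nat \<Rightarrow> real) set" where
  "unit_vecs d = {w. w \<in> extensional {..<d} \<and> (\<Sum>i<d. (w i)\<^sup>2) = 1}"

definition vangle :: "nat \<Rightarrow> (nat \<Rightarrow> real) \<Rightarrow> (nat \<Rightarrow> real) \<Rightarrow> real" where
  "vangle d w w' = arccos (dotp d w w')"

definition ball_theta :: "nat \<Rightarrow> (nat \<Rightarrow> real) \<Rightarrow> real \<Rightarrow> (nat \<Rightarrow> real) set" where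
  "ball_theta d w \<beta> = {w' \<in> unit_vecs d. vangle d w' w \<le> \<beta>}"

definition lebd :: "nat \<Rightarrow> (nat \<Rightarrow> real) measure" where
  "lebd d = PiM {..<d} (\<lambda>_. lborel)"

definition PX :: "nat \<Rightarrow> (nat \<Rightarrow> real) measure" where
  "PX d = uniform_measure (lebd d) {x \<in> space (lebd d). (\<Sum>i<d. (x i)\<^sup>2) \<le> 1}"

definition PXY :: "nat \<Rightarrow> ((nat \<Rightarrow> real) \<Rightarrow> real) \<Rightarrow> ((nat \<Rightarrow> real) \<times> real) measure" where
  "PXY d eta = density (PX d \<Otimes>\<^sub>M count_space {-1, 1})
     (\<lambda>(x, y). ennreal (if y = 1 then eta x else 1 - eta x))"

definition clf_err :: "nat \<Rightarrow> ((nat \<Rightarrow> real) \<Rightarrow> real) \<Rightarrow> ((nat \<Rightarrow> real) \<Rightarrow> real) \<Rightarrow> real" where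
  "clf_err d eta h = measure (PXY d eta) {p \<in> space (PXY d eta). snd p \<noteq> h (fst p)}"

definition err :: "nat \<Rightarrow> ((nat \<Rightarrow> real) \<Rightarrow> real) \<Rightarrow> (nat \<Rightarrow> real) \<Rightarrow> real" where
  "err d eta w = clf_err d eta (\<lambda>x. sgn (dotp d w x))"

definition bayes_classifier :: "nat \<Rightarrow> ((nat \<Rightarrow> real) \<Rightarrow> real) \<Rightarrow> (nat \<Rightarrow> real) \<Rightarrow> bool" where
  "bayes_classifier d eta wstar =
     (\<forall>h \<in> borel_measurable (PX d). (\<forall>x. h x \<in> {-1, 1}) \<longrightarrow>
        clf_err d eta (\<lambda>x. sgn (dotp d wstar x)) \<le> clf_err d eta h)"

definition TNC :: "nat \<Rightarrow> ((nat \<Rightarrow> real) \<Rightarrow> real) \<Rightarrow> (nat \<Rightarrow> real) \<Rightarrow> real \<Rightarrow> real \<Rightarrow> bool" where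
  "TNC d eta wstar \<mu> \<alpha> =
     (\<forall>w \<in> unit_vecs d. \<mu> * vangle d w wstar powr (1 / (1 - \<alpha>)) \<le> err d eta w - err d eta wstar)"

definition emp_err :: "nat \<Rightarrow> ((nat \<Rightarrow> real) \<times> real) list \<Rightarrow> (nat \<Rightarrow> real) \<Rightarrow> nat" where
  "emp_err d W w = length (filter (\<lambda>(x, y). y * dotp d w x < 0) W)"

definition is_erm :: "nat \<Rightarrow> ((nat \<Rightarrow> real) \<Rightarrow> real \<Rightarrow> ((nat \<Rightarrow> real) \<times> real) list \<Rightarrow> (nat \<Rightarrow> real)) \<Rightarrow> bool" where
  "is_erm d sel = (\<forall>w \<beta> W. w \<in> unit_vecs d \<longrightarrow> 0 \<le> \<beta> \<longrightarrow>
      sel w \<beta> W \<in> ball_theta d w \<beta> \<and>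
      (\<forall>v \<in> ball_theta d w \<beta>. emp_err d W (sel w \<beta> W) \<le> emp_err d W v))"

primrec collect :: "(nat \<Rightarrow> 'z) \<Rightarrow> ('z \<Rightarrow> bool) \<Rightarrow> nat \<Rightarrow> nat \<Rightarrow> 'z list \<times> nat" where
  "collect s P p 0 = ([], p)"
| "collect s P p (Suc m) =
     (let i = (LEAST i. p \<le> i \<and> P (s i));
          (L, q) = collect s P (Suc i) m
      in (s i # L, q))"

definition epochs :: "nat \<Rightarrow> nat" where
  "epochs T = nat \<lfloor>log 2 (real T) / 2\<rfloor>"

definition per_epoch :: "nat \<Rightarrow> nat" where
  "per_epoch T = T div epochs T"

primrec alg_run :: "nat \<Rightarrow> nat \<Rightarrow> real
    \<Rightarrow> ((nat \<Rightarrow> real) \<Rightarrow> real \<Rightarrow> ((nat \<Rightarrow> real) \<times> real) list \<Rightarrow> (nat \<Rightarrow> real))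
    \<Rightarrow> (nat \<Rightarrow> real) \<Rightarrow> (nat \<Rightarrow> (nat \<Rightarrow> real) \<times> real) \<Rightarrow> nat \<Rightarrow> (nat \<Rightarrow> real) \<times> nat" where
  "alg_run d T r sel w0 s 0 = (w0, 0)"
| "alg_run d T r sel w0 s (Suc k) =
     (let (w, p) = alg_run d T r sel w0 s k;
          \<beta> = r ^ k * pi;
          keep = (if k = 0 then (\<lambda>z. True)
                  else (\<lambda>z. \<bar>dotp d w (fst z)\<bar> \<le>
                          2 * \<beta> / sqrt (real d) * sqrt (real (epochs T) * (1 + log 2 (1 / r)))));
          (W, q) = collect s keep p (per_epoch T)
      in (sel w \<beta> W, q))"

definition alg_output :: "nat \<Rightarrow> nat \<Rightarrow> real
    \<Rightarrow> ((nat \<Rightarrow> real) \<Rightarrow> real \<Rightarrow> ((nat \<Rightarrow> real) \<times> real) list \<Rightarrow> (nat \<Rightarrow> real))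
    \<Rightarrow> (nat \<Rightarrow> real) \<Rightarrow> (nat \<Rightarrow> (nat \<Rightarrow> real) \<times> real) \<Rightarrow> nat \<Rightarrow> real" where
  "alg_output d T r sel w0 s = fst (alg_run d T r sel w0 s (epochs T))"

definition stream_meas :: "nat \<Rightarrow> ((nat \<Rightarrow> real) \<Rightarrow> real) \<Rightarrow> (nat \<Rightarrow> (nat \<Rightarrow> real) \<times> real) measure" where
  "stream_meas d eta = PiM UNIV (\<lambda>_. PXY d eta)"

end

theory Submission
  imports Defs
begin

text \<open>
  While the radius \<open>\<beta>\<close> of the search ball is above a critical scale, the optimum \<open>w\<^sup>*\<close> stays in the ball:
  on the band an empirical minimizer loses at most (mass of the band) times \<open>sqrt ((d + log (1/\<delta>)) / n)\<close>,
  that is, up to logarithms, \<open>\<beta> sqrt (d / T)\<close>; outside the band the two classifiers disagree only on a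
  tail event; and the noise condition turns the excess error into an angle at most \<open>r \<beta>\<close>. Below the critical
  scale \<open>w\<^sup>*\<close> may leave the ball, but comparing each iterate with the previous one shows that the
  excess error grows by a geometric series only. The lower bound on \<open>\<alpha>\<close> says that the final radius is
  below the critical scale up to a constant.

  The empirical minimizer need not depend measurably on the sample. Hence concentration is proved on one measurable
  event, simultaneously for all windows of the stream and all pairs (band, classifier), by bracketing the latter
  with cells whose normal vectors lie on a fine grid.
\<close>

section \<open>One-dimensional marginals of the uniform distribution on the ball\<close>

text \<open>Where an epoch starts and stops in the stream, its band and its minimizer all depend on
  the data, so no epoch sees an independent sample of a fixed law. Conditioning is avoided: the hits
  of a cell in any window of length m are compared with m times the cell mass. The deviation must be
  relative, of order sqrt (m P L) + L for mass P, because a band may be as light as a power of 1/T.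
  The number n of kept points then satisfies m P >= n/4, which eliminates the random m. The union
  runs over cells and windows whose number is T to the power O(d), hence \<open>L\<close> of order
  (d + log (1/\<delta>)) log T. If 64 L exceeds the sample size of an epoch, the claimed bound is at
  least 1; otherwise d <= T, and powers of d are absorbed by powers of T. The critical radius solves
  (\<beta> \<epsilon> / \<mu>) powr (1 - \<alpha>) = r \<beta>, where \<beta> \<epsilon> bounds the
  loss of an epoch of radius \<beta>. Only label requests are limited by T, not draws, so windows of
  polynomial length are available to fill the sample of a thin band.\<close>

definition sqnorm :: "nat \<Rightarrow> (nat \<Rightarrow> real) \<Rightarrow> real" where
  "sqnorm d x = (\<Sum>i<d. (x i)\<^sup>2)"

lemma sqnorm_nonneg: "0 \<le> sqnorm d x"
  by (simp add: sqnorm_def sum_nonneg)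

lemma sets_lebd_cong [measurable_cong]: "sets (lebd n) = sets (PiM {..<n} (\<lambda>_. borel))"
  unfolding lebd_def by (intro sets_PiM_cong) auto

lemma measurable_dotp [measurable]: "dotp n w \<in> borel_measurable (lebd n)"
  unfolding dotp_def by measurable

lemma measurable_sqnorm [measurable]: "sqnorm n \<in> borel_measurable (lebd n)"
  unfolding sqnorm_def by measurable

lemma sigma_finite_lebd: "sigma_finite_measure (lebd n)"
proof -
  interpret product_sigma_finite "\<lambda>_::nat. lborel :: real measure" by standard
  interpret finite_product_sigma_finite "\<lambda>_. lborel :: real measure" "{..<n}" by standard auto
  show ?thesis unfolding lebd_def by (rule sigma_finite_measure_axioms)
qed

lemma nn_integral_lebd_Suc:
  assumes "f \<in> borel_measurable (lebd (Suc n))"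
  shows "(\<integral>\<^sup>+x. f x \<partial>lebd (Suc n)) = (\<integral>\<^sup>+x. (\<integral>\<^sup>+y. f (x(n:=y)) \<partial>lborel) \<partial>lebd n)"
proof -
  interpret product_sigma_finite "\<lambda>_::nat. lborel :: real measure" by standard
  show ?thesis
    using product_nn_integral_insert[of "{..<n}" n f] assms
    by (simp add: lebd_def lessThan_Suc)
qed

lemma nn_integral_lborel_swap:
  fixes f :: "real \<Rightarrow> real \<Rightarrow> ennreal"
  assumes [measurable]: "case_prod f \<in> borel_measurable (borel \<Otimes>\<^sub>M borel)"
  shows "(\<integral>\<^sup>+x. \<integral>\<^sup>+y. f x y \<partial>lborel \<partial>lborel) = (\<integral>\<^sup>+y. \<integral>\<^sup>+x. f x y \<partial>lborel \<partial>(lborel :: real measure))"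
proof -
  interpret pair_sigma_finite "lborel :: real measure" "lborel :: real measure" by standard
  show ?thesis by (rule lborel_pair.Fubini'[symmetric]) measurable
qed

lemma nn_integral_lborel_reflect:
  assumes [measurable]: "f \<in> borel_measurable borel" and c: "\<bar>c\<bar> = (1::real)"
  shows "(\<integral>\<^sup>+x. f (c * x) \<partial>lborel) = (\<integral>\<^sup>+x. f x \<partial>lborel)"
  using nn_integral_real_affine[of f c 0] c by auto

text \<open>For fixed \<open>y\<close> substitute a = c t + s y, which turns the second argument
  into (y - s a) / c; swap; then substitute in \<open>y\<close>. The Jacobian factors 1/c and c
  cancel. Both substitutions need \<open>c\<close> nonzero, so quarter turns are left to the
  caller.\<close>

lemma nn_integral_rotate2:
  fixes f :: "real \<Rightarrow> real \<Rightarrow> ennreal"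
  assumes [measurable]: "case_prod f \<in> borel_measurable (borel \<Otimes>\<^sub>M borel)"
    and cs: "c\<^sup>2 + s\<^sup>2 = 1" and c: "0 < (c::real)"
  shows "(\<integral>\<^sup>+t. \<integral>\<^sup>+y. f (c * t + s * y) (c * y - s * t) \<partial>lborel \<partial>lborel)
       = (\<integral>\<^sup>+x. \<integral>\<^sup>+y. f x y \<partial>lborel \<partial>(lborel :: real measure))"
proof -
  have m [measurable]: "(\<lambda>(t,y). f (c * t + s * y) (c * y - s * t)) \<in> borel_measurable (borel \<Otimes>\<^sub>M borel)"
    by measurable
  have inner: "(\<integral>\<^sup>+t. f (c * t + s * y) (c * y - s * t) \<partial>lborel)
      = ennreal (1/c) * (\<integral>\<^sup>+a. f a ((y - s * a) / c) \<partial>lborel)" for y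
  proof -
    have alg: "c * (- s * y / c + 1 / c * a) + s * y = a"
        "c * y - s * (- s * y / c + 1 / c * a) = (y - s * a) / c" for a
    proof -
      show "c * (- s * y / c + 1 / c * a) + s * y = a" using c by (simp add: field_simps)
      have "c * y - s * (- s * y / c + 1 / c * a) = ((c\<^sup>2 + s\<^sup>2) * y - s * a) / c"
        using c by (simp add: field_simps power2_eq_square)
      then show "c * y - s * (- s * y / c + 1 / c * a) = (y - s * a) / c" using cs by simp
    qed
    have "(\<integral>\<^sup>+t. f (c * t + s * y) (c * y - s * t) \<partial>lborel)
      = ennreal \<bar>1/c\<bar> * (\<integral>\<^sup>+a. f (c * (- s * y / c + 1 / c * a) + s * y) (c * y - s * (- s * y / c + 1 / c * a)) \<partial>lborel)"
      by (rule nn_integral_real_affine) (use c in auto)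
    also have "(\<integral>\<^sup>+a. f (c * (- s * y / c + 1 / c * a) + s * y) (c * y - s * (- s * y / c + 1 / c * a)) \<partial>lborel)
       = (\<integral>\<^sup>+a. f a ((y - s * a) / c) \<partial>lborel)"
      unfolding alg ..
    finally show ?thesis using c by simp
  qed
  have outer: "(\<integral>\<^sup>+y. f a ((y - s * a) / c) \<partial>lborel) = ennreal c * (\<integral>\<^sup>+b. f a b \<partial>lborel)" for a
    using nn_integral_real_affine[of "\<lambda>y. f a ((y - s * a) / c)" c "s * a"] c by simp
  have "(\<integral>\<^sup>+t. \<integral>\<^sup>+y. f (c * t + s * y) (c * y - s * t) \<partial>lborel \<partial>lborel)
      = (\<integral>\<^sup>+y. \<integral>\<^sup>+t. f (c * t + s * y) (c * y - s * t) \<partial>lborel \<partial>lborel)"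
    by (rule nn_integral_lborel_swap[OF m])
  also have "\<dots> = ennreal (1/c) * (\<integral>\<^sup>+y. \<integral>\<^sup>+a. f a ((y - s * a) / c) \<partial>lborel \<partial>lborel)"
    unfolding inner by (rule nn_integral_cmult) measurable
  also have "(\<integral>\<^sup>+y. \<integral>\<^sup>+a. f a ((y - s * a) / c) \<partial>lborel \<partial>lborel)
      = (\<integral>\<^sup>+a. \<integral>\<^sup>+y. f a ((y - s * a) / c) \<partial>lborel \<partial>lborel)"
    by (rule nn_integral_lborel_swap) measurable
  also have "\<dots> = ennreal c * (\<integral>\<^sup>+a. \<integral>\<^sup>+b. f a b \<partial>lborel \<partial>lborel)"
    unfolding outer by (rule nn_integral_cmult) measurable
  finally show ?thesis using c by (simp add: mult.assoc[symmetric] ennreal_mult[symmetric])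
qed

lemma dotp_Suc_upd: "dotp (Suc n) w (x(n := y)) = dotp n w x + w n * y"
  unfolding dotp_def by simp

lemma sqnorm_Suc_upd: "sqnorm (Suc n) (x(n := y)) = sqnorm n x + y\<^sup>2"
  unfolding sqnorm_def by simp

lemma sqnorm_Suc: "sqnorm (Suc n) w = sqnorm n w + (w n)\<^sup>2"
  unfolding sqnorm_def by simp

text \<open>Rotation invariance enters here: the induction step is a planar rotation of the direction of
  the first \<open>n + 1\<close> coordinates of \<open>w\<close> and the last coordinate.\<close>
lemma nn_integral_lebd_dotp_sqnorm:
  fixes F :: "real \<Rightarrow> real \<Rightarrow> ennreal"
  assumes [measurable]: "case_prod F \<in> borel_measurable (borel \<Otimes>\<^sub>M borel)"
    and "sqnorm (Suc n) w = 1"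
  shows "(\<integral>\<^sup>+x. F (dotp (Suc n) w x) (sqnorm (Suc n) x) \<partial>lebd (Suc n))
       = (\<integral>\<^sup>+x. \<integral>\<^sup>+t. F t (sqnorm n x + t\<^sup>2) \<partial>lborel \<partial>lebd n)"
  using assms
proof (induction n arbitrary: w F)
  case 0
  note [measurable] = 0(1)
  have w: "\<bar>w 0\<bar> = 1" using 0(2) by (simp add: sqnorm_def abs_square_eq_1)
  have sq: "(w 0 * y)\<^sup>2 = y\<^sup>2" for y
    using w power2_abs[of "w 0"] by (simp add: power_mult_distrib)
  have r: "(\<integral>\<^sup>+y. F (w 0 * y) (q + y\<^sup>2) \<partial>lborel) = (\<integral>\<^sup>+y. F y (q + y\<^sup>2) \<partial>lborel)" for q
    using nn_integral_lborel_reflect[of "\<lambda>y. F y (q + y\<^sup>2)" "w 0"] w sq by simp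
  show ?case
    by (subst nn_integral_lebd_Suc, measurable)
       (simp add: dotp_Suc_upd sqnorm_Suc_upd dotp_def r)
next
  case (Suc n)
  note [measurable] = Suc.prems(1)
  let ?m = "Suc n"
  define s where "s = w ?m"
  have sw: "sqnorm ?m w = 1 - s\<^sup>2"
    using Suc.prems(2) by (simp add: s_def sqnorm_Suc)
  have lhs: "(\<integral>\<^sup>+x. F (dotp (Suc ?m) w x) (sqnorm (Suc ?m) x) \<partial>lebd (Suc ?m))
     = (\<integral>\<^sup>+x. \<integral>\<^sup>+y. F (dotp ?m w x + s * y) (sqnorm ?m x + y\<^sup>2) \<partial>lborel \<partial>lebd ?m)"
    by (subst nn_integral_lebd_Suc, measurable) (simp add: dotp_Suc_upd sqnorm_Suc_upd s_def)
  show ?case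
  proof (cases "\<bar>s\<bar> = 1")
    \<comment> \<open>Here \<open>w\<close> is a signed last basis vector: its other coordinates
      vanish and cannot be normalised, and a reflection suffices.\<close>
    case True
    then have "s\<^sup>2 = 1" by (simp add: abs_square_eq_1)
    then have z: "sqnorm ?m w = 0" using sw by simp
    have "w i = 0" if "i < ?m" for i
      using z that unfolding sqnorm_def by (subst (asm) sum_nonneg_eq_0_iff) auto
    then have d0: "dotp ?m w x = 0" for x by (simp add: dotp_def)
    have sq: "(s * y)\<^sup>2 = y\<^sup>2" for y
      using \<open>s\<^sup>2 = 1\<close> by (simp add: power_mult_distrib)
    have r: "(\<integral>\<^sup>+y. F (s * y) (q + y\<^sup>2) \<partial>lborel) = (\<integral>\<^sup>+y. F y (q + y\<^sup>2) \<partial>lborel)" for q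
      using nn_integral_lborel_reflect[of "\<lambda>y. F y (q + y\<^sup>2)" s] True sq by simp
    show ?thesis unfolding lhs by (simp add: d0 r)
  next
    case False
    have "s\<^sup>2 \<le> 1" using sw sqnorm_nonneg[of ?m w] by linarith
    moreover have "s\<^sup>2 \<noteq> 1" using False by (simp add: abs_square_eq_1)
    ultimately have s1: "s\<^sup>2 < 1" by simp
    define c where "c = sqrt (1 - s\<^sup>2)"
    have c: "0 < c" "c\<^sup>2 + s\<^sup>2 = 1" using s1 by (auto simp: c_def)
    define w' where "w' = (\<lambda>i. w i / c)"
    have "sqnorm ?m w' = sqnorm ?m w / c\<^sup>2"
      by (simp add: sqnorm_def w'_def power_divide sum_divide_distrib del: sum.lessThan_Suc)
    also have "\<dots> = 1" using c sw by (simp add: field_simps)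
    finally have w': "sqnorm ?m w' = 1" .
    have dw: "dotp ?m w x = c * dotp ?m w' x" for x
      using c by (simp add: dotp_def w'_def sum_distrib_left del: sum.lessThan_Suc)
    \<comment> \<open>Integrating out the last coordinate leaves a function of the same shape for
      the unit vector \<open>w'\<close> in one dimension less; this is why \<open>F\<close> is
      generalised in the induction.\<close>
    define G where "G = (\<lambda>a q. \<integral>\<^sup>+y. F (c * a + s * y) (q + y\<^sup>2) \<partial>lborel)"
    have G [measurable]: "case_prod G \<in> borel_measurable (borel \<Otimes>\<^sub>M borel)"
      unfolding G_def by measurable
    have "(\<integral>\<^sup>+x. F (dotp (Suc ?m) w x) (sqnorm (Suc ?m) x) \<partial>lebd (Suc ?m))
        = (\<integral>\<^sup>+x. G (dotp ?m w' x) (sqnorm ?m x) \<partial>lebd ?m)"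
      unfolding lhs by (simp add: G_def dw)
    also have "\<dots> = (\<integral>\<^sup>+x. \<integral>\<^sup>+t. G t (sqnorm n x + t\<^sup>2) \<partial>lborel \<partial>lebd n)"
      by (rule Suc.IH[OF G w'])
    also have "\<dots> = (\<integral>\<^sup>+x. \<integral>\<^sup>+y. \<integral>\<^sup>+t. F t (sqnorm n x + y\<^sup>2 + t\<^sup>2) \<partial>lborel \<partial>lborel \<partial>lebd n)"
    proof (rule nn_integral_cong)
      fix x
      have e: "sqnorm n x + t\<^sup>2 + y\<^sup>2 = sqnorm n x + (c * y - s * t)\<^sup>2 + (c * t + s * y)\<^sup>2" for t y
      proof -
        have "(c * y - s * t)\<^sup>2 + (c * t + s * y)\<^sup>2 = (c\<^sup>2 + s\<^sup>2) * (t\<^sup>2 + y\<^sup>2)"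
          by (simp add: power2_eq_square algebra_simps)
        then show ?thesis using c by simp
      qed
      have "(\<integral>\<^sup>+t. G t (sqnorm n x + t\<^sup>2) \<partial>lborel)
        = (\<integral>\<^sup>+t. \<integral>\<^sup>+y. F (c * t + s * y) (sqnorm n x + (c * y - s * t)\<^sup>2 + (c * t + s * y)\<^sup>2) \<partial>lborel \<partial>lborel)"
        unfolding G_def by (intro nn_integral_cong arg_cong[OF e])
      also have "\<dots> = (\<integral>\<^sup>+t. \<integral>\<^sup>+y. F t (sqnorm n x + y\<^sup>2 + t\<^sup>2) \<partial>lborel \<partial>lborel)"
        by (rule nn_integral_rotate2[where f = "\<lambda>t y. F t (sqnorm n x + y\<^sup>2 + t\<^sup>2)"])
          (use c in measurable)
      also have "\<dots> = (\<integral>\<^sup>+y. \<integral>\<^sup>+t. F t (sqnorm n x + y\<^sup>2 + t\<^sup>2) \<partial>lborel \<partial>lborel)"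
        by (rule nn_integral_lborel_swap) measurable
      finally show "(\<integral>\<^sup>+t. G t (sqnorm n x + t\<^sup>2) \<partial>lborel)
        = (\<integral>\<^sup>+y. \<integral>\<^sup>+t. F t (sqnorm n x + y\<^sup>2 + t\<^sup>2) \<partial>lborel \<partial>lborel)" .
    qed
    also have "\<dots> = (\<integral>\<^sup>+x. \<integral>\<^sup>+t. F t (sqnorm ?m x + t\<^sup>2) \<partial>lborel \<partial>lebd ?m)"
      by (subst nn_integral_lebd_Suc, measurable) (simp add: sqnorm_Suc_upd)
    finally show ?thesis .
  qed
qed

section \<open>Marginal density of a unit functional: slabs, tails and bands\<close>

text \<open>Up to the factor \<open>unit_ball_vol n\<close>, the volume of the slice at height
  \<open>t\<close> of the unit ball in dimension n + 1, that is, the unnormalised marginal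
  density.\<close>

definition chord_dens :: "nat \<Rightarrow> real \<Rightarrow> real" where
  "chord_dens n t = (if \<bar>t\<bar> < 1 then sqrt (1 - t\<^sup>2) ^ n else 0)"

lemma measurable_chord_dens [measurable]: "chord_dens n \<in> borel_measurable borel"
  unfolding chord_dens_def by measurable

lemma chord_dens_le_1: "chord_dens n t \<le> 1"
  by (auto simp: chord_dens_def abs_square_le_1 intro!: power_le_one)

lemma emeasure_lebd_sqnorm_le:
  assumes "0 < \<rho>"
  shows "emeasure (lebd n) {x \<in> space (lebd n). sqnorm n x \<le> \<rho>\<^sup>2} = ennreal (unit_ball_vol n * \<rho> ^ n)"
proof -
  have "{x \<in> space (lebd n). sqnorm n x \<le> \<rho>\<^sup>2}
      = {f. sqrt (\<Sum>i\<in>{..<n}. (f i)\<^sup>2) \<le> \<rho>} \<inter> space (Pi\<^sub>M {..<n} (\<lambda>_. lborel))"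
    using assms by (auto simp: sqnorm_def lebd_def real_sqrt_le_iff' sum_nonneg)
  then show ?thesis using emeasure_cball_aux[of "{..<n}" \<rho>] assms by (simp add: lebd_def)
qed

abbreviation unit_ball_d :: "nat \<Rightarrow> (nat \<Rightarrow> real) set" where
  "unit_ball_d n \<equiv> {x \<in> space (lebd n). (\<Sum>i<n. (x i)\<^sup>2) \<le> 1}"

lemma emeasure_unit_ball_d: "emeasure (lebd n) (unit_ball_d n) = ennreal (unit_ball_vol n)"
  using emeasure_lebd_sqnorm_le[of 1 n] by (simp add: sqnorm_def)

lemma sets_unit_ball_d [measurable]: "unit_ball_d n \<in> sets (lebd n)"
  by measurable

text \<open>Rotation invariance replaces the functional by one coordinate \<open>t\<close>; the
  slice at height \<open>t\<close> is a ball of radius sqrt (1 - t^2) in dimension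
  \<open>n\<close>.\<close>

lemma emeasure_lebd_dotp:
  assumes [measurable]: "I \<in> sets borel" and w: "sqnorm (Suc n) w = 1"
  shows "emeasure (lebd (Suc n)) (unit_ball_d (Suc n) \<inter> {x \<in> space (lebd (Suc n)). dotp (Suc n) w x \<in> I})
    = ennreal (unit_ball_vol n) * (\<integral>\<^sup>+t. ennreal (chord_dens n t) * indicator I t \<partial>lborel)"
proof -
  interpret L: sigma_finite_measure "lebd n" by (rule sigma_finite_lebd)
  interpret pair_sigma_finite "lebd n" "lborel :: real measure" by standard
  define F :: "real \<Rightarrow> real \<Rightarrow> ennreal" where "F = (\<lambda>t q. indicator I t * indicator {..1} q)"
  have F [measurable]: "case_prod F \<in> borel_measurable (borel \<Otimes>\<^sub>M borel)"
    unfolding F_def by measurable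
  have "emeasure (lebd (Suc n)) (unit_ball_d (Suc n) \<inter> {x \<in> space (lebd (Suc n)). dotp (Suc n) w x \<in> I})
      = (\<integral>\<^sup>+x. indicator (unit_ball_d (Suc n) \<inter> {x \<in> space (lebd (Suc n)). dotp (Suc n) w x \<in> I}) x \<partial>lebd (Suc n))"
    by (rule nn_integral_indicator[symmetric]) measurable
  also have "\<dots> = (\<integral>\<^sup>+x. F (dotp (Suc n) w x) (sqnorm (Suc n) x) \<partial>lebd (Suc n))"
    by (intro nn_integral_cong) (auto simp: F_def indicator_def sqnorm_def)
  also have "\<dots> = (\<integral>\<^sup>+x. \<integral>\<^sup>+t. F t (sqnorm n x + t\<^sup>2) \<partial>lborel \<partial>lebd n)"
    by (rule nn_integral_lebd_dotp_sqnorm[OF F w])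
  also have "\<dots> = (\<integral>\<^sup>+t. \<integral>\<^sup>+x. F t (sqnorm n x + t\<^sup>2) \<partial>lebd n \<partial>lborel)"
    by (rule Fubini'[symmetric]) measurable
  also have "\<dots> = (\<integral>\<^sup>+t. ennreal (unit_ball_vol n) * (ennreal (chord_dens n t) * indicator I t) \<partial>lborel)"
  proof (rule nn_integral_cong_AE)
    \<comment> \<open>The ball formula needs a positive radius. For n = 0 the two sides really
      differ at these endpoints.\<close>
    have "AE t in lborel. t \<notin> {-1,1::real}"
      by (intro AE_not_in countable_imp_null_set_lborel) auto
    then show "AE t in lborel. (\<integral>\<^sup>+x. F t (sqnorm n x + t\<^sup>2) \<partial>lebd n)
        = ennreal (unit_ball_vol n) * (ennreal (chord_dens n t) * indicator I t)"
    proof eventually_elim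
      case (elim t)
      have "(\<integral>\<^sup>+x. F t (sqnorm n x + t\<^sup>2) \<partial>lebd n)
          = (\<integral>\<^sup>+x. indicator I t * indicator {x \<in> space (lebd n). sqnorm n x \<le> 1 - t\<^sup>2} x \<partial>lebd n)"
        by (intro nn_integral_cong) (auto simp: F_def indicator_def)
      also have "\<dots> = indicator I t * emeasure (lebd n) {x \<in> space (lebd n). sqnorm n x \<le> 1 - t\<^sup>2}"
        by (subst nn_integral_cmult) (auto intro!: nn_integral_indicator arg_cong2[where f="(*)"])
      also have "emeasure (lebd n) {x \<in> space (lebd n). sqnorm n x \<le> 1 - t\<^sup>2}
          = ennreal (unit_ball_vol n) * ennreal (chord_dens n t)"
      proof (cases "\<bar>t\<bar> < 1")
        case True
        then have t: "t\<^sup>2 < 1" by (simp add: abs_square_less_1)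
        then show ?thesis
          using emeasure_lebd_sqnorm_le[of "sqrt (1 - t\<^sup>2)" n] True
          by (simp add: chord_dens_def ennreal_mult)
      next
        case False
        then have "1 < \<bar>t\<bar>" using elim by auto
        then have "1 < t\<^sup>2" using abs_square_le_1[of t] by linarith
        then have "{x \<in> space (lebd n). sqnorm n x \<le> 1 - t\<^sup>2} = {}"
          using sqnorm_nonneg[of n] by (auto simp: not_le) (smt (verit))
        then have "emeasure (lebd n) {x \<in> space (lebd n). sqnorm n x \<le> 1 - t\<^sup>2} = 0"
          by (simp only: emeasure_empty)
        then show ?thesis using False by (simp add: chord_dens_def)
      qed
      finally show ?case by (simp add: ac_simps)
    qed
  qed
  also have "\<dots> = ennreal (unit_ball_vol n) * (\<integral>\<^sup>+t. ennreal (chord_dens n t) * indicator I t \<partial>lborel)"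
    by (rule nn_integral_cmult) measurable
  finally show ?thesis .
qed

lemma sets_PX [measurable_cong]: "sets (PX d) = sets (lebd d)"
  by (simp add: PX_def)

lemma space_PX: "space (PX d) = space (lebd d)"
  by (simp add: PX_def)

lemma prob_space_PX: "prob_space (PX d)"
  unfolding PX_def
  by (rule prob_space_uniform_measure) (auto simp: emeasure_unit_ball_d ennreal_eq_0_iff not_le)

lemma AE_PX_unit_ball: "AE x in PX d. sqnorm d x \<le> 1"
  unfolding PX_def sqnorm_def
  by (intro AE_uniform_measureI) auto

definition chord_mass :: "nat \<Rightarrow> real set \<Rightarrow> ennreal" where
  "chord_mass n I = (\<integral>\<^sup>+t. ennreal (chord_dens n t) * indicator I t \<partial>lborel)"

text \<open>The volume \<open>unit_ball_vol n\<close> cancels in the quotient, so only the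
  one-dimensional normaliser \<open>chord_mass n UNIV\<close> has to be estimated.\<close>

lemma PX_dotp:
  assumes [measurable]: "I \<in> sets borel" and w: "sqnorm (Suc n) w = 1"
  shows "emeasure (PX (Suc n)) {x \<in> space (PX (Suc n)). dotp (Suc n) w x \<in> I}
    = chord_mass n I / chord_mass n UNIV"
proof -
  let ?v = "ennreal (unit_ball_vol n)"
  have v: "?v \<noteq> 0" "?v \<noteq> \<infinity>" by (auto simp: ennreal_eq_0_iff not_le)
  have "emeasure (lebd (Suc n)) (unit_ball_d (Suc n)) = ?v * chord_mass n UNIV"
    using emeasure_lebd_dotp[of UNIV n w] w by (simp add: chord_mass_def Int_absorb2)
  then have "emeasure (PX (Suc n)) {x \<in> space (PX (Suc n)). dotp (Suc n) w x \<in> I}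
      = (?v * chord_mass n I) / (?v * chord_mass n UNIV)"
    using emeasure_lebd_dotp[OF assms]
    by (simp add: PX_def space_PX chord_mass_def)
  also have "\<dots> = chord_mass n I / chord_mass n UNIV"
    using divide_mult_eq[OF v] by (simp add: mult.commute)
  finally show ?thesis .
qed

text \<open>Bernoulli's inequality gives (1 - t^2)^n >= 1 - n t^2 >= 1/2, and the density is the
  square root of this quantity, hence at least as large.\<close>

lemma chord_dens_ge_half:
  assumes "\<bar>t\<bar> \<le> 1 / sqrt (2 * real (Suc n))"
  shows "1 / 2 \<le> chord_dens n t"
proof -
  have t2: "t\<^sup>2 \<le> 1 / (2 * real (Suc n))"
    using power_mono[OF assms, of 2] by (simp add: power_divide)
  also have "\<dots> < 1" by (simp add: divide_less_eq)
  finally have t1: "t\<^sup>2 < 1" .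
  have "1 / 2 \<le> 1 + real n * (- t\<^sup>2)"
  proof -
    have "real n * t\<^sup>2 \<le> real n * (1 / (2 * real (Suc n)))" by (rule mult_left_mono[OF t2]) simp
    also have "\<dots> \<le> 1 / 2" by (simp add: field_simps)
    finally show ?thesis by simp
  qed
  also have "\<dots> \<le> (1 + - t\<^sup>2) ^ n" by (rule Bernoulli_inequality) (use t1 in simp)
  also have "\<dots> = sqrt (1 - t\<^sup>2) ^ n * sqrt (1 - t\<^sup>2) ^ n"
    using t1 by (simp add: power_mult_distrib[symmetric])
  also have "\<dots> \<le> sqrt (1 - t\<^sup>2) ^ n * 1"
    using t1 by (intro mult_left_mono power_le_one) auto
  finally show ?thesis using t1 by (simp add: chord_dens_def abs_square_less_1)
qed

lemma chord_mass_mono: "I \<subseteq> J \<Longrightarrow> chord_mass n I \<le> chord_mass n J"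
  unfolding chord_mass_def by (intro nn_integral_mono mult_left_mono) (auto simp: indicator_def)

lemma chord_mass_Icc_ge:
  assumes "0 \<le> c" "c \<le> 1 / sqrt (2 * real (Suc n))"
  shows "ennreal c \<le> chord_mass n {-c..c}"
proof -
  have "ennreal c = (\<integral>\<^sup>+t. ennreal (1/2) * indicator {-c..c} t \<partial>lborel)"
    using assms by (subst nn_integral_cmult_indicator) (auto simp: ennreal_mult[symmetric] simp del: ennreal_half)
  also have "\<dots> \<le> chord_mass n {-c..c}"
    unfolding chord_mass_def
  proof (intro nn_integral_mono)
    fix t
    show "ennreal (1/2) * indicator {-c..c} t \<le> ennreal (chord_dens n t) * indicator {-c..c} t"
    proof (cases "t \<in> {-c..c}")
      case True
      then have "\<bar>t\<bar> \<le> 1 / sqrt (2 * real (Suc n))" using assms by auto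
      then show ?thesis using chord_dens_ge_half[of t n] True by (simp only: indicator_simps mult_1_right ennreal_leI)
    qed simp
  qed
  finally show ?thesis .
qed

lemma chord_mass_UNIV_ge: "ennreal (1 / sqrt (2 * real (Suc n))) \<le> chord_mass n UNIV"
  by (rule order_trans[OF chord_mass_Icc_ge chord_mass_mono]) auto

lemma chord_mass_le: "I \<in> sets borel \<Longrightarrow> chord_mass n I \<le> emeasure lborel I"
proof -
  assume [measurable]: "I \<in> sets borel"
  have "chord_mass n I \<le> (\<integral>\<^sup>+t. indicator I t \<partial>lborel)"
    unfolding chord_mass_def
    using chord_dens_le_1[of n] by (intro nn_integral_mono) (auto simp: indicator_def)
  then show ?thesis by simp
qed

lemma chord_mass_UNIV_le: "chord_mass n UNIV \<le> 2"
proof -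
  have "chord_mass n UNIV = chord_mass n {-1..1}"
    unfolding chord_mass_def
    by (intro nn_integral_cong) (auto simp: indicator_def chord_dens_def)
  also have "\<dots> \<le> emeasure lborel {-1..1::real}" by (rule chord_mass_le) simp
  finally show ?thesis by simp
qed

text \<open>Beyond \<open>c\<close> the density is at most (exp (- c^2 / 2))^n, and it lives on an
  interval of length 2.\<close>

lemma chord_mass_tail:
  assumes "0 \<le> c"
  shows "chord_mass n {t. c < \<bar>t\<bar>} \<le> ennreal (2 * exp (- real n * c\<^sup>2 / 2))"
proof -
  have dens: "chord_dens n t \<le> exp (- real n * c\<^sup>2 / 2)" if "c < \<bar>t\<bar>" for t
  proof (cases "\<bar>t\<bar> < 1")
    case True
    have "c\<^sup>2 \<le> t\<^sup>2" using that assms by (metis abs_le_square_iff abs_of_nonneg less_imp_le)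
    then have "1 - t\<^sup>2 \<le> exp (- c\<^sup>2)"
      using exp_ge_add_one_self[of "- c\<^sup>2"] by linarith
    then have "sqrt (1 - t\<^sup>2) \<le> exp (- c\<^sup>2 / 2)"
      by (intro real_le_lsqrt) (auto simp: exp_double[symmetric])
    then have "sqrt (1 - t\<^sup>2) ^ n \<le> exp (- c\<^sup>2 / 2) ^ n"
      using True by (intro power_mono) (auto simp: abs_square_le_1)
    also have "\<dots> = exp (- real n * c\<^sup>2 / 2)" by (simp add: exp_of_nat_mult[symmetric])
    finally show ?thesis using True by (simp add: chord_dens_def)
  qed (simp add: chord_dens_def)
  have "chord_mass n {t. c < \<bar>t\<bar>} \<le> (\<integral>\<^sup>+t. ennreal (exp (- real n * c\<^sup>2 / 2)) * indicator {-1..1::real} t \<partial>lborel)"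
    unfolding chord_mass_def
  proof (intro nn_integral_mono)
    fix t
    show "ennreal (chord_dens n t) * indicator {t. c < \<bar>t\<bar>} t \<le> ennreal (exp (- real n * c\<^sup>2 / 2)) * indicator {-1..1} t"
    proof (cases "c < \<bar>t\<bar> \<and> \<bar>t\<bar> < 1")
      case True
      then have "t \<in> {-1..1}" "t \<in> {t. c < \<bar>t\<bar>}" by auto
      then show ?thesis using dens[of t] True by (simp only: indicator_simps mult_1_right ennreal_leI)
    qed (auto simp: chord_dens_def)
  qed
  also have "\<dots> = ennreal (2 * exp (- real n * c\<^sup>2 / 2))"
    by (subst nn_integral_cmult_indicator) (auto simp: mult.commute ennreal_mult)
  finally show ?thesis .
qed

lemma ennreal_divide_mono: "a \<le> b \<Longrightarrow> d \<le> c \<Longrightarrow> a / c \<le> b / (d :: ennreal)"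
  unfolding divide_ennreal_def
  by (intro mult_mono zero_le)
    (auto simp: less_eq_ennreal.rep_eq inverse_ennreal.rep_eq intro: ereal_inverse_antimono)

lemma measure_le_ennreal: "emeasure M A \<le> ennreal x \<Longrightarrow> 0 \<le> x \<Longrightarrow> measure M A \<le> x"
  by (simp add: measure_def enn2real_leI)

text \<open>The density is at least 1/2 for \<bar>t\<bar> up to 1 / sqrt (2 (n + 1)), so the
  normaliser is at least this number. This is the origin of the factor sqrt (2 d) in the upper
  bounds on masses.\<close>

lemma chord_ratio_le:
  assumes "X \<le> ennreal x" "0 \<le> x"
  shows "X / chord_mass n UNIV \<le> ennreal (sqrt (2 * real (Suc n)) * x)"
proof -
  have "X / chord_mass n UNIV \<le> ennreal x / ennreal (1 / sqrt (2 * real (Suc n)))"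
    by (intro ennreal_divide_mono assms chord_mass_UNIV_ge)
  also have "\<dots> = ennreal (sqrt (2 * real (Suc n)) * x)"
    using assms by (subst divide_ennreal) (auto simp: mult.commute)
  finally show ?thesis .
qed

lemma PX_slab_le:
  assumes "sqnorm d w = 1" "a \<le> b"
  shows "measure (PX d) {x \<in> space (PX d). dotp d w x \<in> {a..b}} \<le> sqrt (2 * real d) * (b - a)"
proof -
  obtain n where d: "d = Suc n" using assms(1) by (cases d) (auto simp: sqnorm_def)
  have w: "sqnorm (Suc n) w = 1" using assms(1) d by simp
  have "emeasure (PX (Suc n)) {x \<in> space (PX (Suc n)). dotp (Suc n) w x \<in> {a..b}}
      \<le> ennreal (sqrt (2 * real (Suc n)) * (b - a))"
    unfolding PX_dotp[OF atLeastAtMost_borel w]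
    using assms(2) chord_mass_le[of "{a..b}" n] by (intro chord_ratio_le) simp_all
  then show ?thesis unfolding d
    by (rule measure_le_ennreal) (simp add: assms(2))
qed

lemma PX_tail_le:
  assumes "sqnorm d w = 1" "0 \<le> c"
  shows "measure (PX d) {x \<in> space (PX d). c < \<bar>dotp d w x\<bar>}
    \<le> 2 * sqrt (2 * real d) * exp (- (real d - 1) * c\<^sup>2 / 2)"
proof -
  obtain n where d: "d = Suc n" using assms(1) by (cases d) (auto simp: sqnorm_def)
  have w: "sqnorm (Suc n) w = 1" using assms(1) d by simp
  have I: "{t. c < \<bar>t\<bar>} \<in> sets (borel :: real measure)" by measurable
  have "emeasure (PX (Suc n)) {x \<in> space (PX (Suc n)). dotp (Suc n) w x \<in> {t. c < \<bar>t\<bar>}}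
     \<le> ennreal (sqrt (2 * real (Suc n)) * (2 * exp (- real n * c\<^sup>2 / 2)))"
    unfolding PX_dotp[OF I w] by (rule chord_ratio_le[OF chord_mass_tail[OF assms(2)]]) simp
  from measure_le_ennreal[OF this] show ?thesis unfolding d by (simp add: mult_ac)
qed

text \<open>The minimum is due to the lower density bound, which is only available up to 1 / sqrt (2
  d); the division by 2 comes from the normaliser being at most 2.\<close>

lemma PX_band_ge:
  assumes "sqnorm d w = 1" "0 \<le> b"
  shows "min b (1 / sqrt (2 * real d)) / 2 \<le> measure (PX d) {x \<in> space (PX d). \<bar>dotp d w x\<bar> \<le> b}"
proof -
  interpret P: prob_space "PX d" by (rule prob_space_PX)
  obtain n where d: "d = Suc n" using assms(1) by (cases d) (auto simp: sqnorm_def)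
  define c where "c = min b (1 / sqrt (2 * real d))"
  have w: "sqnorm (Suc n) w = 1" using assms(1) d by simp
  have c: "0 \<le> c" "c \<le> b" "c \<le> 1 / sqrt (2 * real (Suc n))" using assms(2) by (simp_all add: c_def d)
  have "ennreal (c / 2) = ennreal c / 2"
    using c by (simp add: ennreal_divide_numeral)
  also have "\<dots> \<le> chord_mass n {-b..b} / chord_mass n UNIV"
    using c(2) by (intro ennreal_divide_mono chord_mass_UNIV_le
      order_trans[OF chord_mass_Icc_ge[OF c(1,3)] chord_mass_mono]) simp
  also have "\<dots> = emeasure (PX d) {x \<in> space (PX d). dotp d w x \<in> {-b..b}}"
    unfolding d PX_dotp[OF atLeastAtMost_borel w] ..
  also have "{x \<in> space (PX d). dotp d w x \<in> {-b..b}} = {x \<in> space (PX d). \<bar>dotp d w x\<bar> \<le> b}"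
    by auto
  finally show ?thesis using c by (simp add: P.emeasure_eq_measure c_def)
qed

section \<open>Geometry of errors and angles\<close>

lemma unit_vecs_sqnorm: "w \<in> unit_vecs d \<Longrightarrow> sqnorm d w = 1"
  by (simp add: unit_vecs_def sqnorm_def)

lemma dotp_commute: "dotp d v w = dotp d w v"
  by (simp add: dotp_def mult.commute)

lemma sqnorm_diff: "sqnorm d (\<lambda>i. v i - w i) = sqnorm d v + sqnorm d w - 2 * dotp d v w"
  by (simp add: sqnorm_def dotp_def power2_diff sum.distrib sum_subtractf sum_distrib_left mult.assoc)

lemma dotp_minus_left: "dotp d (\<lambda>i. - w i) x = - dotp d w x"
  by (simp add: dotp_def sum_negf)

lemma dotp_diff_left: "dotp d (\<lambda>i. v i - w i) x = dotp d v x - dotp d w x"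
  by (simp add: dotp_def left_diff_distrib sum_subtractf)

text \<open>Cauchy-Schwarz, read off from the nonnegativity of the squared norms of v - w and v +
  w.\<close>

lemma abs_dotp_unit_le_1:
  assumes "sqnorm d v = 1" "sqnorm d w \<le> 1"
  shows "\<bar>dotp d v w\<bar> \<le> 1"
proof -
  have "2 * dotp d v w \<le> 2" using sqnorm_diff[of d v w] sqnorm_nonneg[of d "\<lambda>i. v i - w i"] assms by simp
  moreover have "sqnorm d (\<lambda>i. - w i) = sqnorm d w" by (simp add: sqnorm_def)
  then have "2 * dotp d v (\<lambda>i. - w i) \<le> 2"
    using sqnorm_diff[of d v "\<lambda>i. - w i"] sqnorm_nonneg[of d "\<lambda>i. v i - (- w i)"] assms by simp
  then have "- dotp d v w \<le> 1" by (simp add: dotp_commute[of d v] dotp_minus_left)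
  ultimately show ?thesis by linarith
qed

lemma vangle_bounds:
  assumes "sqnorm d v = 1" "sqnorm d w = 1"
  shows "0 \<le> vangle d v w" "vangle d v w \<le> pi" "cos (vangle d v w) = dotp d v w"
  using abs_dotp_unit_le_1[of d v w] assms by (auto simp: vangle_def abs_le_iff intro: arccos_lbound arccos_ubound)

lemma vangle_commute: "vangle d v w = vangle d w v"
  by (simp add: vangle_def dotp_commute)

text \<open>A chord is shorter than its arc: the left side is 2 - 2 cos t = 4 sin^2 (t/2), with t
  the angle.\<close>

lemma sqnorm_diff_le_vangle:
  assumes "sqnorm d v = 1" "sqnorm d w = 1"
  shows "sqnorm d (\<lambda>i. v i - w i) \<le> (vangle d v w)\<^sup>2"
proof -
  have "1 - (vangle d v w)\<^sup>2 / 2 \<le> cos (vangle d v w)"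
  proof -
    have "(sin (vangle d v w / 2))\<^sup>2 \<le> (vangle d v w / 2)\<^sup>2"
      by (subst abs_le_square_iff[symmetric]) (rule abs_sin_x_le_abs_x)
    then show ?thesis using cos_double_sin[of "vangle d v w / 2"] by (simp add: power_divide)
  qed
  then show ?thesis using assms vangle_bounds(3)[OF assms] by (simp add: sqnorm_diff)
qed

text \<open>Since \<open>\<bar>v - w\<bar>\<close> is at most the angle, a disagreement at distance more than \<open>b\<close> from the
  hyperplane of \<open>w\<close> is a tail event for the unit functional along \<open>v - w\<close>.\<close>
lemma PX_diff_tail_le:
  assumes v: "sqnorm d v = 1" and w: "sqnorm d w = 1"
    and ang: "vangle d v w \<le> \<beta>" and b: "0 \<le> b" "0 < \<beta>" and d: "1 \<le> d"
  shows "measure (PX d) {x \<in> space (PX d). b < \<bar>dotp d v x - dotp d w x\<bar>}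
    \<le> 2 * sqrt (2 * real d) * exp (- (real d - 1) * (b / \<beta>)\<^sup>2 / 2)"
proof -
  interpret P: prob_space "PX d" by (rule prob_space_PX)
  define z where "z = (\<lambda>i. v i - w i)"
  define \<rho> where "\<rho> = sqrt (sqnorm d z)"
  have r: "0 \<le> \<rho>" "\<rho>\<^sup>2 = sqnorm d z" using sqnorm_nonneg by (auto simp: \<rho>_def)
  have "\<rho>\<^sup>2 \<le> \<beta>\<^sup>2"
    using sqnorm_diff_le_vangle[OF v w] ang vangle_bounds[OF v w] r
    by (simp add: z_def) (meson order_trans power_mono)
  then have rb: "\<rho> \<le> \<beta>" using b by (simp add: power2_le_iff_abs_le)
  have S: "{x \<in> space (PX d). b < \<bar>dotp d v x - dotp d w x\<bar>} = {x \<in> space (PX d). b < \<bar>dotp d z x\<bar>}"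
    by (simp add: z_def dotp_diff_left)
  show ?thesis
  proof (cases "\<rho> = 0")
    case True
    then have "sqnorm d z = 0" using r by simp
    then have "\<forall>i<d. z i = 0" unfolding sqnorm_def by (subst (asm) sum_nonneg_eq_0_iff) auto
    then have "dotp d z x = 0" for x by (simp add: dotp_def)
    then show ?thesis using b unfolding S by simp
  next
    case False
    then have r0: "0 < \<rho>" using r by simp
    define e where "e = (\<lambda>i. z i / \<rho>)"
    have e: "sqnorm d e = 1"
    proof -
      have "sqnorm d e = sqnorm d z / \<rho>\<^sup>2"
        by (simp add: e_def sqnorm_def power_divide sum_divide_distrib)
      then show ?thesis unfolding r(2)[symmetric] using r0 by simp
    qed
    have de: "dotp d z x = \<rho> * dotp d e x" for x
      using r0 by (simp add: e_def dotp_def sum_distrib_left)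
    have "P.prob {x \<in> space (PX d). b < \<bar>dotp d z x\<bar>} \<le> P.prob {x \<in> space (PX d). b / \<beta> < \<bar>dotp d e x\<bar>}"
    proof (intro P.finite_measure_mono subsetI)
      fix x assume "x \<in> {x \<in> space (PX d). b < \<bar>dotp d z x\<bar>}"
      then have x: "x \<in> space (PX d)" "b < \<rho> * \<bar>dotp d e x\<bar>" using r0 by (auto simp: de abs_mult)
      have "\<rho> * \<bar>dotp d e x\<bar> \<le> \<beta> * \<bar>dotp d e x\<bar>" using rb by (intro mult_right_mono) auto
      with x(2) have "b < \<beta> * \<bar>dotp d e x\<bar>" by linarith
      then show "x \<in> {x \<in> space (PX d). b / \<beta> < \<bar>dotp d e x\<bar>}"
        using x b by (simp add: divide_less_eq mult.commute)
    qed measurable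
    also have "\<dots> \<le> 2 * sqrt (2 * real d) * exp (- (real d - 1) * (b / \<beta>)\<^sup>2 / 2)"
      using b by (intro PX_tail_le e) simp
    finally show ?thesis unfolding S .
  qed
qed

section \<open>Joint law of points and labels, and errors restricted to a band\<close>

locale label_model =
  fixes d :: nat and eta :: "(nat \<Rightarrow> real) \<Rightarrow> real"
  assumes eta_measurable [measurable]: "eta \<in> borel_measurable (PX d)"
    and eta_bounds: "0 \<le> eta x" "eta x \<le> 1"
    and d_pos: "1 \<le> d"
begin

sublocale X: prob_space "PX d" by (rule prob_space_PX)

lemma sets_PXY [measurable_cong]: "sets (PXY d eta) = sets (PX d \<Otimes>\<^sub>M count_space {-1,1})"
  by (simp add: PXY_def)

lemma space_PXY: "space (PXY d eta) = space (PX d) \<times> {-1,1}"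
  by (simp add: PXY_def space_pair_measure)

lemma measurable_label [measurable]: "snd \<in> borel_measurable (PXY d eta)"
proof -
  have "(\<lambda>p. (\<lambda>y::real. y) (snd p)) \<in> borel_measurable (PX d \<Otimes>\<^sub>M count_space {-1,1})"
    by (rule measurable_compose[OF measurable_snd]) simp
  then show ?thesis by (simp add: measurable_cong_sets[OF sets_PXY refl])
qed

lemma measurable_point [measurable]: "fst \<in> measurable (PXY d eta) (PX d)"
  by (simp add: measurable_cong_sets[OF sets_PXY refl])

lemma measurable_PXY_dotp [measurable]: "(\<lambda>p. dotp d w (fst p)) \<in> borel_measurable (PXY d eta)"
  by (rule measurable_compose[OF measurable_point]) measurable

lemma measurable_PXY_sqnorm [measurable]: "(\<lambda>p. sqnorm d (fst p)) \<in> borel_measurable (PXY d eta)"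
  by (rule measurable_compose[OF measurable_point]) measurable

lemma nn_integral_PXY_fst:
  assumes [measurable]: "g \<in> borel_measurable (PX d)"
  shows "(\<integral>\<^sup>+p. g (fst p) \<partial>PXY d eta) = (\<integral>\<^sup>+x. g x \<partial>PX d)"
proof -
  interpret C: finite_measure "count_space {-1,1::real}" by (rule finite_measure_count_space) simp
  interpret pair_sigma_finite "PX d" "count_space {-1,1::real}" ..
  define f where "f = (\<lambda>(x, y::real). ennreal (if y = 1 then eta x else 1 - eta x))"
  have [measurable]: "(\<lambda>y::real. y) \<in> borel_measurable (count_space {-1,1})" by simp
  have f [measurable]: "f \<in> borel_measurable (PX d \<Otimes>\<^sub>M count_space {-1,1})"
    unfolding f_def by measurable
  have "(\<integral>\<^sup>+p. g (fst p) \<partial>PXY d eta) = (\<integral>\<^sup>+p. f p * g (fst p) \<partial>(PX d \<Otimes>\<^sub>M count_space {-1,1}))"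
    unfolding PXY_def f_def[symmetric] by (rule nn_integral_density) measurable
  also have "\<dots> = (\<integral>\<^sup>+x. \<integral>\<^sup>+y. f (x, y) * g x \<partial>count_space {-1,1} \<partial>PX d)"
    by (subst C.nn_integral_fst[symmetric]) auto
  also have "\<dots> = (\<integral>\<^sup>+x. g x \<partial>PX d)"
  proof (rule nn_integral_cong)
    fix x
    have "(\<integral>\<^sup>+y. f (x, y) * g x \<partial>count_space {-1,1}) = (ennreal (1 - eta x) + ennreal (eta x)) * g x"
      by (subst nn_integral_count_space_finite) (auto simp: f_def algebra_simps)
    also have "ennreal (1 - eta x) + ennreal (eta x) = 1"
      using eta_bounds[of x] by (subst ennreal_plus[symmetric]) auto
    finally show "(\<integral>\<^sup>+y. f (x, y) * g x \<partial>count_space {-1,1}) = g x" by simp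
  qed
  finally show ?thesis .
qed

lemma prob_PXY_fst:
  assumes [measurable]: "{x \<in> space (PX d). R x} \<in> sets (PX d)"
  shows "measure (PXY d eta) {p \<in> space (PXY d eta). R (fst p)} = measure (PX d) {x \<in> space (PX d). R x}"
proof -
  have M: "{p \<in> space (PXY d eta). R (fst p)} = fst -` {x \<in> space (PX d). R x} \<inter> space (PXY d eta)"
    by (auto simp: space_PXY)
  have "emeasure (PXY d eta) {p \<in> space (PXY d eta). R (fst p)}
      = (\<integral>\<^sup>+p. indicator {x \<in> space (PX d). R x} (fst p) \<partial>PXY d eta)"
  proof -
    have "emeasure (PXY d eta) {p \<in> space (PXY d eta). R (fst p)}
        = (\<integral>\<^sup>+p. indicator {p \<in> space (PXY d eta). R (fst p)} p \<partial>PXY d eta)"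
      unfolding M using measurable_sets[OF measurable_point assms] by (rule nn_integral_indicator[symmetric])
    then show ?thesis
      by (simp add: indicator_def space_PXY cong: nn_integral_cong)
        (auto intro!: nn_integral_cong simp: space_PXY)
  qed
  also have "\<dots> = emeasure (PX d) {x \<in> space (PX d). R x}"
    using assms by (subst nn_integral_PXY_fst) auto
  finally show ?thesis by (simp add: measure_def)
qed

sublocale XY: prob_space "PXY d eta"
proof
  have "emeasure (PXY d eta) (space (PXY d eta)) = (\<integral>\<^sup>+p. 1 \<partial>PXY d eta)" by simp
  also have "\<dots> = (\<integral>\<^sup>+x. 1 \<partial>PX d)" by (rule nn_integral_PXY_fst[of "\<lambda>_. 1"]) simp
  finally show "emeasure (PXY d eta) (space (PXY d eta)) = 1" by (simp add: X.emeasure_space_1)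
qed

text \<open>For c = 0 these are the errors of \<open>v\<close> inside the band of \<open>w\<close>,
  with the strict inequality of \<open>emp_err\<close>. The free threshold leaves room for the shift
  caused by rounding \<open>v\<close> to a grid.\<close>

definition cell :: "(nat \<Rightarrow> real) \<Rightarrow> real \<Rightarrow> (nat \<Rightarrow> real) \<Rightarrow> real \<Rightarrow> ((nat \<Rightarrow> real) \<times> real) set" where
  "cell w b v c = {p \<in> space (PXY d eta). \<bar>dotp d w (fst p)\<bar> \<le> b \<and> snd p * dotp d v (fst p) < c}"

lemma sets_cell [measurable]: "cell w b v c \<in> sets (PXY d eta)"
  unfolding cell_def by measurable

text \<open>\<open>err\<close> counts a point with \<open>sgn\<close> equal to 0 as an error,
  \<open>emp_err\<close> does not. The two conventions differ on a hyperplane, which is a slab of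
  width 0 and hence null.\<close>

lemma err_eq:
  assumes "sqnorm d w = 1"
  shows "err d eta w = XY.prob {p \<in> space (PXY d eta). snd p * dotp d w (fst p) < 0}"
proof -
  have "X.prob {x \<in> space (PX d). dotp d w x \<in> {0..0}} = 0"
    using PX_slab_le[OF assms, of 0 0] measure_nonneg by (simp add: order_antisym)
  then have "XY.prob {p \<in> space (PXY d eta). dotp d w (fst p) \<in> {0..0}} = 0"
    by (subst prob_PXY_fst) auto
  then have "AE p in PXY d eta. dotp d w (fst p) \<noteq> 0"
    by (subst (asm) XY.prob_Collect_eq_0) auto
  then have "AE p in PXY d eta. (snd p \<noteq> sgn (dotp d w (fst p))) \<longleftrightarrow> (snd p * dotp d w (fst p) < 0)"
    using AE_space
  proof eventually_elim
    case (elim p)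
    then show ?case by (auto simp: space_PXY sgn_real_def)
  qed
  then show ?thesis unfolding err_def clf_err_def
    by (intro measure_eq_AE) (auto, measurable)
qed

text \<open>Outside the band \<bar>w.x\<bar> > b. If v.x and u.x are both within \<open>b\<close> of
  w.x, they have its strict sign and \<open>v\<close> and \<open>u\<close> err together. So an extra
  error of \<open>v\<close> there lies in one of two tail events, each with constant 2.\<close>

lemma err_diff_le:
  assumes v: "sqnorm d v = 1" and u: "sqnorm d u = 1" and w: "sqnorm d w = 1"
    and ang: "vangle d v w \<le> \<beta>" "vangle d u w \<le> \<beta>" and b: "0 \<le> b" "0 < \<beta>"
  shows "err d eta v - err d eta u \<le> XY.prob (cell w b v 0) - XY.prob (cell w b u 0)
    + 4 * sqrt (2 * real d) * exp (- (real d - 1) * (b / \<beta>)\<^sup>2 / 2)"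
proof -
  define D where "D h = {p \<in> space (PXY d eta). snd p * dotp d h (fst p) < 0}" for h
  define B where "B = {p \<in> space (PXY d eta). \<bar>dotp d w (fst p)\<bar> \<le> b}"
  define T where "T h = {p \<in> space (PXY d eta). b < \<bar>dotp d h (fst p) - dotp d w (fst p)\<bar>}" for h
  have [measurable]: "D h \<in> sets (PXY d eta)" "B \<in> sets (PXY d eta)" "T h \<in> sets (PXY d eta)" for h
    unfolding D_def B_def T_def by measurable
  have cellD: "cell w b h 0 = D h \<inter> B" for h by (auto simp: cell_def D_def B_def)
  have split: "XY.prob (D h) = XY.prob (D h \<inter> B) + XY.prob (D h - B)" for h
    by (subst XY.finite_measure_Union[symmetric]) (auto intro!: arg_cong[where f = XY.prob])
  have T: "XY.prob (T h) \<le> 2 * sqrt (2 * real d) * exp (- (real d - 1) * (b / \<beta>)\<^sup>2 / 2)"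
    if "sqnorm d h = 1" "vangle d h w \<le> \<beta>" for h
    using PX_diff_tail_le[OF that(1) w that(2) b d_pos]
    unfolding T_def by (subst prob_PXY_fst) auto
  have "D v - B \<subseteq> (D u - B) \<union> (T v \<union> T u)"
  proof
    fix p assume p: "p \<in> D v - B"
    obtain x y where xy: "p = (x, y)" by (cases p)
    have y: "y = 1 \<or> y = -1" using p by (auto simp: D_def space_PXY xy)
    show "p \<in> (D u - B) \<union> (T v \<union> T u)"
    proof (rule ccontr)
      assume "p \<notin> (D u - B) \<union> (T v \<union> T u)"
      with p have "y * dotp d v x < 0" "0 \<le> y * dotp d u x" "b < \<bar>dotp d w x\<bar>"
         "\<bar>dotp d v x - dotp d w x\<bar> \<le> b" "\<bar>dotp d u x - dotp d w x\<bar> \<le> b"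
        by (auto simp: D_def B_def T_def xy)
      then show False using y by auto
    qed
  qed
  then have "XY.prob (D v - B) \<le> XY.prob ((D u - B) \<union> (T v \<union> T u))"
    by (intro XY.finite_measure_mono) auto
  also have "\<dots> \<le> XY.prob (D u - B) + XY.prob (T v \<union> T u)"
    by (rule measure_Un_le) auto
  also have "XY.prob (T v \<union> T u) \<le> XY.prob (T v) + XY.prob (T u)"
    by (rule measure_Un_le) auto
  finally have "XY.prob (D v - B) - XY.prob (D u - B) \<le> XY.prob (T v) + XY.prob (T u)" by simp
  then show ?thesis
    using T[OF v ang(1)] T[OF u ang(2)] split[of v] split[of u]
    by (simp add: err_eq[OF v] err_eq[OF u] cellD flip: D_def)
qed

lemma AE_PXY_unit_ball: "AE p in PXY d eta. sqnorm d (fst p) \<le> 1"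
proof -
  have "X.prob {x \<in> space (PX d). sqnorm d x \<le> 1} = 1"
    using AE_PX_unit_ball[of d] by (subst X.prob_Collect_eq_1) auto
  then have "XY.prob {p \<in> space (PXY d eta). sqnorm d (fst p) \<le> 1} = 1"
    by (subst prob_PXY_fst) auto
  then show ?thesis by (subst (asm) XY.prob_Collect_eq_1) auto
qed

end

section \<open>Uniform concentration over windows of the stream\<close>

lemma exp_le_quadratic:
  assumes "\<bar>x\<bar> \<le> (1::real)" shows "exp x \<le> 1 + x + x\<^sup>2"
proof (cases "0 \<le> x")
  case True then show ?thesis using exp_bound[of x] assms by simp
next
  case False
  define y where "y = - x"
  have y: "0 \<le> y" "y \<le> 1" using False assms by (auto simp: y_def)
  have "1 + y \<le> exp y" by (rule exp_ge_add_one_self)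
  then have "exp (- y) \<le> 1 / (1 + y)" using y by (simp add: exp_minus inverse_eq_divide frac_le)
  also have "\<dots> \<le> 1 - y + y\<^sup>2"
  proof -
    have "1 \<le> (1 - y + y\<^sup>2) * (1 + y)" using y by (simp add: algebra_simps power2_eq_square)
    then show ?thesis using y by (simp add: divide_le_eq)
  qed
  finally show ?thesis by (simp add: y_def)
qed

definition hits :: "(nat \<Rightarrow> 'a) \<Rightarrow> nat set \<Rightarrow> 'a set \<Rightarrow> real" where
  "hits s J S = (\<Sum>i\<in>J. indicator S (s i))"

lemma measurable_hits [measurable]:
  assumes [measurable]: "S \<in> sets M"
  shows "(\<lambda>s. hits s J S) \<in> borel_measurable (PiM UNIV (\<lambda>_. M))"
  unfolding hits_def by measurable

lemma hits_mgf:
  assumes "prob_space M" and S [measurable]: "S \<in> sets M" and J: "finite J" and l: "\<bar>l\<bar> \<le> 1"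
  shows "(\<integral>\<^sup>+s. ennreal (exp (l * (hits s J S - card J * measure M S))) \<partial>PiM UNIV (\<lambda>_::nat. M))
     \<le> ennreal (exp (card J * measure M S * l\<^sup>2))"
proof -
  interpret M: prob_space M by fact
  interpret product_prob_space "\<lambda>_. M" "UNIV :: nat set" by standard
  define P where "P = measure M S"
  have P: "0 \<le> P" "P \<le> 1" by (auto simp: P_def)
  define f where "f = (\<lambda>x. ennreal (exp (l * (indicator S x - P))))"
  have [measurable]: "f \<in> borel_measurable M" unfolding f_def by measurable
  have ex: "exp (l * (hits s J S - card J * P)) = (\<Prod>i\<in>J. exp (l * (indicator S (s i) - P)))" for s
    by (simp add: hits_def exp_sum[OF J, symmetric] sum_distrib_left[symmetric] sum_subtractf)
  have "(\<integral>\<^sup>+s. ennreal (exp (l * (hits s J S - card J * P))) \<partial>PiM UNIV (\<lambda>_::nat. M))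
      = (\<integral>\<^sup>+s. (\<Prod>i\<in>J. f (restrict s J i)) \<partial>PiM UNIV (\<lambda>_::nat. M))"
    by (simp add: ex f_def prod_ennreal)
  also have "\<dots> = (\<integral>\<^sup>+s. (\<Prod>i\<in>J. f (s i)) \<partial>PiM J (\<lambda>_. M))"
    by (subst distr_PiM_restrict_finite[OF J, symmetric], simp, subst nn_integral_distr) auto
  also have "\<dots> = (\<Prod>i\<in>J. integral\<^sup>N M f)"
    by (rule product_nn_integral_prod) (use J in auto)
  also have "\<dots> = (integral\<^sup>N M f) ^ card J" by simp
  also have "integral\<^sup>N M f \<le> ennreal (exp (P * l\<^sup>2))"
  proof -
    have fx: "f x = ennreal (exp (- l * P)) * indicator (space M - S) x + ennreal (exp (l - l * P)) * indicator S x"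
      if "x \<in> space M" for x
      using that by (auto simp: f_def indicator_def algebra_simps)
    have "integral\<^sup>N M f = (\<integral>\<^sup>+x. ennreal (exp (- l * P)) * indicator (space M - S) x + ennreal (exp (l - l * P)) * indicator S x \<partial>M)"
      by (intro nn_integral_cong fx)
    also have "\<dots> = ennreal (exp (- l * P)) * emeasure M (space M - S) + ennreal (exp (l - l * P)) * emeasure M S"
      by (simp add: nn_integral_add nn_integral_cmult_indicator)
    also have "\<dots> = ennreal (exp (- l * P) * (1 - P) + exp (l - l * P) * P)"
      using P by (simp add: M.emeasure_eq_measure M.prob_compl P_def[symmetric] ennreal_mult[symmetric] ennreal_plus[symmetric] del: ennreal_plus)
    also have "exp (- l * P) * (1 - P) + exp (l - l * P) * P = exp (- l * P) * (1 + P * (exp l - 1))"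
      by (simp add: exp_diff exp_minus field_simps)
    also have "\<dots> \<le> exp (- l * P) * exp (P * (l + l\<^sup>2))"
    proof (intro mult_left_mono)
      have "P * (exp l - 1) \<le> P * (l + l\<^sup>2)" using exp_le_quadratic[OF l] P by (intro mult_left_mono) auto
      then show "1 + P * (exp l - 1) \<le> exp (P * (l + l\<^sup>2))"
        using exp_ge_add_one_self[of "P * (l + l\<^sup>2)"] by linarith
    qed simp
    also have "\<dots> = exp (P * l\<^sup>2)" by (simp add: exp_add[symmetric] algebra_simps)
    finally show ?thesis by (simp add: ennreal_leI)
  qed
  then have "(integral\<^sup>N M f) ^ card J \<le> ennreal (exp (P * l\<^sup>2)) ^ card J" by (rule power_mono) simp
  also have "\<dots> = ennreal (exp (card J * P * l\<^sup>2))"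
    by (simp add: ennreal_power exp_of_nat_mult[symmetric] mult.assoc)
  finally show ?thesis by (simp add: P_def)
qed

text \<open>Markov's inequality for the exponential moment; the sign \<open>\<sigma>\<close> selects
  the tail.\<close>

lemma hits_one_sided:
  assumes "prob_space M" and S [measurable]: "S \<in> sets M" and J: "finite J" and L: "0 < L"
    and \<sigma>: "\<bar>\<sigma>\<bar> = 1"
  shows "measure (PiM UNIV (\<lambda>_::nat. M)) {s \<in> space (PiM UNIV (\<lambda>_::nat. M)).
      2 * sqrt (card J * measure M S * L) + 2 * L \<le> \<sigma> * (hits s J S - card J * measure M S)} \<le> exp (- L)"
proof -
  let ?Q = "PiM UNIV (\<lambda>_::nat. M)"
  interpret Q: prob_space ?Q by (rule prob_space_PiM) (rule assms)
  define m where "m = card J * measure M S"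
  have m: "0 \<le> m" by (simp add: m_def)
  define t where "t = 2 * sqrt (m * L) + 2 * L"
  \<comment> \<open>The optimal choice sqrt (L / m) is admissible only if it is at most 1, the range
    of the quadratic bound on exp. Otherwise l = 1, and the summand 2 L of \<open>t\<close> pays for
    it.\<close>
  obtain l where l: "0 < l" "l \<le> 1" "m * l\<^sup>2 - l * t \<le> - L"
  proof (cases "L \<le> m")
    case True
    define l where "l = sqrt (L / m)"
    have "m * l\<^sup>2 = L" using True L by (simp add: l_def)
    moreover have "l * sqrt (m * L) = L"
      using True L by (simp add: l_def real_sqrt_mult[symmetric])
    moreover have l01: "0 < l" "l \<le> 1" using True L by (auto simp: l_def)
    moreover have "l * t = 2 * (l * sqrt (m * L)) + l * (2 * L)"
      by (simp add: t_def algebra_simps)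
    moreover have "0 \<le> l * (2 * L)" using L \<open>0 < l\<close> by simp
    ultimately have "m * l\<^sup>2 - l * t \<le> - L" by linarith
    then show ?thesis by (rule that[OF l01])
  next
    case False
    have "0 \<le> sqrt (m * L)" by (intro real_sqrt_ge_zero mult_nonneg_nonneg) (use m L in auto)
    then have "m - t \<le> - L" unfolding t_def using False by linarith
    then show ?thesis using that[of 1] by simp
  qed
  define X where "X = (\<lambda>s. \<sigma> * (hits s J S - m))"
  have X [measurable]: "X \<in> borel_measurable ?Q" unfolding X_def by measurable
  have "emeasure ?Q {s \<in> space ?Q. t \<le> X s} \<le> emeasure ?Q {s \<in> space ?Q. 1 \<le> ennreal (exp (- l * t)) * ennreal (exp (l * X s))}"
  proof (intro emeasure_mono subsetI)
    fix s assume "s \<in> {s \<in> space ?Q. t \<le> X s}"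
    then have s: "s \<in> space ?Q" "t \<le> X s" by auto
    then have "1 \<le> exp (l * X s - l * t)" using l by simp
    then have "1 \<le> exp (- l * t) * exp (l * X s)" by (simp add: exp_add[symmetric])
    then show "s \<in> {s \<in> space ?Q. 1 \<le> ennreal (exp (- l * t)) * ennreal (exp (l * X s))}"
      using s by (simp add: ennreal_mult[symmetric])
  qed measurable
  also have "\<dots> \<le> ennreal (exp (- l * t)) * (\<integral>\<^sup>+s. ennreal (exp (l * X s)) * indicator (space ?Q) s \<partial>?Q)"
    by (intro order_trans[OF _ nn_integral_Markov_inequality]) (auto intro!: emeasure_mono, measurable)
  also have "(\<integral>\<^sup>+s. ennreal (exp (l * X s)) * indicator (space ?Q) s \<partial>?Q)
      = (\<integral>\<^sup>+s. ennreal (exp ((l * \<sigma>) * (hits s J S - card J * measure M S))) \<partial>?Q)"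
    by (intro nn_integral_cong) (simp add: X_def m_def mult.assoc)
  also have "\<dots> \<le> ennreal (exp (card J * measure M S * (l * \<sigma>)\<^sup>2))"
    by (rule hits_mgf[OF assms(1) S J]) (use l \<sigma> in \<open>simp add: abs_mult\<close>)
  also have "ennreal (exp (- l * t)) * \<dots> = ennreal (exp (m * l\<^sup>2 - l * t))"
  proof -
    have "\<sigma>\<^sup>2 = 1" using \<sigma> by (simp add: abs_square_eq_1)
    then show ?thesis
      by (simp add: m_def ennreal_mult[symmetric] exp_add[symmetric] power_mult_distrib)
  qed
  also have "\<dots> \<le> ennreal (exp (- L))" using l by (intro ennreal_leI) simp
  finally have "emeasure ?Q {s \<in> space ?Q. t \<le> X s} \<le> ennreal (exp (- L))"
    by (simp add: mult_left_mono)
  from measure_le_ennreal[OF this] show ?thesis by (simp add: t_def X_def m_def)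
qed

text \<open>A union bound over sets, starts, lengths and the two signs. Taking all windows makes the
  random start and stop of an epoch harmless, and the quadratic cost in \<open>N\<close> is
  affordable because \<open>N\<close> will be a power of \<open>T\<close>.\<close>

lemma hits_uniform:
  fixes N :: nat
  assumes M: "prob_space M" and F: "finite F" "F \<subseteq> sets M" and L: "0 < L"
  defines "Q \<equiv> PiM UNIV (\<lambda>_::nat. M)"
  defines "A \<equiv> {s \<in> space Q. \<forall>S\<in>F. \<forall>p\<in>{..N}. \<forall>m\<in>{..N}.
      \<bar>hits s {p..<p+m} S - real m * measure M S\<bar> \<le> 2 * sqrt (real m * measure M S * L) + 2 * L}"
  shows "A \<in> sets Q" "1 - real (card F) * (real N + 1)\<^sup>2 * 2 * exp (- L) \<le> measure Q A"
proof -
  interpret Q: prob_space Q unfolding Q_def by (rule prob_space_PiM) (rule M)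
  have SM [measurable]: "S \<in> F \<Longrightarrow> S \<in> sets M" for S using F by auto
  have ms [measurable]: "S \<in> F \<Longrightarrow> (\<lambda>s. hits s J S) \<in> borel_measurable Q" for S J
    unfolding Q_def by measurable
  show A [measurable]: "A \<in> sets Q" unfolding A_def using F by measurable
  define I where "I = F \<times> {..N} \<times> {..N} \<times> {1, -1::real}"
  define B where "B = (\<lambda>(S,p,m,\<sigma>). {s \<in> space Q.
      2 * sqrt (real m * measure M S * L) + 2 * L \<le> \<sigma> * (hits s {p..<p+m} S - real m * measure M S)})"
  have BS: "B i \<in> sets Q" if "i \<in> I" for i
    using that unfolding B_def I_def by (cases i) auto
  have BP: "Q.prob (B i) \<le> exp (- L)" if "i \<in> I" for i
  proof -
    obtain S p m \<sigma> where i: "i = (S,p,m,\<sigma>)" by (cases i) auto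
    with that have "S \<in> sets M" "\<bar>\<sigma>\<bar> = 1" by (auto simp: I_def)
    then show ?thesis using hits_one_sided[OF M, of S "{p..<p+m}" L \<sigma>] L by (simp add: i B_def Q_def)
  qed
  have "space Q - A \<subseteq> (\<Union>i\<in>I. B i)"
  proof
    fix s assume s: "s \<in> space Q - A"
    then obtain S p m where *: "S \<in> F" "p \<le> N" "m \<le> N"
       "2 * sqrt (real m * measure M S * L) + 2 * L < \<bar>hits s {p..<p+m} S - real m * measure M S\<bar>"
      by (auto simp: A_def not_le)
    define \<sigma> :: real where "\<sigma> = (if hits s {p..<p+m} S - real m * measure M S \<ge> 0 then 1 else -1)"
    have "(S,p,m,\<sigma>) \<in> I" "s \<in> B (S,p,m,\<sigma>)" using * s by (auto simp: I_def B_def \<sigma>_def)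
    then show "s \<in> (\<Union>i\<in>I. B i)" by blast
  qed
  then have "Q.prob (space Q - A) \<le> Q.prob (\<Union>i\<in>I. B i)"
    using BS F by (intro Q.finite_measure_mono sets.finite_UN) (auto simp: I_def)
  also have "\<dots> \<le> (\<Sum>i\<in>I. Q.prob (B i))"
    by (rule Q.finite_measure_subadditive_finite) (use BS F in \<open>auto simp: I_def\<close>)
  also have "\<dots> \<le> (\<Sum>i\<in>I. exp (- L))" by (rule sum_mono) (rule BP)
  also have "\<dots> = real (card F) * (real N + 1)\<^sup>2 * 2 * exp (- L)"
    by (simp add: I_def card_cartesian_product power2_eq_square algebra_simps)
  finally show "1 - real (card F) * (real N + 1)\<^sup>2 * 2 * exp (- L) \<le> measure Q A"
    by (subst (asm) Q.prob_compl) auto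
qed

section \<open>Bracketing of bands and classifiers by a finite grid\<close>

lemma sqnorm_coord_le_1:
  assumes "sqnorm d x \<le> 1" "i < d"
  shows "\<bar>x i\<bar> \<le> 1"
proof -
  have "(x i)\<^sup>2 \<le> sqnorm d x"
    unfolding sqnorm_def using assms(2) by (intro member_le_sum) auto
  with assms(1) show ?thesis by (simp add: abs_square_le_1[symmetric])
qed

definition grid :: "nat \<Rightarrow> nat \<Rightarrow> (nat \<Rightarrow> real) set" where
  "grid d K = {..<d} \<rightarrow>\<^sub>E (\<lambda>j. real_of_int j / real K) ` {- int K..int K}"

lemma finite_grid: "finite (grid d K)"
  unfolding grid_def by (intro finite_PiE) auto

lemma card_grid_le: "card (grid d K) \<le> (2 * K + 1) ^ d"
proof -
  have "card ((\<lambda>j. real_of_int j / real K) ` {- int K..int K}) \<le> 2 * K + 1"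
    by (rule order_trans[OF card_image_le]) auto
  then show ?thesis unfolding grid_def by (simp add: card_PiE power_mono)
qed

text \<open>Coordinates are rounded down to multiples of 1/K, and coordinates of \<open>x\<close>
  are at most 1 in size. The crude error d/K is good enough because \<open>K\<close> will be a large
  power of \<open>T\<close>.\<close>

lemma grid_approx:
  assumes w: "sqnorm d w \<le> 1" and K: "0 < K"
  obtains g where "g \<in> grid d K"
    "\<And>x. sqnorm d x \<le> 1 \<Longrightarrow> \<bar>dotp d g x - dotp d w x\<bar> \<le> real d / real K"
proof
  define g where "g = (\<lambda>i\<in>{..<d}. real_of_int \<lfloor>w i * real K\<rfloor> / real K)"
  have "\<lfloor>w i * real K\<rfloor> \<in> {- int K..int K}" if "i < d" for i
  proof -
    have "- 1 \<le> w i" "w i \<le> 1" using sqnorm_coord_le_1[OF w that] by auto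
    then have "- 1 * real K \<le> w i * real K" "w i * real K \<le> 1 * real K"
      by (intro mult_right_mono; simp)+
    then show ?thesis by (auto simp: le_floor_iff floor_le_iff)
  qed
  then show "g \<in> grid d K" by (auto simp: grid_def g_def)
  fix x assume x: "sqnorm d x \<le> 1"
  have gi: "\<bar>(g i - w i) * x i\<bar> \<le> 1 / real K" if i: "i < d" for i
  proof -
    have "\<bar>real_of_int \<lfloor>w i * real K\<rfloor> - w i * real K\<bar> \<le> 1"
      using floor_correct[of "w i * real K"] by linarith
    moreover have "g i - w i = (real_of_int \<lfloor>w i * real K\<rfloor> - w i * real K) / real K"
      using K i by (simp add: g_def field_simps)
    ultimately have "\<bar>g i - w i\<bar> \<le> 1 / real K"
      by (simp add: divide_right_mono)
    then have "\<bar>g i - w i\<bar> * \<bar>x i\<bar> \<le> (1 / real K) * 1"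
      using sqnorm_coord_le_1[OF x i] by (intro mult_mono) auto
    then show ?thesis by (simp add: abs_mult)
  qed
  have "\<bar>dotp d g x - dotp d w x\<bar> = \<bar>\<Sum>i<d. (g i - w i) * x i\<bar>"
    by (simp add: dotp_def left_diff_distrib sum_subtractf)
  also have "\<dots> \<le> (\<Sum>i<d. \<bar>(g i - w i) * x i\<bar>)" by (rule sum_abs)
  also have "\<dots> \<le> (\<Sum>i<d. 1 / real K)" by (rule sum_mono) (use gi in auto)
  finally show "\<bar>dotp d g x - dotp d w x\<bar> \<le> real d / real K" by simp
qed

context label_model
begin

text \<open>The threshold \<open>c = 2\<close> makes the second condition of a cell vacuous on the unit ball, so the same
  family controls the bands (\<open>c = 2\<close>) and the errors inside them (\<open>c = 0\<close>).\<close>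
definition cell_family :: "nat \<Rightarrow> real set \<Rightarrow> ((nat \<Rightarrow> real) \<times> real) set set" where
  "cell_family K bs = (\<lambda>(b,g,h,c,\<sigma>). cell g (b + \<sigma> * (real d / real K)) h (c + \<sigma> * (real d / real K)))
     ` (bs \<times> grid d K \<times> grid d K \<times> {0, 2} \<times> {1, -1})"

lemma finite_cell_family: "finite bs \<Longrightarrow> finite (cell_family K bs)"
  unfolding cell_family_def by (intro finite_imageI finite_cartesian_product finite_grid) auto

lemma cell_family_sets: "cell_family K bs \<subseteq> sets (PXY d eta)"
  unfolding cell_family_def by auto

lemma card_cell_family_le:
  assumes "finite bs"
  shows "card (cell_family K bs) \<le> 4 * card bs * (2 * K + 1) ^ (2 * d)"
proof -
  have "card (cell_family K bs) \<le> card (bs \<times> grid d K \<times> grid d K \<times> {0, 2::real} \<times> {1, -1::real})"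
    unfolding cell_family_def
    by (intro card_image_le finite_cartesian_product finite_grid assms) auto
  also have "\<dots> = 4 * card bs * (card (grid d K) * card (grid d K))"
    by (simp add: card_cartesian_product)
  also have "\<dots> \<le> 4 * card bs * ((2 * K + 1) ^ d * (2 * K + 1) ^ d)"
    by (intro mult_left_mono mult_mono card_grid_le) auto
  finally show ?thesis by (simp add: power_add[symmetric] mult_2)
qed

lemma prob_slab_le:
  assumes "sqnorm d w = 1" "a \<le> b"
  shows "XY.prob {p \<in> space (PXY d eta). dotp d w (fst p) \<in> {a..b}} \<le> sqrt (2 * real d) * (b - a)"
  using PX_slab_le[OF assms] by (subst prob_PXY_fst) auto

text \<open>Lowering or raising both thresholds by the rounding error a = d/K gives an inner and an
  outer member of the family. A point of the unit ball between them lies within 2 a of one of w.x =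
  b, w.x = -b, v.x = c, v.x = -c: four slabs of width 4 a, hence the 16. The slabs belong to
  \<open>w\<close> and \<open>v\<close> since grid vectors need not be unit vectors.\<close>

lemma cell_sandwich:
  assumes w: "sqnorm d w = 1" and v: "sqnorm d v = 1" and K: "0 < K"
    and b: "b \<in> bs" and c: "c \<in> {0, 2}"
  obtains lo up where "lo \<in> cell_family K bs" "up \<in> cell_family K bs"
    "\<And>p. sqnorm d (fst p) \<le> 1 \<Longrightarrow> p \<in> lo \<Longrightarrow> p \<in> cell w b v c"
    "\<And>p. sqnorm d (fst p) \<le> 1 \<Longrightarrow> p \<in> cell w b v c \<Longrightarrow> p \<in> up"
    "XY.prob lo \<le> XY.prob (cell w b v c)" "XY.prob (cell w b v c) \<le> XY.prob up"
    "XY.prob up - XY.prob lo \<le> 16 * sqrt (2 * real d) * (real d / real K)"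
proof -
  define a where "a = real d / real K"
  have a: "0 \<le> a" by (simp add: a_def)
  obtain g where g: "g \<in> grid d K" "\<And>x. sqnorm d x \<le> 1 \<Longrightarrow> \<bar>dotp d g x - dotp d w x\<bar> \<le> a"
    unfolding a_def by (rule grid_approx[of d w K]) (use w K in auto)
  obtain h where h: "h \<in> grid d K" "\<And>x. sqnorm d x \<le> 1 \<Longrightarrow> \<bar>dotp d h x - dotp d v x\<bar> \<le> a"
    unfolding a_def by (rule grid_approx[of d v K]) (use v K in auto)
  define lo where "lo = cell g (b + (-1) * a) h (c + (-1) * a)"
  define up where "up = cell g (b + 1 * a) h (c + 1 * a)"
  have fam: "lo \<in> cell_family K bs" "up \<in> cell_family K bs"
    unfolding lo_def up_def cell_family_def a_def
    by (rule image_eqI[where x = "(b, g, h, c, -1)"] image_eqI[where x = "(b, g, h, c, 1)"];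
        use g(1) h(1) b c in simp)+
  have [measurable]: "lo \<in> sets (PXY d eta)" "up \<in> sets (PXY d eta)"
    unfolding lo_def up_def by measurable
  have sub1: "p \<in> cell w b v c" if p: "sqnorm d (fst p) \<le> 1" "p \<in> lo" for p
  proof -
    have "snd p = 1 \<or> snd p = -1" using p by (auto simp: lo_def cell_def space_PXY)
    then show ?thesis using p g(2)[OF p(1)] h(2)[OF p(1)] by (auto simp: lo_def cell_def)
  qed
  have sub2: "p \<in> up" if p: "sqnorm d (fst p) \<le> 1" "p \<in> cell w b v c" for p
  proof -
    have "snd p = 1 \<or> snd p = -1" using p by (auto simp: cell_def space_PXY)
    then show ?thesis using p g(2)[OF p(1)] h(2)[OF p(1)] by (auto simp: up_def cell_def)
  qed
  define SL where "SL = (\<lambda>z t. {p \<in> space (PXY d eta). dotp d z (fst p) \<in> {t - 2 * a..t + 2 * a}})"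
  have SLm [measurable]: "SL z t \<in> sets (PXY d eta)" for z t unfolding SL_def by measurable
  have SL: "XY.prob (SL z t) \<le> sqrt (2 * real d) * (4 * a)" if "sqnorm d z = 1" for z t
    using prob_slab_le[OF that, of "t - 2 * a" "t + 2 * a"] a by (simp add: SL_def)
  have sub3: "p \<in> lo \<union> ((SL w b \<union> SL w (- b)) \<union> (SL v c \<union> SL v (- c)))"
    if p: "sqnorm d (fst p) \<le> 1" "p \<in> up" for p
  proof (rule ccontr)
    assume n: "p \<notin> lo \<union> ((SL w b \<union> SL w (- b)) \<union> (SL v c \<union> SL v (- c)))"
    have ps: "p \<in> space (PXY d eta)" using p by (auto simp: up_def cell_def)
    define x y where "x = dotp d w (fst p)" and "y = dotp d v (fst p)"
    have nx: "x \<notin> {b - 2*a..b+2*a}" "x \<notin> {-b - 2*a..-b+2*a}" "y \<notin> {c - 2*a..c+2*a}" "y \<notin> {-c - 2*a..-c+2*a}"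
      using n ps by (auto simp: SL_def x_def y_def)
    have G: "\<bar>dotp d g (fst p) - x\<bar> \<le> a" "\<bar>dotp d h (fst p) - y\<bar> \<le> a"
      using g(2)[OF p(1)] h(2)[OF p(1)] by (auto simp: x_def y_def)
    have s: "snd p = 1 \<or> snd p = -1" using p by (auto simp: up_def cell_def space_PXY)
    have U: "\<bar>dotp d g (fst p)\<bar> \<le> b + a" "snd p * dotp d h (fst p) < c + a"
      using p by (auto simp: up_def cell_def)
    have "\<bar>dotp d g (fst p)\<bar> \<le> b - a" using nx(1,2) G(1) U(1) a by (auto simp: abs_le_iff)
    moreover have "snd p * dotp d h (fst p) < c - a"
      using s nx(3,4) G(2) U(2) a by (auto simp: abs_le_iff)
    ultimately have "p \<in> lo" using ps by (simp add: lo_def cell_def)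
    with n show False by simp
  qed
  have "XY.prob up \<le> XY.prob (lo \<union> ((SL w b \<union> SL w (- b)) \<union> (SL v c \<union> SL v (- c))))"
    by (rule XY.finite_measure_mono_AE) (use AE_PXY_unit_ball sub3 in \<open>auto elim!: eventually_mono\<close>)
  also have "\<dots> \<le> XY.prob lo + ((XY.prob (SL w b) + XY.prob (SL w (- b))) + (XY.prob (SL v c) + XY.prob (SL v (- c))))"
    by (intro order_trans[OF measure_Un_le] add_mono order_refl) auto
  also have "\<dots> \<le> XY.prob lo + 16 * sqrt (2 * real d) * a"
    using SL[OF w, of b] SL[OF w, of "- b"] SL[OF v, of c] SL[OF v, of "- c"] by simp
  finally have diff: "XY.prob up - XY.prob lo \<le> 16 * sqrt (2 * real d) * (real d / real K)"
    by (simp add: a_def)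
  have p1: "XY.prob lo \<le> XY.prob (cell w b v c)" "XY.prob (cell w b v c) \<le> XY.prob up"
    by (rule XY.finite_measure_mono_AE; use AE_PXY_unit_ball sub1 sub2 in \<open>auto elim!: eventually_mono\<close>)+
  show ?thesis by (rule that[OF fam sub1 sub2 p1 diff])
qed

text \<open>By \<open>fine\<close> the brackets differ by at most one expected hit per window.
  Replacing the mean z by z + 1 costs 1 directly and at most 2 L under the square root, so the 2 L
  of the family becomes 5 L.\<close>

lemma cell_deviation:
  assumes good: "\<And>S p m. S \<in> cell_family K bs \<Longrightarrow> p \<le> N \<Longrightarrow> m \<le> N \<Longrightarrow>
      \<bar>hits s {p..<p+m} S - real m * XY.prob S\<bar> \<le> 2 * sqrt (real m * XY.prob S * L) + 2 * L"
    and ball: "\<And>i. sqnorm d (fst (s i)) \<le> 1"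
    and w: "sqnorm d w = 1" and v: "sqnorm d v = 1" and K: "0 < K"
    and b: "b \<in> bs" and c: "c \<in> {0, 2}" and L: "1 \<le> L"
    and fine: "16 * sqrt (2 * real d) * (real d / real K) * real N \<le> 1"
    and p: "p \<le> N" and m: "m \<le> N"
  shows "\<bar>hits s {p..<p+m} (cell w b v c) - real m * XY.prob (cell w b v c)\<bar>
     \<le> 2 * sqrt (real m * XY.prob (cell w b v c) * L) + 5 * L"
proof -
  obtain lo up where fam: "lo \<in> cell_family K bs" "up \<in> cell_family K bs"
    and sub: "\<And>p. sqnorm d (fst p) \<le> 1 \<Longrightarrow> p \<in> lo \<Longrightarrow> p \<in> cell w b v c"
      "\<And>p. sqnorm d (fst p) \<le> 1 \<Longrightarrow> p \<in> cell w b v c \<Longrightarrow> p \<in> up"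
    and pr: "XY.prob lo \<le> XY.prob (cell w b v c)" "XY.prob (cell w b v c) \<le> XY.prob up"
    and diff: "XY.prob up - XY.prob lo \<le> 16 * sqrt (2 * real d) * (real d / real K)"
    by (rule cell_sandwich[OF w v K b c]) (rule that)
  define z where "z = real m * XY.prob (cell w b v c)"
  have z0: "0 \<le> z" by (simp add: z_def)
  have "real m * (XY.prob up - XY.prob lo) \<le> real N * (16 * sqrt (2 * real d) * (real d / real K))"
    using diff pr m by (intro mult_mono) auto
  then have d1: "real m * XY.prob up \<le> real m * XY.prob lo + 1"
    using fine by (simp add: algebra_simps)
  have zlo: "real m * XY.prob lo \<le> z" and zup: "z \<le> real m * XY.prob up"
    using pr by (auto simp: z_def intro!: mult_left_mono)
  have hl: "hits s {p..<p+m} lo \<le> hits s {p..<p+m} (cell w b v c)"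
    and hu: "hits s {p..<p+m} (cell w b v c) \<le> hits s {p..<p+m} up"
    unfolding hits_def using sub[OF ball] by (auto intro!: sum_mono split: split_indicator)
  have "real m * XY.prob up \<le> z + 1" using d1 zlo by linarith
  then have "sqrt (real m * XY.prob up * L) \<le> sqrt ((z + 1) * L)"
    using L by (intro real_sqrt_le_mono mult_right_mono) auto
  also have "\<dots> \<le> sqrt (z * L) + sqrt L"
    using z0 L sqrt_add_le_add_sqrt[of "z * L" L] by (simp add: distrib_right)
  also have "sqrt L \<le> L" using L by (simp add: real_le_lsqrt power2_eq_square)
  finally have su: "sqrt (real m * XY.prob up * L) \<le> sqrt (z * L) + L" by simp
  have sl: "sqrt (real m * XY.prob lo * L) \<le> sqrt (z * L)"
    using L zlo by (intro real_sqrt_le_mono mult_right_mono) auto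
  show ?thesis
    using good[OF fam(1) p m] good[OF fam(2) p m] hl hu su sl zlo zup d1 L
    unfolding z_def[symmetric] abs_le_iff by (intro conjI; linarith)
qed

text \<open>The event is given by finitely many cells and windows together with every stream point
  lying in the ball, so it is measurable although its conclusion covers uncountably many pairs
  \<open>w\<close>, \<open>v\<close>.\<close>

lemma good_event:
  assumes bs: "finite bs" and K: "0 < K" and L: "1 \<le> L"
    and fine: "16 * sqrt (2 * real d) * (real d / real K) * real N \<le> 1"
  obtains A where "A \<in> sets (stream_meas d eta)"
    "1 - real (4 * card bs * (2 * K + 1) ^ (2 * d)) * (real N + 1)\<^sup>2 * 2 * exp (- L)
       \<le> measure (stream_meas d eta) A"
    "\<And>s i. s \<in> A \<Longrightarrow> s i \<in> space (PXY d eta) \<and> sqnorm d (fst (s i)) \<le> 1"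
    "\<And>s w v b c p m. s \<in> A \<Longrightarrow> sqnorm d w = 1 \<Longrightarrow> sqnorm d v = 1 \<Longrightarrow> b \<in> bs \<Longrightarrow> c \<in> {0, 2} \<Longrightarrow>
       p \<le> N \<Longrightarrow> m \<le> N \<Longrightarrow>
       \<bar>hits s {p..<p+m} (cell w b v c) - real m * XY.prob (cell w b v c)\<bar>
     \<le> 2 * sqrt (real m * XY.prob (cell w b v c) * L) + 5 * L"
proof -
  let ?Q = "PiM UNIV (\<lambda>_::nat. PXY d eta)"
  interpret Q: prob_space ?Q by (rule prob_space_PiM) unfold_locales
  define F where "F = cell_family K bs"
  define A0 where "A0 = {s \<in> space ?Q. \<forall>S\<in>F. \<forall>p\<in>{..N}. \<forall>m\<in>{..N}.
      \<bar>hits s {p..<p+m} S - real m * XY.prob S\<bar> \<le> 2 * sqrt (real m * XY.prob S * L) + 2 * L}"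
  have A0: "A0 \<in> sets ?Q" "1 - real (card F) * (real N + 1)\<^sup>2 * 2 * exp (- L) \<le> Q.prob A0"
    unfolding A0_def F_def using L
    by (intro hits_uniform[OF XY.prob_space_axioms finite_cell_family[OF bs] cell_family_sets]; simp)+
  define U where "U = {s \<in> space ?Q. \<forall>i. sqnorm d (fst (s i)) \<le> 1}"
  have [measurable]: "(\<lambda>s. sqnorm d (fst (s i))) \<in> borel_measurable ?Q" for i
    by (rule measurable_compose[OF _ measurable_PXY_sqnorm]) simp
  have U: "U \<in> sets ?Q" unfolding U_def by measurable
  have "AE s in ?Q. sqnorm d (fst (s i)) \<le> 1" for i
    by (rule AE_PiM_component[where P = "\<lambda>p. sqnorm d (fst p) \<le> 1"])
      (auto intro: AE_PXY_unit_ball XY.prob_space_axioms)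
  then have AEU: "AE s in ?Q. \<forall>i. sqnorm d (fst (s i)) \<le> 1" by (simp add: AE_all_countable)
  define A where "A = A0 \<inter> U"
  have "Q.prob A = Q.prob A0"
    unfolding A_def using AEU A0(1) U
    by (intro Q.finite_measure_eq_AE) (auto simp: U_def A0_def elim!: eventually_mono)
  have "real (card F) \<le> real (4 * card bs * (2 * K + 1) ^ (2 * d))"
    unfolding F_def by (intro of_nat_mono card_cell_family_le bs)
  then have "real (card F) * (real N + 1)\<^sup>2 * 2 * exp (- L)
      \<le> real (4 * card bs * (2 * K + 1) ^ (2 * d)) * (real N + 1)\<^sup>2 * 2 * exp (- L)"
    by (intro mult_right_mono) auto
  show ?thesis
  proof
    show "A \<in> sets (stream_meas d eta)" using A0(1) U by (auto simp: A_def stream_meas_def)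
    show "1 - real (4 * card bs * (2 * K + 1) ^ (2 * d)) * (real N + 1)\<^sup>2 * 2 * exp (- L)
       \<le> measure (stream_meas d eta) A"
      unfolding stream_meas_def \<open>Q.prob A = Q.prob A0\<close> using A0(2) \<open>real (card F) * _ * _ * _ \<le> _\<close> by linarith
    show "s i \<in> space (PXY d eta) \<and> sqnorm d (fst (s i)) \<le> 1" if "s \<in> A" for s i
      using that by (auto simp: A_def U_def space_PiM)
    show "\<bar>hits s {p..<p+m} (cell w b v c) - real m * XY.prob (cell w b v c)\<bar>
     \<le> 2 * sqrt (real m * XY.prob (cell w b v c) * L) + 5 * L"
      if "s \<in> A" "sqnorm d w = 1" "sqnorm d v = 1" "b \<in> bs" "c \<in> {0, 2}" "p \<le> N" "m \<le> N" for s w v b c p m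
      by (rule cell_deviation[OF _ _ that(2,3) K that(4,5) L fine that(6,7)])
        (use that(1) in \<open>auto simp: A_def A0_def U_def F_def\<close>)
  qed
qed

end

section \<open>The sample collected in an epoch as a filtered window\<close>

text \<open>\<open>LEAST\<close> is meaningful only if a further accepted point exists. Enough
  accepted points in some window guarantee this at each of the \<open>n\<close> picks, and the list
  is then the accepted part of an initial segment of that window.\<close>

lemma collect_eq_filter:
  assumes "n \<le> card {i \<in> {p..<p+m}. P (s i)}"
  shows "\<exists>q. p \<le> q \<and> q \<le> p + m \<and> collect s P p n = (map s (filter (\<lambda>i. P (s i)) [p..<q]), q)
     \<and> card {i \<in> {p..<q}. P (s i)} = n"
  using assms
proof (induction n arbitrary: p m)
  case 0
  then show ?case by (intro exI[of _ p]) simp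
next
  case (Suc n)
  have "{i \<in> {p..<p+m}. P (s i)} \<noteq> {}" using Suc.prems by (metis card.empty not_less_eq_eq le0)
  then obtain j where j: "p \<le> j" "j < p + m" "P (s j)" by auto
  define i where "i = (LEAST i. p \<le> i \<and> P (s i))"
  have i: "p \<le> i" "P (s i)" using LeastI[of "\<lambda>i. p \<le> i \<and> P (s i)" j] j by (auto simp: i_def)
  have ij: "i \<le> j" unfolding i_def using j by (intro Least_le) auto
  have no: "\<not> P (s k)" if "p \<le> k" "k < i" for k
    using that not_less_Least[of k "\<lambda>i. p \<le> i \<and> P (s i)"] by (auto simp: i_def)
  have split: "{k \<in> {p..<q}. P (s k)} = insert i {k \<in> {Suc i..<q}. P (s k)}" if "i < q" for q
  proof -
    have "k \<in> {p..<q} \<and> P (s k) \<longleftrightarrow> k = i \<or> (k \<in> {Suc i..<q} \<and> P (s k))" for k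
      using i no[of k] that by (cases k i rule: linorder_cases) auto
    then show ?thesis by blast
  qed
  define m' where "m' = p + m - Suc i"
  have m': "Suc i + m' = p + m" using ij j by (simp add: m'_def)
  have "Suc n \<le> Suc (card {k \<in> {Suc i..<p+m}. P (s k)})"
    using Suc.prems split[of "p+m"] ij j by simp
  then have "n \<le> card {k \<in> {Suc i..<Suc i + m'}. P (s k)}" unfolding m' by simp
  from Suc.IH[OF this] obtain q where q: "Suc i \<le> q" "q \<le> Suc i + m'"
    "collect s P (Suc i) n = (map s (filter (\<lambda>i. P (s i)) [Suc i..<q]), q)"
    "card {k \<in> {Suc i..<q}. P (s k)} = n" by blast
  have "[p..<q] = [p..<i] @ [i..<q]" using i q upt_add_eq_append[of p i "q - i"] by simp
  also have "[i..<q] = i # [Suc i..<q]" using q by (simp add: upt_conv_Cons)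
  finally have up: "[p..<q] = [p..<i] @ i # [Suc i..<q]" .
  have "filter (\<lambda>i. P (s i)) [p..<i] = []" using no by (auto simp: filter_empty_conv)
  then have fl: "filter (\<lambda>i. P (s i)) [p..<q] = i # filter (\<lambda>i. P (s i)) [Suc i..<q]"
    using up i by simp
  show ?case
    using q i m' fl split[of q] by (intro exI[of _ q]) (simp add: i_def[symmetric])
qed

section \<open>Analysis of one epoch\<close>

lemma hits_eq_card:
  assumes "finite J"
  shows "hits s J S = real (card {i \<in> J. s i \<in> S})"
proof -
  have "hits s J S = (\<Sum>i\<in>J. if s i \<in> S then 1 else 0)"
    unfolding hits_def by (intro sum.cong) auto
  also have "\<dots> = (\<Sum>i | i \<in> J \<and> s i \<in> S. 1)" by (rule sum.inter_filter[OF assms, symmetric])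
  finally show ?thesis by simp
qed

lemma emp_err_map_filter:
  "emp_err d (map s (filter (\<lambda>i. P (s i)) [p..<q])) v
    = card {i \<in> {p..<q}. P (s i) \<and> snd (s i) * dotp d v (fst (s i)) < 0}"
  unfolding emp_err_def filter_map length_map filter_filter
  by (subst distinct_length_filter) (auto intro!: arg_cong[where f = card] simp: case_prod_unfold)

text \<open>Here \<open>m\<close> is the random window length, \<open>n\<close> the number of kept
  points, P the band mass, S and S' in-band error masses with counts h and h'. Let \<rho> = sqrt (L
  / n). The band deviation forces m P >= n/4, so sqrt (m P L) <= 2 \<rho> m P, and \<rho> <= 1/8
  gives L <= \<rho> m P / 2. All deviations are thus multiples of \<rho> m P; dividing by
  \<open>m\<close> leaves the constant 13 = 2 (2 * 2 + 5/2).\<close>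

lemma erm_window_ineq:
  assumes n: "64 * L \<le> n" and L: "1 \<le> L" and P: "0 \<le> P" and m: "0 \<le> m" and S: "0 \<le> S" "S \<le> P" "0 \<le> S'" "S' \<le> P"
    and band: "\<bar>n - m * P\<bar> \<le> 2 * sqrt (m * P * L) + 5 * L"
    and h: "\<bar>h - m * S\<bar> \<le> 2 * sqrt (m * S * L) + 5 * L" "\<bar>h' - m * S'\<bar> \<le> 2 * sqrt (m * S' * L) + 5 * L" "h \<le> h'"
  shows "S - S' \<le> 13 * P * sqrt (L / n)"
proof -
  define z where "z = m * P"
  define \<rho> where "\<rho> = sqrt (L / n)"
  have n0: "0 < n" using n L by linarith
  have \<rho>0: "0 \<le> \<rho>" using n0 L by (simp add: \<rho>_def)
  have "L / n \<le> (1/8)\<^sup>2" using n n0 by (simp add: divide_le_eq power2_eq_square)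
  then have \<rho>8: "\<rho> \<le> 1/8" unfolding \<rho>_def by (intro real_le_lsqrt) auto
  have \<rho>L: "\<rho>\<^sup>2 * n = L" using n0 L by (simp add: \<rho>_def)
  have z0: "0 \<le> z" using m P by (simp add: z_def)
  have zn: "n / 4 \<le> z"
  proof (rule ccontr)
    assume "\<not> n / 4 \<le> z"
    then have zl: "z < n / 4" by simp
    have "z * L \<le> (n / 4) * (n / 64)" using zl n z0 L by (intro mult_mono) auto
    then have "sqrt (z * L) \<le> n / 16"
      using n0 by (intro real_le_lsqrt) (auto simp: power2_eq_square)
    then show False using band zl n n0 unfolding z_def[symmetric] by (simp add: abs_le_iff)
  qed
  have Lz: "L \<le> (2 * \<rho>)\<^sup>2 * z"
    using mult_left_mono[OF zn, of "4 * \<rho>\<^sup>2"] \<rho>L by (simp add: power2_eq_square)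
  have "z * L \<le> z * ((2 * \<rho>)\<^sup>2 * z)" using Lz z0 by (intro mult_left_mono)
  also have "\<dots> = (2 * \<rho> * z)\<^sup>2" by (simp add: power2_eq_square)
  finally have sq: "sqrt (z * L) \<le> 2 * \<rho> * z" using z0 \<rho>0 by (intro real_le_lsqrt) auto
  have "\<rho> * \<rho> \<le> \<rho> * (1/8)" using \<rho>0 \<rho>8 by (intro mult_left_mono)
  then have "4 * (\<rho> * \<rho>) * z \<le> (\<rho> / 2) * z" using z0 by (intro mult_right_mono) auto
  then have L2: "L \<le> \<rho> * z / 2" using Lz by (simp add: power2_eq_square mult.assoc)
  have mono: "sqrt (m * R * L) \<le> sqrt (z * L)" if "R \<le> P" for R
    unfolding z_def using that m L by (intro real_sqrt_le_mono mult_right_mono mult_left_mono) auto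
  have up: "m * S \<le> h + 2 * sqrt (z * L) + 5 * L" using h(1) mono[OF S(2)] by linarith
  have low: "h' \<le> m * S' + 2 * sqrt (z * L) + 5 * L" using h(2) mono[OF S(4)] by linarith
  have "m * (S - S') \<le> 2 * (2 * sqrt (z * L) + 5 * L)"
    using up low h(3) by (simp add: right_diff_distrib)
  also have "\<dots> \<le> 2 * (2 * (2 * \<rho> * z) + 5 * (\<rho> * z / 2))"
    using sq L2 by (intro mult_left_mono add_mono) auto
  also have "\<dots> = m * (13 * P * \<rho>)" by (simp add: z_def algebra_simps)
  finally have "m * (S - S') \<le> m * (13 * P * \<rho>)" .
  moreover have "0 < m"
  proof -
    have "0 < z" using zn n0 by linarith
    then show ?thesis using m by (cases "m = 0") (auto simp: z_def)
  qed
  ultimately show ?thesis by (simp add: \<rho>_def)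
qed

text \<open>The mean \<open>z\<close> is at least 256 L, so the deviation is far below the 3/4 of
  \<open>z\<close> that separates it from \<open>n\<close>.\<close>

lemma hits_enough:
  assumes n: "64 * L \<le> n" and L: "1 \<le> L" and z: "4 * n \<le> z" and h: "\<bar>h - z\<bar> \<le> 2 * sqrt (z * L) + 5 * L"
  shows "n \<le> (h :: real)"
proof -
  have z0: "0 \<le> z" using assms by linarith
  have "z * L \<le> z * (z / 256)" using z0 n z by (intro mult_left_mono) auto
  then have "sqrt (z * L) \<le> z / 16" using z0 by (intro real_le_lsqrt) (auto simp: power2_eq_square)
  then show ?thesis using assms unfolding abs_le_iff by linarith
qed

lemma ball_theta_refl: "w \<in> unit_vecs d \<Longrightarrow> 0 \<le> \<beta> \<Longrightarrow> w \<in> ball_theta d w \<beta>"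
proof -
  assume w: "w \<in> unit_vecs d" "0 \<le> \<beta>"
  then have "dotp d w w = 1" by (auto simp: unit_vecs_def dotp_def power2_eq_square)
  then show ?thesis using w by (simp add: ball_theta_def vangle_def)
qed

context label_model
begin

lemma cell_le_band: "XY.prob (cell w b v 0) \<le> XY.prob (cell w b w' 2)"
  if "sqnorm d v = 1" "sqnorm d w' = 1"
proof (rule XY.finite_measure_mono_AE)
  show "AE p in PXY d eta. p \<in> cell w b v 0 \<longrightarrow> p \<in> cell w b w' 2"
    using AE_PXY_unit_ball
  proof eventually_elim
    case (elim p)
    then have "\<bar>dotp d w' (fst p)\<bar> \<le> 1" using that by (intro abs_dotp_unit_le_1)
    then show ?case by (auto simp: cell_def space_PXY)
  qed
qed measurable

lemma prob_band: "XY.prob (cell w b w 2) = measure (PX d) {x \<in> space (PX d). \<bar>dotp d w x\<bar> \<le> b}"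
  if "sqnorm d w = 1"
proof -
  have "XY.prob (cell w b w 2) = XY.prob {p \<in> space (PXY d eta). \<bar>dotp d w (fst p)\<bar> \<le> b}"
  proof (rule measure_eq_AE)
    show "AE p in PXY d eta. p \<in> cell w b w 2 \<longleftrightarrow> p \<in> {p \<in> space (PXY d eta). \<bar>dotp d w (fst p)\<bar> \<le> b}"
      using AE_PXY_unit_ball
    proof eventually_elim
      case (elim p)
      then have "\<bar>dotp d w (fst p)\<bar> \<le> 1" using that by (intro abs_dotp_unit_le_1)
      then show ?case by (auto simp: cell_def space_PXY)
    qed
  qed measurable
  also have "\<dots> = measure (PX d) {x \<in> space (PX d). \<bar>dotp d w x\<bar> \<le> b}"
    by (rule prob_PXY_fst) measurable
  finally show ?thesis .
qed

lemma prob_band_le: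
  assumes "sqnorm d w = 1" "0 \<le> b"
  shows "XY.prob (cell w b w 2) \<le> 2 * sqrt (2 * real d) * b"
proof -
  have "{x \<in> space (PX d). \<bar>dotp d w x\<bar> \<le> b} = {x \<in> space (PX d). dotp d w x \<in> {-b..b}}" by auto
  then show ?thesis using PX_slab_le[OF assms(1), of "-b" b] assms by (simp add: prob_band)
qed

text \<open>The band of half-width at least 1 covers the ball, so the first epoch has no out-of-band
  term.\<close>

lemma err_full_band:
  assumes "sqnorm d w = 1" "sqnorm d v = 1" "1 \<le> b"
  shows "err d eta v = XY.prob (cell w b v 0)"
  unfolding err_eq[OF assms(2)]
proof (rule measure_eq_AE)
  show "AE p in PXY d eta. p \<in> {p \<in> space (PXY d eta). snd p * dotp d v (fst p) < 0} \<longleftrightarrow> p \<in> cell w b v 0"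
    using AE_PXY_unit_ball
  proof eventually_elim
    case (elim p)
    then have "\<bar>dotp d w (fst p)\<bar> \<le> 1" using assms by (intro abs_dotp_unit_le_1)
    then show ?case using assms by (auto simp: cell_def)
  qed
qed measurable

text \<open>Deterministic once \<open>dev\<close> holds. It is used twice: on the window of length
  \<open>M\<close>, to see that collection ends by p + M, and then on the window actually read,
  which is at most as long.\<close>

lemma erm_epoch:
  fixes n :: nat
  assumes s: "\<And>i. s i \<in> space (PXY d eta)" "\<And>i. sqnorm d (fst (s i)) \<le> 1"
    and w: "sqnorm d w = 1" and n: "64 * L \<le> real n" and L: "1 \<le> L"
    and dev: "\<And>v c p m. sqnorm d v = 1 \<Longrightarrow> c \<in> {0, 2} \<Longrightarrow> p \<le> N \<Longrightarrow> m \<le> N \<Longrightarrow>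
       \<bar>hits s {p..<p+m} (cell w b v c) - real m * XY.prob (cell w b v c)\<bar>
     \<le> 2 * sqrt (real m * XY.prob (cell w b v c) * L) + 5 * L"
    and p: "p \<le> N" and M: "M \<le> N" and Pb: "4 * real n \<le> real M * XY.prob (cell w b w 2)"
    and keep: "\<And>i. keep (s i) \<longleftrightarrow> \<bar>dotp d w (fst (s i))\<bar> \<le> b"
  obtains W q where "collect s keep p n = (W, q)" "q \<le> p + M"
    "\<And>v u. sqnorm d v = 1 \<Longrightarrow> sqnorm d u = 1 \<Longrightarrow> emp_err d W v \<le> emp_err d W u \<Longrightarrow>
      XY.prob (cell w b v 0) - XY.prob (cell w b u 0) \<le> 13 * XY.prob (cell w b w 2) * sqrt (L / real n)"
proof -
  have inband: "s i \<in> cell w b w 2 \<longleftrightarrow> keep (s i)" for i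
  proof -
    have "\<bar>dotp d w (fst (s i))\<bar> \<le> 1" by (rule abs_dotp_unit_le_1[OF w s(2)])
    then show ?thesis using s(1)[of i] by (auto simp: cell_def keep space_PXY)
  qed
  have hb: "hits s J (cell w b w 2) = real (card {i \<in> J. keep (s i)})" if "finite J" for J
    using that by (simp add: hits_eq_card inband)
  have he: "hits s J (cell w b v 0) = real (card {i \<in> J. keep (s i) \<and> snd (s i) * dotp d v (fst (s i)) < 0})"
    if "finite J" for J v
    using that s(1) by (simp add: hits_eq_card cell_def keep)
  have "real n \<le> hits s {p..<p+M} (cell w b w 2)"
    by (rule hits_enough[OF n L Pb]) (use dev[OF w _ p M, of 2] in simp)
  then have "n \<le> card {i \<in> {p..<p+M}. keep (s i)}" by (simp add: hb)
  from collect_eq_filter[where P = keep and s = s, OF this] obtain q where q: "p \<le> q" "q \<le> p + M"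
    "collect s keep p n = (map s (filter (\<lambda>i. keep (s i)) [p..<q]), q)"
    "card {i \<in> {p..<q}. keep (s i)} = n" by blast
  define m where "m = q - p"
  have qm: "q = p + m" "m \<le> N" using q(1,2) M by (auto simp: m_def)
  show ?thesis
  proof (rule that[OF q(3,2)])
    fix v u assume v: "sqnorm d v = 1" and u: "sqnorm d u = 1"
      and e: "emp_err d (map s (filter (\<lambda>i. keep (s i)) [p..<q])) v \<le> emp_err d (map s (filter (\<lambda>i. keep (s i)) [p..<q])) u"
    show "XY.prob (cell w b v 0) - XY.prob (cell w b u 0) \<le> 13 * XY.prob (cell w b w 2) * sqrt (L / real n)"
    proof (rule erm_window_ineq[OF n L, where m = "real m"])
      show "\<bar>real n - real m * XY.prob (cell w b w 2)\<bar> \<le> 2 * sqrt (real m * XY.prob (cell w b w 2) * L) + 5 * L"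
        using dev[OF w _ p qm(2), of 2] hb[of "{p..<p+m}"] q(4) by (simp add: qm(1))
      show "hits s {p..<p+m} (cell w b v 0) \<le> hits s {p..<p+m} (cell w b u 0)"
        using e unfolding emp_err_map_filter by (simp add: he qm(1))
    qed (use dev[OF v _ p qm(2), of 0] dev[OF u _ p qm(2), of 0] cell_le_band[OF v w] cell_le_band[OF u w] in auto)
  qed
qed

end

text \<open>In the first epoch \<open>b = \<infinity>\<close>; on the unit ball this is the same as half-width 1.\<close>
definition band_width :: "nat \<Rightarrow> nat \<Rightarrow> real \<Rightarrow> nat \<Rightarrow> real" where
  "band_width d T r k = (if k = 0 then 1 else
     2 * (r ^ k * pi) / sqrt (real d) * sqrt (real (epochs T) * (1 + log 2 (1 / r))))"

lemma epochs_ge_1: "4 \<le> T \<Longrightarrow> 1 \<le> epochs T"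
proof -
  assume "4 \<le> T"
  then have "2 \<le> log 2 (real T)" by (subst le_log_iff) (auto simp: powr_numeral)
  then show ?thesis by (simp add: epochs_def le_nat_iff le_floor_iff)
qed

context label_model
begin

text \<open>The comparison vector \<open>u\<close> is left free because it is needed for the optimum
  as long as it lies in the ball, and for the current iterate always. The slack
  \<open>\<tau>\<close> is calibrated at radius \<open>r ^ epochs T\<close>, below the radius of
  every epoch, so it serves them all.\<close>

lemma alg_epochs:
  assumes r: "0 < r" "r < 1/2" and d4: "4 \<le> d" and T: "4 \<le> T"
    and erm: "is_erm d sel" and w0: "w0 \<in> unit_vecs d"
    and s: "\<And>i. s i \<in> space (PXY d eta)" "\<And>i. sqnorm d (fst (s i)) \<le> 1"
    and dev: "\<And>w v b c p m. sqnorm d w = 1 \<Longrightarrow> sqnorm d v = 1 \<Longrightarrow> b \<in> band_width d T r ` {..<epochs T} \<Longrightarrow>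
        c \<in> {0, 2} \<Longrightarrow> p \<le> epochs T * M \<Longrightarrow> m \<le> epochs T * M \<Longrightarrow>
       \<bar>hits s {p..<p+m} (cell w b v c) - real m * XY.prob (cell w b v c)\<bar>
     \<le> 2 * sqrt (real m * XY.prob (cell w b v c) * L) + 5 * L"
    and n: "64 * L \<le> real (per_epoch T)" and L: "1 \<le> L"
    and M: "8 * sqrt (2 * real d) * real (per_epoch T) \<le> real M * r ^ epochs T"
    and out: "4 * sqrt (2 * real d) * exp (- 3/2 * (real (epochs T) * (1 + log 2 (1 / r)))) \<le> r ^ epochs T * \<tau>"
    and \<tau>: "0 \<le> \<tau>"
    and k: "k < epochs T"
  defines "V \<equiv> \<lambda>k. fst (alg_run d T r sel w0 s k)"
    and "\<epsilon> \<equiv> 78 * sqrt (real (epochs T) * (1 + log 2 (1 / r))) * sqrt (L / real (per_epoch T)) + \<tau>"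
  shows "V k \<in> unit_vecs d" "V (Suc k) \<in> ball_theta d (V k) (r ^ k * pi)"
    "\<And>u. u \<in> ball_theta d (V k) (r ^ k * pi) \<Longrightarrow> err d eta (V (Suc k)) \<le> err d eta u + r ^ k * pi * \<epsilon>"
proof -
  define E where "E = epochs T"
  define n' where "n' = per_epoch T"
  define h where "h = sqrt (real E * (1 + log 2 (1 / r)))"
  have lr: "0 < log 2 (1 / r)" using r by simp
  have E1: "1 \<le> E" using epochs_ge_1[OF T] by (simp add: E_def)
  have h2: "h\<^sup>2 = real E * (1 + log 2 (1 / r))" using lr by (simp add: h_def)
  have "1 * 1 \<le> real E * (1 + log 2 (1 / r))" using E1 lr by (intro mult_mono) auto
  then have h1: "1 \<le> h" unfolding h_def by (intro real_le_rsqrt) simp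
  have sd: "0 < sqrt (real d)" using d4 by simp
  \<comment> \<open>The stream position is bounded along with the iterate, so that each epoch starts
    in the range covered by \<open>dev\<close>.\<close>
  have step: "V (Suc k) \<in> ball_theta d (V k) (r ^ k * pi) \<and>
      snd (alg_run d T r sel w0 s (Suc k)) \<le> Suc k * M \<and>
      (\<forall>u \<in> ball_theta d (V k) (r ^ k * pi). err d eta (V (Suc k)) \<le> err d eta u + r ^ k * pi * \<epsilon>)"
    if k: "k < E" and Vk: "V k \<in> unit_vecs d" and pk: "snd (alg_run d T r sel w0 s k) \<le> k * M" for k
  proof -
    define w p where "w = V k" and "p = snd (alg_run d T r sel w0 s k)"
    define \<beta> where "\<beta> = r ^ k * pi"
    define b where "b = band_width d T r k"
    define keep where "keep = (if k = 0 then (\<lambda>z. True) else (\<lambda>z::(nat \<Rightarrow> real) \<times> real. \<bar>dotp d w (fst z)\<bar> \<le>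
        2 * \<beta> / sqrt (real d) * sqrt (real (epochs T) * (1 + log 2 (1 / r)))))"
    have w: "w \<in> unit_vecs d" "sqnorm d w = 1" using Vk by (auto simp: w_def unit_vecs_sqnorm)
    have \<beta>0: "0 < \<beta>" using r by (simp add: \<beta>_def)
    have rE: "r ^ E \<le> r ^ k" using r k by (intro power_decreasing) auto
    have "1 \<le> pi" using pi_ge_two by linarith
    then have \<beta>E: "r ^ E \<le> \<beta>" unfolding \<beta>_def using rE r mult_mono[of "r ^ E" "r ^ k" 1 pi] by simp
    have b_k: "b = 2 * \<beta> / sqrt (real d) * h" if "k \<noteq> 0"
      using that by (simp add: b_def band_width_def \<beta>_def h_def E_def)
    \<comment> \<open>One lower bound for the band widths of all epochs, so that a single window
      length \<open>M\<close> is enough.\<close>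
    have b_ge: "r ^ E / sqrt (real d) \<le> b"
    proof (cases "k = 0")
      case True
      have "r ^ E \<le> 1" using r by (intro power_le_one) auto
      moreover have "1 \<le> sqrt (real d)" using d4 by simp
      ultimately have "r ^ E \<le> sqrt (real d)" by linarith
      then show ?thesis using True sd by (simp add: b_def band_width_def divide_le_eq)
    next
      case False
      have "r ^ E * 1 \<le> (2 * \<beta>) * h" using \<beta>E h1 \<beta>0 r by (intro mult_mono) auto
      then show ?thesis using sd by (simp add: b_k[OF False] divide_right_mono)
    qed
    then have b0: "0 < b" using r sd by (meson divide_pos_pos less_le_trans zero_less_power)
    have Pb: "4 * real n' \<le> real M * XY.prob (cell w b w 2)"
    proof -
      have "r ^ E / sqrt (2 * real d) \<le> r ^ E / sqrt (real d)"
        using r sd d4 by (intro divide_left_mono) auto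
      moreover have "r ^ E / sqrt (2 * real d) \<le> 1 / sqrt (2 * real d)"
        using r by (intro divide_right_mono power_le_one) auto
      ultimately have "r ^ E / sqrt (2 * real d) \<le> min b (1 / sqrt (2 * real d))" using b_ge by simp
      then have "r ^ E / sqrt (2 * real d) / 2 \<le> XY.prob (cell w b w 2)"
        unfolding prob_band[OF w(2)]
        by (intro order_trans[OF divide_right_mono PX_band_ge[OF w(2) less_imp_le[OF b0]]]) auto
      then have "real M * (r ^ E / sqrt (2 * real d) / 2) \<le> real M * XY.prob (cell w b w 2)"
        by (intro mult_left_mono) auto
      moreover have "4 * real n' \<le> real M * (r ^ E / sqrt (2 * real d) / 2)"
      proof -
        have "0 < sqrt (2 * real d)" using d4 by simp
        then have "4 * real n' \<le> (real M * r ^ E) / (2 * sqrt (2 * real d))"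
          using M by (simp add: E_def n'_def pos_le_divide_eq mult_ac)
        then show ?thesis by (simp add: mult_ac)
      qed
      ultimately show ?thesis by linarith
    qed
    have keep: "keep (s i) \<longleftrightarrow> \<bar>dotp d w (fst (s i))\<bar> \<le> b" for i
      using abs_dotp_unit_le_1[OF w(2) s(2)[of i]]
      by (simp add: keep_def b_def band_width_def \<beta>_def)
    have bb: "b \<in> band_width d T r ` {..<epochs T}" using k by (auto simp: b_def E_def)
    have pN: "p \<le> epochs T * M"
      unfolding p_def by (rule order_trans[OF pk]) (use k in \<open>simp add: E_def\<close>)
    have MN: "M \<le> epochs T * M" using E1 by (simp add: E_def)
    obtain W q where W: "collect s keep p (per_epoch T) = (W, q)" "q \<le> p + M"
      and we: "\<And>v u. sqnorm d v = 1 \<Longrightarrow> sqnorm d u = 1 \<Longrightarrow> emp_err d W v \<le> emp_err d W u \<Longrightarrow>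
      XY.prob (cell w b v 0) - XY.prob (cell w b u 0) \<le> 13 * XY.prob (cell w b w 2) * sqrt (L / real (per_epoch T))"
      by (rule erm_epoch[where s = s and w = w and b = b and n = "per_epoch T" and keep = keep,
         OF s w(2) n L dev[OF w(2) _ bb] pN MN Pb[unfolded n'_def] keep]) (assumption+, rule that)
    have run: "alg_run d T r sel w0 s (Suc k) = (sel w \<beta> W, q)"
      using W(1) unfolding alg_run.simps(2) w_def p_def V_def \<beta>_def keep_def
      by (simp add: Let_def split_beta)
    then have V': "V (Suc k) = sel w \<beta> W" by (simp add: V_def)
    have ermk: "sel w \<beta> W \<in> ball_theta d w \<beta>" "\<And>v. v \<in> ball_theta d w \<beta> \<Longrightarrow> emp_err d W (sel w \<beta> W) \<le> emp_err d W v"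
      using erm w(1) \<beta>0 unfolding is_erm_def by auto
    have "err d eta (sel w \<beta> W) \<le> err d eta u + \<beta> * \<epsilon>" if u: "u \<in> ball_theta d w \<beta>" for u
    proof -
      let ?v = "sel w \<beta> W"
      have v1: "sqnorm d ?v = 1" "vangle d ?v w \<le> \<beta>" and u1: "sqnorm d u = 1" "vangle d u w \<le> \<beta>"
        using ermk(1) u by (auto simp: ball_theta_def unit_vecs_sqnorm)
      have diff: "XY.prob (cell w b ?v 0) - XY.prob (cell w b u 0) \<le> 13 * XY.prob (cell w b w 2) * sqrt (L / real n')"
        unfolding n'_def by (rule we[OF v1(1) u1(1) ermk(2)[OF u]])
      have sL: "0 \<le> sqrt (L / real n')" using L by simp
      \<comment> \<open>In the first epoch \<beta> h >= 1 bounds any mass. Later the sqrt d of the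
        slab bound cancels the 1 / sqrt d of the band width, leaving 4 sqrt 2 <= 6; with the 13 of
        \<open>erm_window_ineq\<close> this gives the 78 in \<open>\<epsilon>\<close>.\<close>
      have P6: "XY.prob (cell w b w 2) \<le> 6 * (\<beta> * h)"
      proof (cases "k = 0")
        case True
        then have "1 * 1 \<le> \<beta> * h" using \<open>1 \<le> pi\<close> h1 by (intro mult_mono) (auto simp: \<beta>_def)
        then show ?thesis using XY.prob_le_1[of "cell w b w 2"] by linarith
      next
        case False
        have "XY.prob (cell w b w 2) \<le> 2 * sqrt (2 * real d) * b"
          by (rule prob_band_le[OF w(2)]) (use b0 in simp)
        also have "\<dots> = (4 * sqrt 2) * (\<beta> * h)"
          using sd by (simp add: b_k[OF False] real_sqrt_mult)
        also have "\<dots> \<le> 6 * (\<beta> * h)"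
        proof (rule mult_right_mono)
          have "sqrt 2 \<le> 3/2" by (intro real_le_lsqrt) (auto simp: power2_eq_square)
          then show "4 * sqrt 2 \<le> 6" by simp
        qed (use \<beta>0 h1 in simp)
        finally show ?thesis .
      qed
      have "13 * XY.prob (cell w b w 2) * sqrt (L / real n') \<le> 13 * (6 * (\<beta> * h)) * sqrt (L / real n')"
        using P6 sL by (intro mult_right_mono mult_left_mono) auto
      then have main: "XY.prob (cell w b ?v 0) - XY.prob (cell w b u 0) \<le> \<beta> * (78 * h * sqrt (L / real n'))"
        using diff by (simp add: mult_ac)
      have eps: "\<beta> * \<epsilon> = \<beta> * (78 * h * sqrt (L / real n')) + \<beta> * \<tau>"
        by (simp add: \<epsilon>_def h_def E_def n'_def algebra_simps)
      show ?thesis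
      proof (cases "k = 0")
        case True
        then have "1 \<le> b" by (simp add: b_def band_width_def)
        moreover have "0 \<le> \<beta> * \<tau>" using \<beta>0 \<tau> by simp
        ultimately show ?thesis
          using main eps err_full_band[OF w(2) v1(1), of b] err_full_band[OF w(2) u1(1), of b]
          by linarith
      next
        case False
        have "b / \<beta> = 2 * h / sqrt (real d)" using \<beta>0 by (simp add: b_k[OF False])
        then have sq: "(b / \<beta>)\<^sup>2 = 4 * h\<^sup>2 / real d" by (simp add: power_divide power_mult_distrib)
        \<comment> \<open>The hypothesis d >= 4 enters through (d - 1) / d >= 3/4, which turns 2 h^2
          into the 3/2 h^2 of \<open>out\<close>.\<close>
        have "- (real d - 1) * (b / \<beta>)\<^sup>2 / 2 = - (2 * h\<^sup>2) * ((real d - 1) / real d)"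
          unfolding sq using d4 by (simp add: field_simps)
        also have "\<dots> \<le> - (2 * h\<^sup>2) * (3 / 4)"
        proof (rule mult_left_mono_neg)
          show "3 / 4 \<le> (real d - 1) / real d" using d4 by (simp add: field_simps)
        qed simp
        also have "\<dots> = - 3/2 * (real (epochs T) * (1 + log 2 (1 / r)))" by (simp add: h2 E_def)
        finally have "exp (- (real d - 1) * (b / \<beta>)\<^sup>2 / 2) \<le> exp (- 3/2 * (real (epochs T) * (1 + log 2 (1 / r))))"
          by simp
        then have "4 * sqrt (2 * real d) * exp (- (real d - 1) * (b / \<beta>)\<^sup>2 / 2)
            \<le> 4 * sqrt (2 * real d) * exp (- 3/2 * (real (epochs T) * (1 + log 2 (1 / r))))"
          by (intro mult_left_mono) auto
        also have "\<dots> \<le> r ^ E * \<tau>" using out by (simp add: E_def)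
        also have "\<dots> \<le> \<beta> * \<tau>" using \<beta>E \<tau> by (rule mult_right_mono)
        finally show ?thesis
          using err_diff_le[OF v1(1) u1(1) w(2) v1(2) u1(2), of b] b0 \<beta>0 main eps by linarith
      qed
    qed
    then show ?thesis using ermk(1) W(2) pk run by (simp add: V' w_def \<beta>_def p_def)
  qed
  have inv: "V k \<in> unit_vecs d \<and> snd (alg_run d T r sel w0 s k) \<le> k * M" if "k \<le> E" for k
    using that
  proof (induction k)
    case 0
    then show ?case using w0 by (simp add: V_def)
  next
    case (Suc k)
    then show ?case using step[of k] by (auto simp: ball_theta_def)
  qed
  have kE: "k < E" using k by (simp add: E_def)
  show "V k \<in> unit_vecs d" "V (Suc k) \<in> ball_theta d (V k) (r ^ k * pi)"
    "\<And>u. u \<in> ball_theta d (V k) (r ^ k * pi) \<Longrightarrow> err d eta (V (Suc k)) \<le> err d eta u + r ^ k * pi * \<epsilon>"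
    using step[OF kE] inv[of k] kE by auto
qed

end

section \<open>From epochs to the convergence rate\<close>

text \<open>The bound in \<open>B\<close> is the radius with equality in the conclusion. The left
  side grows like \<beta> powr (1 - \<alpha>), slower than r \<beta>, so above that radius the angle
  allowed by the noise condition fits into the next ball.\<close>

lemma critical_scale:
  fixes r \<mu> \<alpha> \<epsilon> \<beta> :: real
  assumes r: "0 < r" and \<mu>: "0 < \<mu>" and \<alpha>: "0 < \<alpha>" "\<alpha> < 1" and e: "0 < \<epsilon>" and \<beta>: "0 < \<beta>"
    and B: "((\<epsilon> / \<mu>) powr (1 - \<alpha>) / r) powr (1 / \<alpha>) \<le> \<beta>"
  shows "(\<beta> * \<epsilon> / \<mu>) powr (1 - \<alpha>) \<le> r * \<beta>"
proof -
  have "(((\<epsilon> / \<mu>) powr (1 - \<alpha>) / r) powr (1 / \<alpha>)) powr \<alpha> \<le> \<beta> powr \<alpha>"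
    by (rule powr_mono2) (use \<alpha> B in auto)
  then have "(\<epsilon> / \<mu>) powr (1 - \<alpha>) / r \<le> \<beta> powr \<alpha>"
    using \<alpha> r e \<mu> by (simp add: powr_powr)
  then have *: "(\<epsilon> / \<mu>) powr (1 - \<alpha>) \<le> r * \<beta> powr \<alpha>" using r by (simp add: field_simps)
  have "(\<beta> * \<epsilon> / \<mu>) powr (1 - \<alpha>) = \<beta> powr (1 - \<alpha>) * (\<epsilon> / \<mu>) powr (1 - \<alpha>)"
    using \<beta> e \<mu> by (simp add: powr_mult[symmetric])
  also have "\<dots> \<le> \<beta> powr (1 - \<alpha>) * (r * \<beta> powr \<alpha>)" by (intro mult_left_mono *) simp
  also have "\<dots> = r * (\<beta> powr (1 - \<alpha>) * \<beta> powr \<alpha>)" by simp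
  also have "\<dots> = r * \<beta>" using \<beta> by (simp add: powr_add[symmetric])
  finally show ?thesis .
qed

text \<open>While the radius is at least \<open>B\<close>, \<open>opt\<close> and
  \<open>noise\<close> keep the optimum in the next ball. If an epoch with the optimum in its ball
  has radius below \<open>B\<close>, its excess is at most \<epsilon> B, and afterwards
  \<open>prev\<close> adds a geometric tail that at most doubles this.\<close>

lemma excess_recursion:
  fixes e \<theta> :: "nat \<Rightarrow> real"
  assumes r: "0 < r" "r < 1/2" and \<mu>: "0 < \<mu>" and \<alpha>: "0 < \<alpha>" "\<alpha> < 1" and eps: "0 < \<epsilon>"
    and \<theta>0: "\<theta> 0 \<le> pi" and \<theta>: "\<And>k. k \<le> E \<Longrightarrow> 0 \<le> \<theta> k"
    and opt: "\<And>k. k < E \<Longrightarrow> \<theta> k \<le> r ^ k * pi \<Longrightarrow> e (Suc k) \<le> r ^ k * pi * \<epsilon>"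
    and prev: "\<And>k. k < E \<Longrightarrow> e (Suc k) \<le> e k + r ^ k * pi * \<epsilon>"
    and noise: "\<And>k. k \<le> E \<Longrightarrow> \<mu> * \<theta> k powr (1 / (1 - \<alpha>)) \<le> e k"
    and E: "1 \<le> E"
  defines "B \<equiv> ((\<epsilon> / \<mu>) powr (1 - \<alpha>) / r) powr (1 / \<alpha>)"
  shows "e E \<le> \<epsilon> * max (r ^ (E - 1) * pi) (2 * B)"
proof -
  define b where "b k = r ^ k * pi" for k
  have b: "0 < b k" "b (Suc k) = r * b k" "2 * b (Suc k) \<le> b k" for k
  proof -
    show "0 < b k" "b (Suc k) = r * b k" using r by (auto simp: b_def)
    then show "2 * b (Suc k) \<le> b k" using r mult_right_mono[of "2 * r" 1 "b k"] by simp
  qed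
  \<comment> \<open>The term - 2 \<open>b k\<close> reserves the cost of the epochs to come: r < 1/2
    gives b k <= 2 b k - 2 b (k + 1). The clause k = 0 is needed because no epoch precedes the
    start, so its excess is not controlled.\<close>
  have "(\<theta> k \<le> b k \<and> (k = 0 \<or> e k \<le> \<epsilon> * b (k - 1))) \<or> e k \<le> \<epsilon> * (2 * B - 2 * b k)" if "k \<le> E" for k
    using that
  proof (induction k)
    case 0
    then show ?case using \<theta>0 by (simp add: b_def)
  next
    case (Suc k)
    then have kE: "k < E" by simp
    have eb: "\<epsilon> * (2 * b (Suc k)) \<le> \<epsilon> * b k" using b(3) eps by (intro mult_left_mono) auto
    from Suc have "(\<theta> k \<le> b k) \<or> e k \<le> \<epsilon> * (2 * B - 2 * b k)" by auto
    then show ?case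
    proof
      assume t: "\<theta> k \<le> b k"
      have e': "e (Suc k) \<le> \<epsilon> * b k" using opt[OF kE] t by (simp add: b_def mult.commute)
      show ?thesis
      proof (cases "B \<le> b k")
        case True
        have "\<mu> * \<theta> (Suc k) powr (1 / (1 - \<alpha>)) \<le> b k * \<epsilon>"
          using noise[of "Suc k"] e' Suc.prems by (simp add: mult.commute)
        then have le: "\<theta> (Suc k) powr (1 / (1 - \<alpha>)) \<le> b k * \<epsilon> / \<mu>" using \<mu> by (simp add: field_simps)
        have "\<theta> (Suc k) = (\<theta> (Suc k) powr (1 / (1 - \<alpha>))) powr (1 - \<alpha>)"
          using \<alpha> \<theta>[OF Suc.prems] by (simp add: powr_powr)
        also have "\<dots> \<le> (b k * \<epsilon> / \<mu>) powr (1 - \<alpha>)" by (rule powr_mono2) (use \<alpha> le in auto)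
        also have "\<dots> \<le> r * b k"
          by (rule critical_scale[OF r(1) \<mu> \<alpha> eps b(1)]) (use True in \<open>simp add: B_def\<close>)
        finally show ?thesis using e' b(2) by simp
      next
        case False
        then have "\<epsilon> * b k \<le> \<epsilon> * B" using eps by simp
        then have "\<epsilon> * b k + \<epsilon> * (2 * b (Suc k)) \<le> \<epsilon> * (2 * B)" using eb by simp
        then show ?thesis using e' by (simp add: right_diff_distrib)
      qed
    next
      assume "e k \<le> \<epsilon> * (2 * B - 2 * b k)"
      then have "e (Suc k) \<le> \<epsilon> * (2 * B - 2 * b (Suc k))"
      proof -
        have "e (Suc k) \<le> e k + \<epsilon> * b k" using prev[OF kE] by (simp add: b_def mult.commute)
        then show ?thesis
          using \<open>e k \<le> _\<close> eb unfolding right_diff_distrib by linarith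
      qed
      then show ?thesis ..
    qed
  qed
  from this[of E] E have "e E \<le> \<epsilon> * b (E - 1) \<or> e E \<le> \<epsilon> * (2 * B - 2 * b E)" by auto
  then show ?thesis
  proof
    assume "e E \<le> \<epsilon> * b (E - 1)"
    also have "\<dots> \<le> \<epsilon> * max (r ^ (E - 1) * pi) (2 * B)" using eps by (intro mult_left_mono) (auto simp: b_def)
    finally show ?thesis .
  next
    assume "e E \<le> \<epsilon> * (2 * B - 2 * b E)"
    also have "\<dots> \<le> \<epsilon> * max (r ^ (E - 1) * pi) (2 * B)"
      using eps b(1)[of E] by (intro mult_left_mono) auto
    finally show ?thesis .
  qed
qed

section \<open>Epochs, tails, grids and windows measured in powers of \<open>T\<close>\<close>

lemma log_T_ge_2: "4 \<le> T \<Longrightarrow> 2 \<le> log 2 (real T)"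
  by (subst le_log_iff) (auto simp: powr_numeral)

lemma epochs_bounds:
  assumes "4 \<le> T"
  shows "real (epochs T) \<le> log 2 (real T) / 2" "log 2 (real T) / 2 - 1 \<le> real (epochs T)"
proof -
  have "0 \<le> \<lfloor>log 2 (real T) / 2\<rfloor>" using log_T_ge_2[OF assms] by simp
  then have "real (epochs T) = real_of_int \<lfloor>log 2 (real T) / 2\<rfloor>" by (simp add: epochs_def)
  then show "real (epochs T) \<le> log 2 (real T) / 2" "log 2 (real T) / 2 - 1 \<le> real (epochs T)"
    by linarith+
qed

lemma log_le_self: "0 < T \<Longrightarrow> log 2 (real T) \<le> real T"
proof -
  assume "0 < T"
  have "real T < 2 ^ T" using of_nat_less_two_power[of T] by simp
  then show ?thesis using \<open>0 < T\<close> by (subst log_le_iff) (auto simp: powr_realpow)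
qed

text \<open>Rounding the quotient down loses at most a factor 2, which the 1/2 in the number of
  epochs compensates.\<close>

lemma per_epoch_ge:
  assumes "4 \<le> T"
  shows "real T \<le> log 2 (real T) * real (per_epoch T)"
proof -
  let ?E = "epochs T"
  have E: "1 \<le> ?E" by (rule epochs_ge_1[OF assms])
  have "real ?E \<le> real T"
    using epochs_bounds(1)[OF assms] log_le_self[of T] log_T_ge_2[OF assms] assms by linarith
  then have ET: "?E \<le> T" by simp
  have n1: "1 \<le> per_epoch T" unfolding per_epoch_def using E ET by (simp add: Suc_le_eq div_greater_zero_iff)
  have "T = ?E * per_epoch T + T mod ?E" by (simp add: per_epoch_def)
  also have "T mod ?E \<le> ?E * per_epoch T"
    using mod_less_divisor[of ?E T] E n1 by (metis less_le_not_le less_one linorder_not_le mult.right_neutral mult_le_mono2 nat_less_le order_trans)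
  finally have "real T \<le> 2 * real ?E * real (per_epoch T)"
    by (metis (mono_tags) add_left_mono mult_2 of_nat_le_iff of_nat_mult of_nat_numeral mult.assoc)
  also have "\<dots> \<le> log 2 (real T) * real (per_epoch T)"
    using epochs_bounds(1)[OF assms] by (intro mult_right_mono) auto
  finally show ?thesis .
qed

lemma per_epoch_le: "per_epoch T \<le> T"
  by (simp add: per_epoch_def)

text \<open>Without rounding, r to the power (log T) / 2 is exactly \<open>T\<close> to the power -
  l/2; rounding the number of epochs costs at most one factor 1/r.\<close>

lemma power_epochs:
  fixes r :: real
  assumes r: "0 < r" "r < 1/2" and T: "4 \<le> T"
  defines "l \<equiv> log 2 (1 / r)"
  shows "real T powr (- l / 2) \<le> r ^ epochs T" "r ^ epochs T \<le> real T powr (- l / 2) / r"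
proof -
  have T0: "0 < real T" using T by simp
  have eq: "real T powr (- l / 2) = r powr (log 2 (real T) / 2)"
  proof -
    have "ln (real T powr (- l / 2)) = ln (r powr (log 2 (real T) / 2))"
      using r T0 by (simp add: ln_powr l_def log_def ln_div)
    then show ?thesis using r T0 by (subst (asm) ln_inj_iff) auto
  qed
  have pw: "r ^ epochs T = r powr real (epochs T)" using r by (simp add: powr_realpow)
  show "real T powr (- l / 2) \<le> r ^ epochs T"
    unfolding eq pw using epochs_bounds(1)[OF T] r by (intro powr_mono') auto
  have "r powr real (epochs T) \<le> r powr (log 2 (real T) / 2 - 1)"
    using epochs_bounds(2)[OF T] r by (intro powr_mono') auto
  also have "\<dots> = r powr (log 2 (real T) / 2) / r" using r by (simp add: powr_diff)
  finally show "r ^ epochs T \<le> real T powr (- l / 2) / r" unfolding eq pw .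
qed

text \<open>This is the purpose of the factor E (1 + log (1/r)) in the band width: even after
  division by the last radius the tail is O(T^(-1/2)). The comparison 1/2 - 3/4 (1 + l) <= - l/2 -
  1/2 amounts to l >= 1, that is, r <= 1/2.\<close>

lemma tail_negligible:
  fixes r :: real
  assumes r: "0 < r" "r < 1/2" and T: "4 \<le> T" and d: "d \<le> T"
  defines "l \<equiv> log 2 (1 / r)"
  shows "4 * sqrt (2 * real d) * exp (- 3/2 * (real (epochs T) * (1 + l)))
    \<le> r ^ epochs T * (6 * exp (3/2 * (1 + l)) * real T powr (-1/2))"
proof -
  have T0: "1 \<le> real T" using T by simp
  have l1: "1 \<le> l" unfolding l_def using r by (subst le_log_iff) (auto simp: field_simps)
  have "- 3/2 * (real (epochs T) * (1 + l)) \<le> 3/2 * (1 + l) - 3/4 * (1 + l) * log 2 (real T)"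
    using mult_right_mono[OF epochs_bounds(2)[OF T], of "3/2 * (1 + l)"] l1 by (simp add: algebra_simps)
  also have "\<dots> \<le> 3/2 * (1 + l) - 3/4 * (1 + l) * ln (real T)"
  proof -
    have "ln (2::real) \<le> 1" using ln_le_minus_one[of "2::real"] by simp
    then have "ln (real T) \<le> log 2 (real T)" using T0
      by (simp add: log_def le_divide_eq mult_left_le)
    then show ?thesis using l1 by (intro diff_left_mono mult_left_mono) auto
  qed
  finally have "exp (- 3/2 * (real (epochs T) * (1 + l))) \<le> exp (3/2 * (1 + l)) * exp (- (3/4 * (1 + l) * ln (real T)))"
    by (simp add: exp_add[symmetric])
  also have "exp (- (3/4 * (1 + l) * ln (real T))) = real T powr (- (3/4 * (1 + l)))"
    using T0 by (simp add: powr_def)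
  finally have ex: "exp (- 3/2 * (real (epochs T) * (1 + l))) \<le> exp (3/2 * (1 + l)) * real T powr (- (3/4 * (1 + l)))" .
  have "sqrt (2 * real d) \<le> 3/2 * real T powr (1/2)"
  proof -
    have "sqrt 2 \<le> 3/2" by (intro real_le_lsqrt) (auto simp: power2_eq_square)
    then have "sqrt 2 * sqrt (real d) \<le> 3/2 * sqrt (real T)" using d by (intro mult_mono) auto
    then show ?thesis using T0 by (simp add: real_sqrt_mult powr_half_sqrt)
  qed
  then have "4 * sqrt (2 * real d) * exp (- 3/2 * (real (epochs T) * (1 + l)))
     \<le> 4 * (3/2 * real T powr (1/2)) * (exp (3/2 * (1 + l)) * real T powr (- (3/4 * (1 + l))))"
    using ex by (intro mult_mono) auto
  also have "\<dots> = 6 * exp (3/2 * (1 + l)) * real T powr (1/2 - 3/4 * (1 + l))"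
  proof -
    have "real T powr (1/2) * real T powr (- (3/4 * (1 + l))) = real T powr (1/2 - 3/4 * (1 + l))"
      unfolding powr_add[symmetric] by simp
    then show ?thesis by simp
  qed
  also have "\<dots> \<le> 6 * exp (3/2 * (1 + l)) * real T powr (- l / 2 - 1/2)"
  proof (intro mult_left_mono powr_mono)
    show "1/2 - 3/4 * (1 + l) \<le> - l / 2 - 1/2" using l1 by (simp add: field_simps)
  qed (use T0 in auto)
  also have "\<dots> = real T powr (- l / 2) * (6 * exp (3/2 * (1 + l)) * real T powr (-1/2))"
    proof -
    have "real T powr (- l / 2 - 1/2) = real T powr (- l / 2) * real T powr (-1/2)"
      unfolding powr_add[symmetric] by simp
    then show ?thesis by simp
  qed
  also have "\<dots> \<le> r ^ epochs T * (6 * exp (3/2 * (1 + l)) * real T powr (-1/2))"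
    using power_epochs(1)[OF r T] by (intro mult_right_mono) (auto simp: l_def)
  finally show ?thesis .
qed

text \<open>The constant 4 q + 40 in \<open>L\<close> originates here. The number of events is at
  most \<open>T\<close> to the power 3 + 2 d (q + 11) + 2 (q + 6), from 8 E, from the two grid
  vectors of a cell and from the windows; this exponent is at most (4 q + 40) d. The share of log
  (1/\<delta>) in \<open>L\<close> pays for \<open>\<delta>\<close>.\<close>

lemma union_bound_le:
  fixes \<delta> :: real
  assumes T: "4 \<le> T" and d: "4 \<le> d" and \<delta>: "0 < \<delta>" "\<delta> < 1" and E: "E \<le> T" and N: "N \<le> T ^ (q + 5)"
  shows "real (4 * E * (2 * T ^ (q + 10) + 1) ^ (2 * d)) * (real N + 1)\<^sup>2 * 2
     * exp (- (real (4 * q + 40) * (real d + log 2 (1 / \<delta>)) * log 2 (real T))) \<le> \<delta>"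
proof -
  define P where "P = 3 + (q + 11) * (2 * d) + (q + 6) * 2"
  have T1: "1 \<le> real T" "0 < T" using T by auto
  have lT: "2 \<le> log 2 (real T)" by (rule log_T_ge_2[OF T])
  have ln2: "0 < ln (2::real)" "ln (2::real) \<le> 1" using ln_le_minus_one[of "2::real"] by auto
  have lnT: "ln (real T) \<le> log 2 (real T)" using T1 ln2 by (simp add: log_def le_divide_eq mult_left_le)
  have "1 / \<delta> \<ge> 1" using \<delta> by simp
  then have lnd0: "0 \<le> ln (1 / \<delta>)" by simp
  then have lnd: "ln (1 / \<delta>) \<le> log 2 (1 / \<delta>)" "0 \<le> log 2 (1 / \<delta>)"
    using ln2 by (auto simp: log_def le_divide_eq mult_left_le)
  have "4 ^ 2 \<le> T ^ 2" using T by (rule power_mono) simp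
  then have "8 * E \<le> T ^ 2 * T" using E by (intro mult_mono) auto
  then have a1: "8 * E \<le> T ^ 3" by (simp add: power3_eq_cube power2_eq_square)
  have "1 \<le> T ^ (q + 10)" "1 \<le> T ^ (q + 5)" using T1 by auto
  then have "2 * T ^ (q + 10) + 1 \<le> 4 * T ^ (q + 10)" "N + 1 \<le> 4 * T ^ (q + 5)" using N by linarith+
  moreover have "4 * T ^ (q + 10) \<le> T ^ (q + 11)" "4 * T ^ (q + 5) \<le> T ^ (q + 6)"
  proof -
    have "T ^ (q + 11) = T * T ^ (q + 10)" "T ^ (q + 6) = T * T ^ (q + 5)" by (simp_all add: add.commute flip: power_Suc)
    then show "4 * T ^ (q + 10) \<le> T ^ (q + 11)" "4 * T ^ (q + 5) \<le> T ^ (q + 6)"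
      using T by (simp_all only: mult_le_mono1)
  qed
  ultimately have a2: "2 * T ^ (q + 10) + 1 \<le> T ^ (q + 11)" and a3: "N + 1 \<le> T ^ (q + 6)"
    by linarith+
  have "8 * E * (2 * T ^ (q + 10) + 1) ^ (2 * d) * (N + 1) ^ 2
      \<le> T ^ 3 * (T ^ (q + 11)) ^ (2 * d) * (T ^ (q + 6)) ^ 2"
    by (intro mult_mono a1 power_mono a2 a3) auto
  also have "\<dots> = T ^ P" unfolding P_def power_add power_mult ..
  finally have "real (8 * E * (2 * T ^ (q + 10) + 1) ^ (2 * d) * (N + 1) ^ 2) \<le> real T ^ P"
    unfolding of_nat_power[symmetric] of_nat_le_iff .
  also have "\<dots> = exp (real P * ln (real T))" using T1 by (simp add: exp_of_nat_mult)
  finally have main: "real (8 * E * (2 * T ^ (q + 10) + 1) ^ (2 * d) * (N + 1) ^ 2) \<le> exp (real P * ln (real T))" .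
  have "(2 * q + 18) * 1 \<le> (2 * q + 18) * d" using d by (intro mult_le_mono2) simp
  then have "2 * q + 15 \<le> (2 * q + 18) * d" by (rule order_trans[rotated]) simp
  then have "P \<le> (4 * q + 40) * d" unfolding P_def by (simp add: algebra_simps)
  then have "real P \<le> real (4 * q + 40) * real d" unfolding of_nat_mult[symmetric] of_nat_le_iff .
  then have p1: "real P * ln (real T) \<le> (real (4 * q + 40) * real d) * log 2 (real T)"
    using lnT T1 by (intro mult_mono) auto
  have "1 * ln (1 / \<delta>) * 1 \<le> real (4 * q + 40) * log 2 (1 / \<delta>) * log 2 (real T)"
    using lnd lnd0 lT by (intro mult_mono) auto
  then have "real P * ln (real T) - real (4 * q + 40) * (real d + log 2 (1 / \<delta>)) * log 2 (real T) \<le> - ln (1 / \<delta>)"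
    using p1 by (simp add: algebra_simps)
  also have "- ln (1 / \<delta>) = ln \<delta>" using \<delta> by (simp add: ln_div)
  finally have "exp (real P * ln (real T) + - (real (4 * q + 40) * (real d + log 2 (1 / \<delta>)) * log 2 (real T))) \<le> exp (ln \<delta>)"
    by simp
  then have fin: "exp (real P * ln (real T)) * exp (- (real (4 * q + 40) * (real d + log 2 (1 / \<delta>)) * log 2 (real T))) \<le> \<delta>"
    using \<delta> by (simp only: exp_add exp_ln)
  have eq: "real (4 * E * (2 * T ^ (q + 10) + 1) ^ (2 * d)) * (real N + 1)\<^sup>2 * 2
      = real (8 * E * (2 * T ^ (q + 10) + 1) ^ (2 * d) * (N + 1) ^ 2)" by simp
  show ?thesis unfolding eq by (rule order_trans[OF mult_right_mono[OF main] fin]) simp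
qed

lemma sqrt_le_of_nat: "sqrt (real n) \<le> real n"
proof -
  have "real n \<le> (real n)\<^sup>2"
    unfolding of_nat_power[symmetric] of_nat_le_iff by (simp add: power2_nat_le_imp_le power2_eq_square)
  then show ?thesis by (rule real_le_lsqrt[rotated]) simp
qed

text \<open>The exponent q + 10 is 3 + 2 + (q + 5): a constant 32 <= T^3, the square of d, and the
  length \<open>N\<close>.\<close>

lemma grid_fine_enough:
  fixes T d N q :: nat
  assumes T: "4 \<le> T" and d: "d \<le> T" and N: "N \<le> T ^ (q + 5)"
  shows "16 * sqrt (2 * real d) * (real d / real (T ^ (q + 10))) * real N \<le> 1"
proof -
  have T1: "0 < real T" using T by simp
  have sd: "sqrt (2 * real d) \<le> 2 * real d" using sqrt_le_of_nat[of "2 * d"] by simp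
  have "4 ^ 3 \<le> T ^ 3" using T by (rule power_mono) simp
  then have "32 \<le> T ^ 3" by simp
  then have "32 * (d * d) * N \<le> T ^ 3 * (T * T) * T ^ (q + 5)" using d N by (intro mult_mono) auto
  also have "\<dots> = T ^ (q + 10)" by (simp add: power_add power2_eq_square numeral_eq_Suc)
  finally have "real (32 * (d * d) * N) \<le> real (T ^ (q + 10))" by (rule of_nat_mono)
  have "16 * sqrt (2 * real d) * (real d / real (T ^ (q + 10))) * real N
      \<le> 16 * (2 * real d) * (real d / real (T ^ (q + 10))) * real N"
    using sd by (intro mult_right_mono mult_left_mono) auto
  also have "\<dots> = real (32 * (d * d) * N) / real (T ^ (q + 10))" by simp
  also have "\<dots> \<le> 1" using \<open>real (32 * (d * d) * N) \<le> _\<close> T1 by (simp add: divide_le_eq)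
  finally show ?thesis .
qed

text \<open>The last radius is at least \<open>T\<close> to the power - q, and 16 d n <= T^4 with n
  the sample size; hence windows of length T^(q + 4).\<close>

lemma window_long_enough:
  fixes r :: real
  assumes r: "0 < r" "r < 1/2" and T: "4 \<le> T" and d: "d \<le> T" and q: "log 2 (1 / r) \<le> real q"
  shows "8 * sqrt (2 * real d) * real (per_epoch T) \<le> real (T ^ (q + 4)) * r ^ epochs T"
proof -
  have T1: "1 \<le> real T" using T by simp
  have l0: "0 < log 2 (1 / r)" using r by simp
  have sd: "sqrt (2 * real d) \<le> 2 * real d" using sqrt_le_of_nat[of "2 * d"] by simp
  have "4 ^ 2 \<le> T ^ 2" using T by (rule power_mono) simp
  then have "16 * d * per_epoch T \<le> T ^ 2 * T * T" using d per_epoch_le[of T] by (intro mult_mono) auto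
  also have "\<dots> = T ^ 4" by (simp add: numeral_eq_Suc)
  finally have "real (16 * d * per_epoch T) \<le> real (T ^ 4)" by (rule of_nat_mono)
  then have "8 * (2 * real d) * real (per_epoch T) \<le> real T ^ 4" by simp
  moreover have "8 * sqrt (2 * real d) * real (per_epoch T) \<le> 8 * (2 * real d) * real (per_epoch T)"
    using sd by (intro mult_right_mono mult_left_mono) auto
  moreover have "real T ^ 4 \<le> real (T ^ (q + 4)) * r ^ epochs T"
  proof -
    have "real T powr (- real q) \<le> real T powr (- log 2 (1 / r) / 2)"
      using q l0 T1 by (intro powr_mono) auto
    also have "\<dots> \<le> r ^ epochs T" by (rule power_epochs(1)[OF r T])
    finally have "real (T ^ (q + 4)) * real T powr (- real q) \<le> real (T ^ (q + 4)) * r ^ epochs T"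
      by (intro mult_left_mono) auto
    moreover have "real T powr (- real q) = 1 / real T ^ q" using T1 by (simp add: powr_minus_divide powr_realpow)
    ultimately show ?thesis using T1 by (simp add: power_add)
  qed
  ultimately show ?thesis by linarith
qed

section \<open>One good event for the whole run\<close>

context label_model
begin

text \<open>The event is chosen before the selector \<open>sel\<close>, the start vector and
  \<open>u\<close>, so no measurability of \<open>sel\<close> is involved.\<close>

lemma algorithm_good_event:
  fixes r \<delta> :: real
  assumes r: "0 < r" "r < 1/2" and d4: "4 \<le> d" and T: "4 \<le> T" and \<delta>: "0 < \<delta>" "\<delta> < 1"
    and q: "log 2 (1 / r) \<le> real q"
  defines "l \<equiv> log 2 (1 / r)"
    and "L \<equiv> real (4 * q + 40) * (real d + log 2 (1 / \<delta>)) * log 2 (real T)"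
  defines "\<epsilon> \<equiv> 78 * sqrt (real (epochs T) * (1 + l)) * sqrt (L / real (per_epoch T))
      + 6 * exp (3/2 * (1 + l)) * real T powr (-1/2)"
  assumes n: "64 * L \<le> real (per_epoch T)"
  obtains A where "A \<in> sets (stream_meas d eta)" "1 - \<delta> \<le> measure (stream_meas d eta) A"
    "\<And>s sel w0 k u. s \<in> A \<Longrightarrow> is_erm d sel \<Longrightarrow> w0 \<in> unit_vecs d \<Longrightarrow> k < epochs T \<Longrightarrow>
      fst (alg_run d T r sel w0 s k) \<in> unit_vecs d \<and>
      fst (alg_run d T r sel w0 s (Suc k)) \<in> unit_vecs d \<and>
      (u \<in> ball_theta d (fst (alg_run d T r sel w0 s k)) (r ^ k * pi) \<longrightarrow>
        err d eta (fst (alg_run d T r sel w0 s (Suc k))) \<le> err d eta u + r ^ k * pi * \<epsilon>)"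
proof -
  have lT: "2 \<le> log 2 (real T)" by (rule log_T_ge_2[OF T])
  have ld: "0 \<le> log 2 (1 / \<delta>)" using \<delta> by simp
  have dL: "real d \<le> L"
  proof -
    have "1 * real d * 1 \<le> L" unfolding L_def using lT ld by (intro mult_mono) auto
    then show ?thesis by simp
  qed
  have L1: "1 \<le> L" using dL d4 by simp
  \<comment> \<open>The sample-size hypothesis yields d <= L <= n <= T, so no separate assumption
    relating d and \<open>T\<close> is required.\<close>
  have "real d \<le> real T" using dL n per_epoch_le[of T] L1 by linarith
  then have dT: "d \<le> T" by simp
  have ET: "epochs T \<le> T"
    using epochs_bounds(1)[OF T] log_le_self[of T] lT T by linarith
  define M where "M = T ^ (q + 4)"
  define N where "N = epochs T * M"
  have N: "N \<le> T ^ (q + 5)"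
    using mult_right_mono[OF ET, of "T ^ (q + 4)"] by (simp add: N_def M_def numeral_eq_Suc)
  have cb: "card (band_width d T r ` {..<epochs T}) \<le> epochs T" using card_image_le[of "{..<epochs T}"] by simp
  have K: "0 < T ^ (q + 10)" using T by simp
  obtain A where A: "A \<in> sets (stream_meas d eta)"
    "1 - real (4 * card (band_width d T r ` {..<epochs T}) * (2 * T ^ (q + 10) + 1) ^ (2 * d)) * (real N + 1)\<^sup>2 * 2 * exp (- L)
       \<le> measure (stream_meas d eta) A"
    "\<And>s i. s \<in> A \<Longrightarrow> s i \<in> space (PXY d eta) \<and> sqnorm d (fst (s i)) \<le> 1"
    "\<And>s w v b c p m. s \<in> A \<Longrightarrow> sqnorm d w = 1 \<Longrightarrow> sqnorm d v = 1 \<Longrightarrow> b \<in> band_width d T r ` {..<epochs T} \<Longrightarrow> c \<in> {0, 2} \<Longrightarrow>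
       p \<le> N \<Longrightarrow> m \<le> N \<Longrightarrow>
       \<bar>hits s {p..<p+m} (cell w b v c) - real m * XY.prob (cell w b v c)\<bar>
     \<le> 2 * sqrt (real m * XY.prob (cell w b v c) * L) + 5 * L"
    by (rule good_event[OF _ K L1 grid_fine_enough[OF T dT N], of "band_width d T r ` {..<epochs T}"])
      (simp, rule that)
  show ?thesis
  proof (rule that[OF A(1)])
    have "card (band_width d T r ` {..<epochs T}) \<le> T" using cb ET by linarith
    from union_bound_le[OF T d4 \<delta> this N]
    show "1 - \<delta> \<le> measure (stream_meas d eta) A" using A(2) unfolding L_def by linarith
    fix s sel w0 k u
    assume s: "s \<in> A" and sel: "is_erm d sel" and w0: "w0 \<in> unit_vecs d" and k: "k < epochs T"
    have tau: "0 \<le> 6 * exp (3/2 * (1 + log 2 (1 / r))) * real T powr (-1/2)" by simp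
    note run = alg_epochs[OF r d4 T sel w0 A(3)[OF s, THEN conjunct1] A(3)[OF s, THEN conjunct2]
        A(4)[OF s, unfolded N_def] n L1 window_long_enough[OF r T dT q, folded M_def]
        tail_negligible[OF r T dT] tau k]
    show "fst (alg_run d T r sel w0 s k) \<in> unit_vecs d \<and>
      fst (alg_run d T r sel w0 s (Suc k)) \<in> unit_vecs d \<and>
      (u \<in> ball_theta d (fst (alg_run d T r sel w0 s k)) (r ^ k * pi) \<longrightarrow>
        err d eta (fst (alg_run d T r sel w0 s (Suc k))) \<le> err d eta u + r ^ k * pi * \<epsilon>)"
      unfolding \<epsilon>_def l_def
    proof (intro conjI impI)
      show "fst (alg_run d T r sel w0 s (Suc k)) \<in> unit_vecs d"
        using run(2) unfolding ball_theta_def by blast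
    qed (rule run(1) run(3); assumption)+
  qed
qed

end

section \<open>Exponents of the final rate\<close>

lemma unit_vecs_vangle_pi:
  assumes "v \<in> unit_vecs d" "w \<in> unit_vecs d"
  shows "0 \<le> vangle d v w" "vangle d v w \<le> pi"
  using vangle_bounds[OF unit_vecs_sqnorm[OF assms(1)] unit_vecs_sqnorm[OF assms(2)]] by auto

text \<open>The lower bound on \<open>\<alpha>\<close> is equivalent to (1 - \<alpha>) / \<alpha> <=
  log (1/r). So the factor from the last radius is at most (1/T) powr ((1 - \<alpha>) / (2
  \<alpha>)), hence at most the same power of \<open>X\<close>, and the exponents add up to 1 / (2
  \<alpha>).\<close>

lemma exponent_arith:
  fixes X \<alpha> r :: real
  assumes \<alpha>: "1 / (1 + log 2 (1 / r)) \<le> \<alpha>" "\<alpha> < 1" and r: "0 < r" "r < 1/2" and T: "4 \<le> T"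
    and X: "1 / real T \<le> X"
  shows "real T powr (- log 2 (1 / r) / 2) * X powr (1/2) \<le> X powr (1 / (2 * \<alpha>))"
proof -
  define l where "l = log 2 (1 / r)"
  have T0: "1 \<le> real T" using T by simp
  have X0: "0 < X" using X T0 by (meson divide_pos_pos less_le_trans zero_less_one)
  have l0: "0 < l" using r by (simp add: l_def)
  have a0: "0 < \<alpha>" using \<alpha>(1) l0 unfolding l_def[symmetric]
    by (meson add_pos_pos divide_pos_pos less_le_trans zero_less_one)
  have "1 \<le> \<alpha> * (1 + l)" using \<alpha>(1) l0 unfolding l_def[symmetric] by (simp add: divide_le_eq)
  then have "(1 - \<alpha>) / \<alpha> \<le> l" using a0 by (simp add: divide_le_eq algebra_simps)
  then have "- l / 2 \<le> - ((1 - \<alpha>) / (2 * \<alpha>))" using a0 by (simp add: field_simps)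
  then have "real T powr (- l / 2) \<le> real T powr (- ((1 - \<alpha>) / (2 * \<alpha>)))" using T0 by (intro powr_mono) auto
  also have "\<dots> = (1 / real T) powr ((1 - \<alpha>) / (2 * \<alpha>))" using T0 by (simp add: powr_minus_divide powr_divide)
  also have "\<dots> \<le> X powr ((1 - \<alpha>) / (2 * \<alpha>))" by (rule powr_mono2) (use a0 \<alpha>(2) X T0 in auto)
  finally have "real T powr (- l / 2) * X powr (1/2) \<le> X powr ((1 - \<alpha>) / (2 * \<alpha>)) * X powr (1/2)"
    by (intro mult_right_mono) auto
  also have "\<dots> = X powr ((1 - \<alpha>) / (2 * \<alpha>) + 1/2)" by (simp add: powr_add)
  also have "(1 - \<alpha>) / (2 * \<alpha>) + 1/2 = 1 / (2 * \<alpha>)" using a0 by (simp add: field_simps)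
  finally show ?thesis by (simp add: l_def)
qed

text \<open>The exponent of \<epsilon> is 1 + (1 - \<alpha>) / \<alpha> = 1 / \<alpha>; the
  remaining factor depends on \<open>\<mu>\<close>, \<open>r\<close> and \<open>\<alpha>\<close>
  only.\<close>

lemma critical_scale_value:
  fixes \<epsilon> \<mu> r \<alpha> :: real
  assumes "0 < \<epsilon>" "0 < \<mu>" "0 < r" "0 < \<alpha>"
  shows "\<epsilon> * ((\<epsilon> / \<mu>) powr (1 - \<alpha>) / r) powr (1 / \<alpha>)
    = (1 / \<mu> powr (1 - \<alpha>) / r) powr (1 / \<alpha>) * \<epsilon> powr (1 / \<alpha>)"
proof -
  have "((\<epsilon> / \<mu>) powr (1 - \<alpha>) / r) powr (1 / \<alpha>)
      = ((1 / \<mu> powr (1 - \<alpha>) / r) * \<epsilon> powr (1 - \<alpha>)) powr (1 / \<alpha>)"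
    using assms by (simp add: powr_divide)
  also have "\<dots> = (1 / \<mu> powr (1 - \<alpha>) / r) powr (1 / \<alpha>) * \<epsilon> powr ((1 - \<alpha>) / \<alpha>)"
    using assms by (subst powr_mult) (auto simp: powr_powr)
  finally have "\<epsilon> * ((\<epsilon> / \<mu>) powr (1 - \<alpha>) / r) powr (1 / \<alpha>)
      = (1 / \<mu> powr (1 - \<alpha>) / r) powr (1 / \<alpha>) * (\<epsilon> powr 1 * \<epsilon> powr ((1 - \<alpha>) / \<alpha>))"
    using assms by simp
  also have "\<epsilon> powr 1 * \<epsilon> powr ((1 - \<alpha>) / \<alpha>) = \<epsilon> powr (1 / \<alpha>)"
    unfolding powr_add[symmetric] using assms by (simp add: field_simps)
  finally show ?thesis .
qed

text \<open>With X = (d + log (1/\<delta>)) / T the inner numerator is \<open>L\<close>. The sample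
  size is at least T / log T, so \<open>L\<close> divided by it is at most c X (log T)^2; the
  T^(-1/2) term is dominated because X >= 1/T.\<close>

lemma epoch_error_le:
  fixes r X c :: real
  assumes r: "0 < r" "r < 1/2" and T: "4 \<le> T" and X: "1 / real T \<le> X" and c: "0 \<le> c"
    and n: "0 < per_epoch T"
  defines "l \<equiv> log 2 (1 / r)"
  shows "78 * sqrt (real (epochs T) * (1 + l)) * sqrt ((c * (X * real T) * log 2 (real T)) / real (per_epoch T))
      + 6 * exp (3/2 * (1 + l)) * real T powr (-1/2)
    \<le> (78 * sqrt (1 + l) * sqrt c + 6 * exp (3/2 * (1 + l))) * (log 2 (real T) ^ 2 * sqrt X)"
proof -
  define LT where "LT = log 2 (real T)"
  have T0: "0 < real T" using T by simp
  have X0: "0 < X" using X T0 by (meson divide_pos_pos less_le_trans zero_less_one)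
  have LT: "2 \<le> LT" unfolding LT_def by (rule log_T_ge_2[OF T])
  have l0: "0 < l" using r by (simp add: l_def)
  have LT2: "LT * 1 \<le> LT * LT" using LT by (intro mult_left_mono) auto
  have "real (epochs T) * (1 + l) \<le> (LT * LT) * (1 + l)"
  proof (rule mult_right_mono)
    show "real (epochs T) \<le> LT * LT" using epochs_bounds(1)[OF T] LT LT2 unfolding LT_def by linarith
  qed (use l0 in simp)
  then have "sqrt (real (epochs T) * (1 + l)) \<le> sqrt ((LT * LT) * (1 + l))" by simp
  also have "\<dots> = LT * sqrt (1 + l)" using LT by (simp add: real_sqrt_mult)
  finally have s1: "sqrt (real (epochs T) * (1 + l)) \<le> LT * sqrt (1 + l)" .
  have "c * (X * real T) * LT \<le> c * (X * (LT * real (per_epoch T))) * LT"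
    using per_epoch_ge[OF T] c X0 LT by (intro mult_right_mono mult_left_mono) (auto simp: LT_def)
  then have "(c * (X * real T) * LT) / real (per_epoch T) \<le> c * X * (LT * LT)"
    using n by (simp add: divide_le_eq mult_ac)
  then have "sqrt ((c * (X * real T) * LT) / real (per_epoch T)) \<le> sqrt (c * X * (LT * LT))" by simp
  also have "\<dots> = sqrt c * sqrt X * LT" using LT by (simp add: real_sqrt_mult)
  finally have s2: "sqrt ((c * (X * real T) * LT) / real (per_epoch T)) \<le> sqrt c * sqrt X * LT" .
  have "78 * sqrt (real (epochs T) * (1 + l)) * sqrt ((c * (X * real T) * LT) / real (per_epoch T))
      \<le> 78 * (LT * sqrt (1 + l)) * (sqrt c * sqrt X * LT)"
    using s1 s2 LT l0 c X0 T0 by (intro mult_mono) (auto simp: LT_def)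
  then have a: "78 * sqrt (real (epochs T) * (1 + l)) * sqrt ((c * (X * real T) * LT) / real (per_epoch T))
      \<le> (78 * sqrt (1 + l) * sqrt c) * (LT ^ 2 * sqrt X)" by (simp add: power2_eq_square mult_ac)
  have "real T powr (-1/2) = sqrt (1 / real T)"
    using T0 by (simp add: powr_minus_divide powr_half_sqrt real_sqrt_divide)
  also have "\<dots> \<le> 1 * sqrt X" using X by simp
  also have "1 * sqrt X \<le> LT ^ 2 * sqrt X"
    using LT X0 by (intro mult_right_mono one_le_power) auto
  finally have "6 * exp (3/2 * (1 + l)) * real T powr (-1/2) \<le> 6 * exp (3/2 * (1 + l)) * (LT ^ 2 * sqrt X)"
    by (intro mult_left_mono) auto
  with a show ?thesis unfolding LT_def[symmetric] distrib_right by linarith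
qed

text \<open>The radius term is \<open>exponent_arith\<close>; one factor 1/r is due to rounding the
  number of epochs, the other to the exponent \<open>epochs T - 1\<close>. The critical term is of
  order \<epsilon> powr (1/\<alpha>), where sqrt X becomes X powr (1 / (2 \<alpha>)) and k >=
  2/\<alpha> absorbs the logarithms.\<close>

lemma excess_rate:
  fixes r \<mu> \<alpha> :: real
  assumes r: "0 < r" "r < 1/2" and \<mu>: "0 < \<mu>" and \<alpha>: "1 / (1 + log 2 (1 / r)) \<le> \<alpha>" "\<alpha> < 1"
    and T: "4 \<le> T" and X: "1 / real T \<le> X" and C1: "0 < C1" and k: "2 / \<alpha> \<le> real k"
  defines "\<epsilon> \<equiv> C1 * (log 2 (real T) ^ 2 * sqrt X)"
  shows "\<epsilon> * max (r ^ (epochs T - 1) * pi) (2 * ((\<epsilon> / \<mu>) powr (1 - \<alpha>) / r) powr (1 / \<alpha>))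
    \<le> (C1 * pi / r\<^sup>2 + 2 * (1 / \<mu> powr (1 - \<alpha>) / r) powr (1 / \<alpha>) * C1 powr (1 / \<alpha>))
        * log 2 (real T) ^ k * X powr (1 / (2 * \<alpha>))"
proof -
  define LT where "LT = log 2 (real T)"
  have T0: "0 < real T" using T by simp
  have X0: "0 < X" using X T0 by (meson divide_pos_pos less_le_trans zero_less_one)
  have LT: "2 \<le> LT" unfolding LT_def by (rule log_T_ge_2[OF T])
  have l0: "0 < log 2 (1 / r)" using r by simp
  have a0: "0 < \<alpha>" using \<alpha>(1) l0
    by (meson add_pos_pos divide_pos_pos less_le_trans zero_less_one)
  have e: "0 < \<epsilon>" using C1 X0 LT by (simp add: \<epsilon>_def LT_def)
  define Y where "Y = LT ^ k * X powr (1 / (2 * \<alpha>))"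
  have Y0: "0 \<le> Y" using LT by (simp add: Y_def)
  have "2 \<le> 2 / \<alpha>" using a0 \<alpha>(2) by (simp add: le_divide_eq)
  then have k2: "2 \<le> k" using k by linarith
  have A: "\<epsilon> * (r ^ (epochs T - 1) * pi) \<le> (C1 * pi / r\<^sup>2) * Y"
  proof -
    have "r ^ (epochs T - 1) = r ^ epochs T / r"
      using r epochs_ge_1[OF T] by (cases "epochs T") auto
    also have "\<dots> \<le> real T powr (- log 2 (1 / r) / 2) / r / r"
      using power_epochs(2)[OF r T] r by (intro divide_right_mono) auto
    finally have "r ^ (epochs T - 1) \<le> real T powr (- log 2 (1 / r) / 2) / r\<^sup>2" by (simp add: power2_eq_square)
    then have "\<epsilon> * (r ^ (epochs T - 1) * pi) \<le> \<epsilon> * (real T powr (- log 2 (1 / r) / 2) / r\<^sup>2 * pi)"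
      using e by (intro mult_left_mono mult_right_mono) auto
    also have "\<dots> = (C1 * pi / r\<^sup>2) * (LT ^ 2 * (real T powr (- log 2 (1 / r) / 2) * X powr (1/2)))"
      using X0 by (simp add: \<epsilon>_def LT_def powr_half_sqrt mult_ac)
    also have "\<dots> \<le> (C1 * pi / r\<^sup>2) * (LT ^ k * X powr (1 / (2 * \<alpha>)))"
      using exponent_arith[OF \<alpha> r T X] C1 r LT k2
      by (intro mult_left_mono mult_mono power_increasing) auto
    finally show ?thesis by (simp add: Y_def)
  qed
  have B: "\<epsilon> * (2 * ((\<epsilon> / \<mu>) powr (1 - \<alpha>) / r) powr (1 / \<alpha>))
      \<le> (2 * (1 / \<mu> powr (1 - \<alpha>) / r) powr (1 / \<alpha>) * C1 powr (1 / \<alpha>)) * Y"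
  proof -
    have "\<epsilon> powr (1 / \<alpha>) = C1 powr (1 / \<alpha>) * ((LT ^ 2) powr (1 / \<alpha>) * sqrt X powr (1 / \<alpha>))"
      using C1 LT X0 by (simp add: \<epsilon>_def LT_def powr_mult)
    also have "(LT ^ 2) powr (1 / \<alpha>) = LT powr (2 / \<alpha>)"
    proof -
      have "LT ^ 2 = LT powr 2" using LT by (simp add: powr_numeral)
      then show ?thesis by (simp only: powr_powr) simp
    qed
    also have "sqrt X powr (1 / \<alpha>) = X powr (1 / (2 * \<alpha>))"
    proof -
      have "sqrt X = X powr (1/2)" using X0 by (simp add: powr_half_sqrt)
      then show ?thesis by (simp only: powr_powr) simp
    qed
    finally have eq: "\<epsilon> powr (1 / \<alpha>) = C1 powr (1 / \<alpha>) * (LT powr (2 / \<alpha>) * X powr (1 / (2 * \<alpha>)))" .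
    have "LT powr (2 / \<alpha>) \<le> LT powr real k" using LT k by (intro powr_mono) auto
    also have "\<dots> = LT ^ k" using LT by (simp add: powr_realpow)
    finally have "\<epsilon> powr (1 / \<alpha>) \<le> C1 powr (1 / \<alpha>) * Y"
      unfolding eq Y_def by (intro mult_left_mono mult_right_mono) auto
    then have "2 * (1 / \<mu> powr (1 - \<alpha>) / r) powr (1 / \<alpha>) * \<epsilon> powr (1 / \<alpha>)
      \<le> 2 * (1 / \<mu> powr (1 - \<alpha>) / r) powr (1 / \<alpha>) * (C1 powr (1 / \<alpha>) * Y)"
      by (intro mult_left_mono) auto
    then show ?thesis using critical_scale_value[OF e \<mu> r(1) a0] by (simp add: mult_ac)
  qed
  have "0 \<le> (C1 * pi / r\<^sup>2) * Y" using C1 Y0 r by simp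
  moreover have "0 \<le> (2 * (1 / \<mu> powr (1 - \<alpha>) / r) powr (1 / \<alpha>) * C1 powr (1 / \<alpha>)) * Y" using Y0 by simp
  ultimately have "\<epsilon> * max (r ^ (epochs T - 1) * pi) (2 * ((\<epsilon> / \<mu>) powr (1 - \<alpha>) / r) powr (1 / \<alpha>))
     \<le> (C1 * pi / r\<^sup>2) * Y + (2 * (1 / \<mu> powr (1 - \<alpha>) / r) powr (1 / \<alpha>) * C1 powr (1 / \<alpha>)) * Y"
    (is "\<epsilon> * max ?a ?b \<le> _")
  proof (cases "?a \<le> ?b")
    case True
    then have m: "max ?a ?b = ?b" by (rule max_absorb2)
    show ?thesis unfolding m using B \<open>0 \<le> (C1 * pi / r\<^sup>2) * Y\<close> by linarith
  next
    case False
    then have m: "max ?a ?b = ?a" by (intro max_absorb1) linarith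
    show ?thesis unfolding m using A \<open>0 \<le> (2 * _ * _) * Y\<close> by linarith
  qed
  then show ?thesis by (simp add: Y_def LT_def algebra_simps)
qed

text \<open>Too small a sample means that X (log T)^2 is bounded below, so the claimed rate exceeds
  the trivial bound 1 on any excess error.\<close>

lemma short_epoch_rate:
  fixes X c \<alpha> :: real
  assumes T: "4 \<le> T" and X: "0 < X" and c: "0 < c" and \<alpha>: "0 < \<alpha>" and k: "2 / \<alpha> \<le> real k"
    and short: "real (per_epoch T) < 64 * (c * (X * real T) * log 2 (real T))"
  shows "1 \<le> (64 * c) powr (1 / (2 * \<alpha>)) * log 2 (real T) ^ k * X powr (1 / (2 * \<alpha>))"
proof -
  define LT where "LT = log 2 (real T)"
  have T0: "0 < real T" using T by simp
  have LT: "2 \<le> LT" unfolding LT_def by (rule log_T_ge_2[OF T])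
  have "real T \<le> LT * real (per_epoch T)" using per_epoch_ge[OF T] by (simp add: LT_def)
  also have "\<dots> \<le> LT * (64 * (c * (X * real T) * LT))" using short LT by (intro mult_left_mono) (auto simp: LT_def)
  finally have "1 \<le> 64 * c * LT ^ 2 * X" using T0 by (simp add: power2_eq_square mult_ac)
  then have "1 powr (1 / (2 * \<alpha>)) \<le> (64 * c * LT ^ 2 * X) powr (1 / (2 * \<alpha>))"
    using \<alpha> by (intro powr_mono2) auto
  also have "\<dots> = (64 * c) powr (1 / (2 * \<alpha>)) * (LT ^ 2) powr (1 / (2 * \<alpha>)) * X powr (1 / (2 * \<alpha>))"
    using c LT X by (simp add: powr_mult)
  also have "\<dots> \<le> (64 * c) powr (1 / (2 * \<alpha>)) * LT ^ k * X powr (1 / (2 * \<alpha>))"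
  proof (intro mult_right_mono mult_left_mono)
    have "(LT ^ 2) powr (1 / (2 * \<alpha>)) = LT powr (1 / \<alpha>)"
    proof -
      have "LT ^ 2 = LT powr 2" using LT by (simp add: powr_numeral)
      then show ?thesis by (simp only: powr_powr) simp
    qed
    also have "\<dots> \<le> LT powr real k"
    proof (rule powr_mono)
      have "1 / \<alpha> \<le> 2 / \<alpha>" using \<alpha> by (intro divide_right_mono) auto
      then show "1 / \<alpha> \<le> real k" using k by linarith
    qed (use LT in simp)
    also have "\<dots> = LT ^ k" using LT by (simp add: powr_realpow)
    finally show "(LT ^ 2) powr (1 / (2 * \<alpha>)) \<le> LT ^ k" .
  qed auto
  finally show ?thesis by (simp add: LT_def)
qed

theorem theorem1:
  fixes r \<mu> \<alpha> :: real
  assumes "0 < r" "r < 1/2" "0 < \<mu>"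
    and "1 / (1 + log 2 (1 / r)) \<le> \<alpha>" "\<alpha> < 1"
  shows "\<exists>C k::nat. \<forall>(d::nat) (T::nat) (\<delta>::real) eta wstar sel w0.
     4 \<le> d \<longrightarrow> 4 \<le> T \<longrightarrow> 0 < \<delta> \<longrightarrow> \<delta> < 1 \<longrightarrow>
     eta \<in> borel_measurable (PX d) \<longrightarrow> (\<forall>x. 0 \<le> eta x \<and> eta x \<le> 1) \<longrightarrow>
     wstar \<in> unit_vecs d \<longrightarrow> bayes_classifier d eta wstar \<longrightarrow>
     TNC d eta wstar \<mu> \<alpha> \<longrightarrow>
     is_erm d sel \<longrightarrow> w0 \<in> unit_vecs d \<longrightarrow>
     (\<exists>A \<in> sets (stream_meas d eta).
        measure (stream_meas d eta) A \<ge> 1 - \<delta> \<and>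
        (\<forall>s \<in> A. err d eta (alg_output d T r sel w0 s) - err d eta wstar
           \<le> C * (log 2 (real T * real d)) ^ k
               * ((real d + log 2 (1 / \<delta>)) / real T) powr (1 / (2 * \<alpha>))))"
proof -
  define l where "l = log 2 (1 / r)"
  have l0: "0 < l" using assms(1,2) by (simp add: l_def)
  have a0: "0 < \<alpha>" using assms(4) l0 unfolding l_def[symmetric]
    by (meson add_pos_pos divide_pos_pos less_le_trans zero_less_one)
  \<comment> \<open>An integer above log (1/r), so that window lengths and grid sizes are natural
    powers of \<open>T\<close>.\<close>
  define q where "q = nat \<lceil>l\<rceil>"
  have q: "log 2 (1 / r) \<le> real q" using l0 by (simp add: q_def l_def[symmetric] of_nat_ceiling)
  define c where "c = real (4 * q + 40)"
  have c0: "0 < c" by (simp add: c_def)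
  define C1 where "C1 = 78 * sqrt (1 + l) * sqrt c + 6 * exp (3/2 * (1 + l))"
  have C1: "0 < C1" unfolding C1_def using l0 c0 by (intro add_nonneg_pos) auto
  define k where "k = nat \<lceil>2 / \<alpha>\<rceil>"
  have k: "2 / \<alpha> \<le> real k" by (simp add: k_def of_nat_ceiling)
  define C2 where "C2 = C1 * pi / r\<^sup>2 + 2 * (1 / \<mu> powr (1 - \<alpha>) / r) powr (1 / \<alpha>) * C1 powr (1 / \<alpha>)"
  have C2: "0 \<le> C2" using C1 by (simp add: C2_def)
  \<comment> \<open>The sum covers both cases below: \<open>C2\<close> when epochs have enough
    samples, the other summand when they are too short.\<close>
  define C where "C = C2 + (64 * c) powr (1 / (2 * \<alpha>))"
  show ?thesis
  proof (intro exI[of _ C] exI[of _ k] allI impI)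
    fix d T :: nat and \<delta> :: real and eta wstar sel w0
    assume d4: "4 \<le> d" and T: "4 \<le> T" and \<delta>: "0 < \<delta>" "\<delta> < 1"
      and eta: "eta \<in> borel_measurable (PX d)" "\<forall>x. 0 \<le> eta x \<and> eta x \<le> 1"
      and ws: "wstar \<in> unit_vecs d" and "bayes_classifier d eta wstar" and tnc: "TNC d eta wstar \<mu> \<alpha>"
      and sel: "is_erm d sel" and w0: "w0 \<in> unit_vecs d"
    interpret label_model d eta using eta d4 by unfold_locales auto
    interpret S: prob_space "stream_meas d eta"
      unfolding stream_meas_def by (rule prob_space_PiM) (rule XY.prob_space_axioms)
    define X where "X = (real d + log 2 (1 / \<delta>)) / real T"
    have ld: "0 \<le> log 2 (1 / \<delta>)" using \<delta> by simp
    have T0: "0 < real T" using T by simp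
    have X: "1 / real T \<le> X" unfolding X_def using ld d4 by (intro divide_right_mono) auto
    then have X0: "0 < X" using T0 by (meson divide_pos_pos less_le_trans zero_less_one)
    have XT: "X * real T = real d + log 2 (1 / \<delta>)" using T0 by (simp add: X_def)
    have LT: "2 \<le> log 2 (real T)" by (rule log_T_ge_2[OF T])
    have "log 2 (real T) \<le> log 2 (real T * real d)" using T0 d4 by (subst log_le_cancel_iff) auto
    then have LTk: "log 2 (real T) ^ k \<le> log 2 (real T * real d) ^ k" using LT by (intro power_mono) auto
    have widen: "R * log 2 (real T) ^ k * X powr (1 / (2 * \<alpha>)) \<le> C * log 2 (real T * real d) ^ k * X powr (1 / (2 * \<alpha>))"
      if "0 \<le> R" "R \<le> C" for R
      using that LTk LT by (intro mult_right_mono mult_mono) auto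
    define L where "L = real (4 * q + 40) * (real d + log 2 (1 / \<delta>)) * log 2 (real T)"
    have L: "L = c * (X * real T) * log 2 (real T)" unfolding L_def XT c_def ..
    show "\<exists>A \<in> sets (stream_meas d eta).
        measure (stream_meas d eta) A \<ge> 1 - \<delta> \<and>
        (\<forall>s \<in> A. err d eta (alg_output d T r sel w0 s) - err d eta wstar
           \<le> C * (log 2 (real T * real d)) ^ k
               * ((real d + log 2 (1 / \<delta>)) / real T) powr (1 / (2 * \<alpha>)))"
    proof (cases "64 * L \<le> real (per_epoch T)")
      case False
      have "1 \<le> (64 * c) powr (1 / (2 * \<alpha>)) * log 2 (real T) ^ k * X powr (1 / (2 * \<alpha>))"
        by (rule short_epoch_rate[OF T X0 c0 a0 k]) (use False in \<open>simp add: L\<close>)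
      also have "\<dots> \<le> C * log 2 (real T * real d) ^ k * X powr (1 / (2 * \<alpha>))"
        by (rule widen) (use C2 in \<open>auto simp: C_def\<close>)
      finally have one: "1 \<le> C * log 2 (real T * real d) ^ k * X powr (1 / (2 * \<alpha>))" .
      have "err d eta w - err d eta wstar \<le> 1" for w
        using XY.prob_le_1 measure_nonneg unfolding err_def clf_err_def by (smt (verit))
      then have "err d eta w - err d eta wstar \<le> C * log 2 (real T * real d) ^ k * X powr (1 / (2 * \<alpha>))" for w
        using one order_trans by blast
      then show ?thesis using \<delta> S.prob_space
        by (intro bexI[of _ "space (stream_meas d eta)"]) (auto simp: X_def)
    next
      case True
      have L0: "0 < L" unfolding L using c0 X0 T0 LT by (intro mult_pos_pos) linarith+
      then have n0: "0 < per_epoch T" using True by linarith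
      define \<epsilon> where "\<epsilon> = C1 * (log 2 (real T) ^ 2 * sqrt X)"
      have e0: "0 < \<epsilon>" using C1 X0 LT by (simp add: \<epsilon>_def)
      have eps: "78 * sqrt (real (epochs T) * (1 + l)) * sqrt (L / real (per_epoch T))
            + 6 * exp (3/2 * (1 + l)) * real T powr (-1/2) \<le> \<epsilon>"
        using epoch_error_le[OF assms(1,2) T X less_imp_le[OF c0] n0]
        unfolding \<epsilon>_def C1_def L l_def .
      obtain A where A: "A \<in> sets (stream_meas d eta)" "1 - \<delta> \<le> measure (stream_meas d eta) A"
        and run: "\<And>s sel w0 k u. s \<in> A \<Longrightarrow> is_erm d sel \<Longrightarrow> w0 \<in> unit_vecs d \<Longrightarrow> k < epochs T \<Longrightarrow>
      fst (alg_run d T r sel w0 s k) \<in> unit_vecs d \<and>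
      fst (alg_run d T r sel w0 s (Suc k)) \<in> unit_vecs d \<and>
      (u \<in> ball_theta d (fst (alg_run d T r sel w0 s k)) (r ^ k * pi) \<longrightarrow>
        err d eta (fst (alg_run d T r sel w0 s (Suc k))) \<le> err d eta u + r ^ k * pi *
          (78 * sqrt (real (epochs T) * (1 + l)) * sqrt (L / real (per_epoch T))
            + 6 * exp (3/2 * (1 + l)) * real T powr (-1/2)))"
        by (rule algorithm_good_event[OF assms(1,2) d4 T \<delta> q True[unfolded L_def], folded L_def l_def])
          (rule that)
      have "err d eta (alg_output d T r sel w0 s) - err d eta wstar
         \<le> C * log 2 (real T * real d) ^ k * X powr (1 / (2 * \<alpha>))" if s: "s \<in> A" for s
      proof -
        define V where "V i = fst (alg_run d T r sel w0 s i)" for i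
        define e where "e i = err d eta (V i) - err d eta wstar" for i
        define \<theta> where "\<theta> i = vangle d (V i) wstar" for i
        have V: "V i \<in> unit_vecs d" if "i \<le> epochs T" for i
        proof (cases i)
          case 0
          then show ?thesis using w0 by (simp add: V_def)
        next
          case (Suc j)
          then show ?thesis using run[OF s sel w0, of j] that by (simp add: V_def del: alg_run.simps)
        qed
        have stepV: "err d eta (V (Suc i)) \<le> err d eta u + r ^ i * pi * \<epsilon>"
          if i: "i < epochs T" and u: "u \<in> ball_theta d (V i) (r ^ i * pi)" for i u
        proof -
          have "0 \<le> r ^ i * pi" using assms(1) by simp
          from mult_left_mono[OF eps this] run[OF s sel w0 i, of u] u show ?thesis
            unfolding V_def by linarith
        qed
        have "e (epochs T) \<le> \<epsilon> * max (r ^ (epochs T - 1) * pi) (2 * ((\<epsilon> / \<mu>) powr (1 - \<alpha>) / r) powr (1 / \<alpha>))"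
        proof (rule excess_recursion[OF assms(1,2,3) a0 assms(5) e0, where \<theta> = \<theta>])
          show "\<theta> 0 \<le> pi" unfolding \<theta>_def by (rule unit_vecs_vangle_pi[OF V ws]) simp
          show "0 \<le> \<theta> i" if "i \<le> epochs T" for i
            unfolding \<theta>_def by (rule unit_vecs_vangle_pi[OF V[OF that] ws])
          show "e (Suc i) \<le> r ^ i * pi * \<epsilon>" if "i < epochs T" "\<theta> i \<le> r ^ i * pi" for i
          proof -
            have "wstar \<in> ball_theta d (V i) (r ^ i * pi)"
              using that ws by (simp add: ball_theta_def \<theta>_def vangle_commute)
            then show ?thesis using stepV[OF that(1)] by (simp add: e_def diff_le_eq add.commute)
          qed
          show "e (Suc i) \<le> e i + r ^ i * pi * \<epsilon>" if "i < epochs T" for i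
          proof -
            have "V i \<in> ball_theta d (V i) (r ^ i * pi)"
              by (rule ball_theta_refl[OF V]) (use that assms(1) in auto)
            from stepV[OF that this] show ?thesis by (simp add: e_def)
          qed
          show "\<mu> * \<theta> i powr (1 / (1 - \<alpha>)) \<le> e i" if "i \<le> epochs T" for i
            using tnc V[OF that] unfolding TNC_def \<theta>_def e_def by blast
          show "1 \<le> epochs T" by (rule epochs_ge_1[OF T])
        qed
        also have "\<dots> \<le> C2 * log 2 (real T) ^ k * X powr (1 / (2 * \<alpha>))"
          unfolding C2_def \<epsilon>_def by (rule excess_rate[OF assms T X C1 k])
        also have "\<dots> \<le> C * log 2 (real T * real d) ^ k * X powr (1 / (2 * \<alpha>))"
          by (rule widen[OF C2]) (simp add: C_def)
        finally show ?thesis by (simp add: e_def V_def alg_output_def)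
      qed
      then show ?thesis using A by (intro bexI[of _ A]) (auto simp: X_def)
    qed
  qed
qed

end
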